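(* Let $\mathbf{k}$ be a field and let $a\in \mathbb{R}$. Consider interval modules over $(\mathbb{R},\le)$. Then: \begin{itemize} \item The interval modules $\mathbf{k}(-\infty,a)$ and $\mathbf{k}(-\infty,a]$ are injective. They are not flat and thus not projective. \item The interval modules $\mathbf{k}[a,\infty)$ are projective (in fact graded free) and the interval modules $\mathbf{k}(a,\infty)$ are flat but not projective. Neither $\mathbf{k}[a,\infty)$ nor $\mathbf{k}(a,\infty)$ is injective. \item The interval module $\mathbf{k}[\mathbb{R}]$ is both injective and flat, but not projective. \item If $I\subset \mathbb{R}$ is a nonempty bounded interval, then $\mathbf{k}[I]$ is neither flat (hence not projective) nor injective. \end{itemize}
   Context: A persistence module is a functor $M:\mathbf{R}\to \mathbf{Vect}_{\mathbf{k}}$ from the poset $(\mathbb{R},\le)$ (viewed as a category) to $\mathbf{k}$-vector spaces; morphisms are natural transformations. Equivalently, $M$ is an $\mathbb{R}$-graded module $\bigoplus_a M_a$ over the monoid ring $\mathbf{k}[U_0]$, $U_0=[0,\infty)$, where $x^s$ acts as $M_{a\le a+s}$. "Injective" and "projective" refer to the abelian category of persistence modules; "graded free" means free over $\mathbf{k}[U_0]$ with a homogeneous basis. For an interval $I\subset\mathbb{R}$, the interval module $\mathbf{k}[I]$ has $\mathbf{k}[I]_x=\mathbf{k}$ for $x\in I$ and $0$ otherwise, with $\mathbf{k}[I]_{x\le y}$ the identity when $x,y\in I$ and zero otherwise; e.g. $\mathbf{k}(-\infty,a]$ abbreviates $\mathbf{k}[(-\infty,a]]$. The graded module tensor product is $(M\otimes_{\mathbf{gr}}N)_r=\operatorname{colim}_{s+t\le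 r}M_s\otimes_{\mathbf{k}}N_t$ (colimit over pairs $(s,t)$ with $s+t\le r$, with the product order). A persistence module $M$ is flat (i.e. $\otimes_{\mathbf{gr}}$-flat) if $-\otimes_{\mathbf{gr}}M$ is an exact functor. *)

theory Defs
  imports "HOL-Algebra.Module" "HOL-Algebra.AbelCoset" "HOL-Analysis.Topology_Euclidean_Space"
begin

section \<open>Linear algebra over a field \<open>K\<close>\<close>

text \<open>
  \<open>K\<close> is always a field in the sense of HOL-Algebra, so that a \<open>K\<close>-vector space is a
  \<open>V\<close> with \<open>Module.module K V\<close>. The fields \<open>mult\<close> and \<open>one\<close>, which the record of modules
  inherits from the record of rings, carry no information.
\<close>

definition linear_maps ::
  "('k, 'x) ring_scheme \<Rightarrow> ('k, 'v) module \<Rightarrow> ('k, 'w) module \<Rightarrow> ('v \<Rightarrow> 'w) set" where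
  "linear_maps K V W = {f \<in> carrier V \<rightarrow> carrier W.
     (\<forall>x\<in>carrier V. \<forall>y\<in>carrier V. f (x \<oplus>\<^bsub>V\<^esub> y) = f x \<oplus>\<^bsub>W\<^esub> f y) \<and>
     (\<forall>c\<in>carrier K. \<forall>x\<in>carrier V. f (c \<odot>\<^bsub>V\<^esub> x) = c \<odot>\<^bsub>W\<^esub> f x)}"

definition regular_space :: "('k, 'x) ring_scheme \<Rightarrow> ('k, 'k) module" where
  "regular_space K = \<lparr>carrier = carrier K, mult = mult K, one = \<one>\<^bsub>K\<^esub>, zero = \<zero>\<^bsub>K\<^esub>,
     add = add K, smult = mult K\<rparr>"

definition submodule_generated ::
  "('k, 'x) ring_scheme \<Rightarrow> ('k, 'v) module \<Rightarrow> 'v set \<Rightarrow> 'v set" where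
  "submodule_generated K V S = \<Inter>{H. submodule H K V \<and> S \<subseteq> H}"

definition quotient_space :: "('k, 'v) module \<Rightarrow> 'v set \<Rightarrow> ('k, 'v set) module" where
  "quotient_space V W = \<lparr>carrier = a_rcosets\<^bsub>V\<^esub> W, mult = undefined, one = undefined, zero = W,
     add = set_add V, smult = (\<lambda>c X. \<Union>x\<in>X. W +>\<^bsub>V\<^esub> (c \<odot>\<^bsub>V\<^esub> x))\<rparr>"

text \<open>
  For a linear \<open>h : V \<rightarrow> V'\<close> with \<open>h W \<subseteq> W'\<close>, the map \<open>V/W \<rightarrow> V'/W'\<close> induced by \<open>h\<close>:
  all the cosets in the union below are then equal.
\<close>

definition quotient_map ::
  "('k, 'w) module \<Rightarrow> 'w set \<Rightarrow> ('v \<Rightarrow> 'w) \<Rightarrow> 'v set \<Rightarrow> 'w set" where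
  "quotient_map V' W' h X = (\<Union>x\<in>X. W' +>\<^bsub>V'\<^esub> h x)"

text \<open>
  The elements of the direct sum of the \<open>D j\<close>, \<open>j \<in> J\<close>, are total functions, zero off \<open>J\<close>;
  \<open>D j\<close> is assumed to be a vector space for every \<open>j\<close>, also off \<open>J\<close>.
\<close>

definition direct_sum :: "'j set \<Rightarrow> ('j \<Rightarrow> ('k, 'v) module) \<Rightarrow> ('k, 'j \<Rightarrow> 'v) module" where
  "direct_sum J D = \<lparr>
     carrier = {u. (\<forall>j\<in>J. u j \<in> carrier (D j)) \<and> (\<forall>j. j \<notin> J \<longrightarrow> u j = \<zero>\<^bsub>D j\<^esub>) \<and>
                   finite {j. u j \<noteq> \<zero>\<^bsub>D j\<^esub>}},
     mult = undefined, one = undefined,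
     zero = (\<lambda>j. \<zero>\<^bsub>D j\<^esub>),
     add = (\<lambda>u v j. u j \<oplus>\<^bsub>D j\<^esub> v j),
     smult = (\<lambda>c u j. c \<odot>\<^bsub>D j\<^esub> u j)\<rparr>"

definition in_summand :: "('j \<Rightarrow> ('k, 'v) module) \<Rightarrow> 'j \<Rightarrow> 'v \<Rightarrow> 'j \<Rightarrow> 'v" where
  "in_summand D j x = (\<lambda>i. \<zero>\<^bsub>D i\<^esub>)(j := x)"

definition free_space :: "('k, 'x) ring_scheme \<Rightarrow> 'a set \<Rightarrow> ('k, 'a \<Rightarrow> 'k) module" where
  "free_space K X = direct_sum X (\<lambda>_. regular_space K)"

definition free_gen :: "('k, 'x) ring_scheme \<Rightarrow> 'a \<Rightarrow> 'a \<Rightarrow> 'k" where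
  "free_gen K x = in_summand (\<lambda>_. regular_space K) x \<one>\<^bsub>K\<^esub>"


subsection \<open>Tensor products of vector spaces\<close>

abbreviation pair_space ::
  "('k, 'x) ring_scheme \<Rightarrow> ('k, 'v) module \<Rightarrow> ('k, 'w) module \<Rightarrow> ('k, 'v \<times> 'w \<Rightarrow> 'k) module" where
  "pair_space K V W \<equiv> free_space K (carrier V \<times> carrier W)"

definition bilinear_relations ::
  "('k, 'x) ring_scheme \<Rightarrow> ('k, 'v) module \<Rightarrow> ('k, 'w) module \<Rightarrow> ('v \<times> 'w \<Rightarrow> 'k) set" where
  "bilinear_relations K V W = (let F = pair_space K V W; e = (\<lambda>x y. free_gen K (x, y)) in
     {e (x \<oplus>\<^bsub>V\<^esub> x') y \<ominus>\<^bsub>F\<^esub> (e x y \<oplus>\<^bsub>F\<^esub> e x' y) |x x' y.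
        x \<in> carrier V \<and> x' \<in> carrier V \<and> y \<in> carrier W} \<union>
     {e x (y \<oplus>\<^bsub>W\<^esub> y') \<ominus>\<^bsub>F\<^esub> (e x y \<oplus>\<^bsub>F\<^esub> e x y') |x y y'.
        x \<in> carrier V \<and> y \<in> carrier W \<and> y' \<in> carrier W} \<union>
     {e (c \<odot>\<^bsub>V\<^esub> x) y \<ominus>\<^bsub>F\<^esub> (c \<odot>\<^bsub>F\<^esub> e x y) |c x y.
        c \<in> carrier K \<and> x \<in> carrier V \<and> y \<in> carrier W} \<union>
     {e x (c \<odot>\<^bsub>W\<^esub> y) \<ominus>\<^bsub>F\<^esub> (c \<odot>\<^bsub>F\<^esub> e x y) |c x y.
        c \<in> carrier K \<and> x \<in> carrier V \<and> y \<in> carrier W})"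

definition tensor_kernel ::
  "('k, 'x) ring_scheme \<Rightarrow> ('k, 'v) module \<Rightarrow> ('k, 'w) module \<Rightarrow> ('v \<times> 'w \<Rightarrow> 'k) set" where
  "tensor_kernel K V W = submodule_generated K (pair_space K V W) (bilinear_relations K V W)"

definition tensor ::
  "('k, 'x) ring_scheme \<Rightarrow> ('k, 'v) module \<Rightarrow> ('k, 'w) module \<Rightarrow>
   ('k, ('v \<times> 'w \<Rightarrow> 'k) set) module" where
  "tensor K V W = quotient_space (pair_space K V W) (tensor_kernel K V W)"

text \<open>\<open>f \<otimes> g : V \<otimes> W \<rightarrow> V' \<otimes> W'\<close>; its argument determines \<open>V\<close> and \<open>W\<close>.\<close>

definition tensor_map ::
  "('k, 'x) ring_scheme \<Rightarrow> ('k, 'v') module \<Rightarrow> ('k, 'w') module \<Rightarrow> ('v \<Rightarrow> 'v') \<Rightarrow> ('w \<Rightarrow> 'w') \<Rightarrow>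
   ('v \<times> 'w \<Rightarrow> 'k) set \<Rightarrow> ('v' \<times> 'w' \<Rightarrow> 'k) set" where
  "tensor_map K V' W' f g = quotient_map (pair_space K V' W') (tensor_kernel K V' W')
     (\<lambda>u. \<Oplus>\<^bsub>pair_space K V' W'\<^esub>p\<in>{p. u p \<noteq> \<zero>\<^bsub>K\<^esub>}.
        u p \<odot>\<^bsub>pair_space K V' W'\<^esub> free_gen K (f (fst p), g (snd p)))"


subsection \<open>Colimits of vector spaces\<close>

text \<open>
  The colimit of a diagram \<open>D\<close> indexed by the set \<open>J\<close> with preorder \<open>leq\<close>, where \<open>\<phi> i j\<close> is the
  map \<open>D i \<rightarrow> D j\<close> for \<open>leq i j\<close>.
\<close>

definition colim_kernel ::
  "('k, 'x) ring_scheme \<Rightarrow> 'j set \<Rightarrow> ('j \<Rightarrow> 'j \<Rightarrow> bool) \<Rightarrow> ('j \<Rightarrow> ('k, 'v) module) \<Rightarrow>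
   ('j \<Rightarrow> 'j \<Rightarrow> 'v \<Rightarrow> 'v) \<Rightarrow> ('j \<Rightarrow> 'v) set" where
  "colim_kernel K J leq D \<phi> = submodule_generated K (direct_sum J D)
     {in_summand D i x \<ominus>\<^bsub>direct_sum J D\<^esub> in_summand D j (\<phi> i j x) |i j x.
        i \<in> J \<and> j \<in> J \<and> leq i j \<and> x \<in> carrier (D i)}"

definition colim ::
  "('k, 'x) ring_scheme \<Rightarrow> 'j set \<Rightarrow> ('j \<Rightarrow> 'j \<Rightarrow> bool) \<Rightarrow> ('j \<Rightarrow> ('k, 'v) module) \<Rightarrow>
   ('j \<Rightarrow> 'j \<Rightarrow> 'v \<Rightarrow> 'v) \<Rightarrow> ('k, ('j \<Rightarrow> 'v) set) module" where
  "colim K J leq D \<phi> = quotient_space (direct_sum J D) (colim_kernel K J leq D \<phi>)"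


section \<open>Persistence modules\<close>

record ('k, 'v) pers =
  pspace :: "real \<Rightarrow> ('k, 'v) module"
  ptrans :: "real \<Rightarrow> real \<Rightarrow> 'v \<Rightarrow> 'v"

definition persistence_module :: "('k, 'x) ring_scheme \<Rightarrow> ('k, 'v) pers \<Rightarrow> bool" where
  "persistence_module K M \<longleftrightarrow>
     (\<forall>a. Module.module K (pspace M a)) \<and>
     (\<forall>a b. a \<le> b \<longrightarrow> ptrans M a b \<in> linear_maps K (pspace M a) (pspace M b)) \<and>
     (\<forall>a. \<forall>x\<in>carrier (pspace M a). ptrans M a a x = x) \<and>
     (\<forall>a b c. a \<le> b \<longrightarrow> b \<le> c \<longrightarrow>
        (\<forall>x\<in>carrier (pspace M a). ptrans M b c (ptrans M a b x) = ptrans M a c x))"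

definition pers_morphism ::
  "('k, 'x) ring_scheme \<Rightarrow> ('k, 'v) pers \<Rightarrow> ('k, 'w) pers \<Rightarrow> (real \<Rightarrow> 'v \<Rightarrow> 'w) \<Rightarrow> bool" where
  "pers_morphism K M N f \<longleftrightarrow>
     (\<forall>a. f a \<in> linear_maps K (pspace M a) (pspace N a)) \<and>
     (\<forall>a b. a \<le> b \<longrightarrow> (\<forall>x\<in>carrier (pspace M a). f b (ptrans M a b x) = ptrans N a b (f a x)))"

definition interval_module :: "('k, 'x) ring_scheme \<Rightarrow> real set \<Rightarrow> ('k, 'k) pers" where
  "interval_module K I = \<lparr>
     pspace = (\<lambda>a. if a \<in> I then regular_space K
                   else (regular_space K)\<lparr>carrier := {\<zero>\<^bsub>K\<^esub>}\<rparr>),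
     ptrans = (\<lambda>a b x. if a \<in> I \<and> b \<in> I then x else \<zero>\<^bsub>K\<^esub>)\<rparr>"


subsection \<open>Injective and projective persistence modules\<close>

text \<open>
  Kernels and cokernels of persistence modules are formed degree by degree; the lemmas
  \<open>pers_mono_iff_cancel\<close> and \<open>pers_epi_iff_cancel\<close> below confirm that the following are the
  monomorphisms and epimorphisms in the categorical sense.
\<close>

definition pers_mono :: "('k, 'v) pers \<Rightarrow> (real \<Rightarrow> 'v \<Rightarrow> 'w) \<Rightarrow> bool" where
  "pers_mono M f \<longleftrightarrow> (\<forall>a. inj_on (f a) (carrier (pspace M a)))"

definition pers_epi :: "('k, 'v) pers \<Rightarrow> ('k, 'w) pers \<Rightarrow> (real \<Rightarrow> 'v \<Rightarrow> 'w) \<Rightarrow> bool" where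
  "pers_epi M N f \<longleftrightarrow> (\<forall>a. f a ` carrier (pspace M a) = carrier (pspace N a))"

text \<open>
  In HOL, a predicate cannot quantify over persistence modules of all types. Therefore the
  notions that quantify over all persistence modules take a type \<open>'v\<close> as an argument and range
  over those whose vector spaces have their elements in \<open>'v\<close>: \<open>'v\<close> plays the role of a universe.
  The module \<open>M\<close> itself may have elements of any type.
\<close>

definition injective_pers :: "'v itself \<Rightarrow> ('k, 'x) ring_scheme \<Rightarrow> ('k, 'm) pers \<Rightarrow> bool" where
  "injective_pers U K M \<longleftrightarrow>
     (\<forall>(A :: ('k, 'v) pers) (B :: ('k, 'v) pers) i g.
        persistence_module K A \<and> persistence_module K B \<and>
        pers_morphism K A B i \<and> pers_mono A i \<and> pers_morphism K A M g \<longrightarrow>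
        (\<exists>h. pers_morphism K B M h \<and> (\<forall>a. \<forall>x\<in>carrier (pspace A a). h a (i a x) = g a x)))"

definition projective_pers :: "'v itself \<Rightarrow> ('k, 'x) ring_scheme \<Rightarrow> ('k, 'm) pers \<Rightarrow> bool" where
  "projective_pers U K M \<longleftrightarrow>
     (\<forall>(B :: ('k, 'v) pers) (C :: ('k, 'v) pers) p g.
        persistence_module K B \<and> persistence_module K C \<and>
        pers_morphism K B C p \<and> pers_epi B C p \<and> pers_morphism K M C g \<longrightarrow>
        (\<exists>h. pers_morphism K M B h \<and> (\<forall>a. \<forall>x\<in>carrier (pspace M a). p a (h a x) = g a x)))"

text \<open>
  A universe that has room for all vector spaces with elements in the arbitrary type \<open>'u\<close> and for
  the direct sum of a family of one-dimensional spaces indexed by \<open>\<real>\<close>. A universe that is too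
  small would trivialize the notions above (over a one-element type there are only zero modules);
  in this one every interval module has a free cover, up to isomorphism.
\<close>

type_synonym ('k, 'u) universe = "'u + (real \<Rightarrow> 'k)"


subsection \<open>The graded module tensor product and flatness\<close>

definition sum_le :: "real \<Rightarrow> (real \<times> real) set" where
  "sum_le r = {(s, t). s + t \<le> r}"

definition pair_le :: "real \<times> real \<Rightarrow> real \<times> real \<Rightarrow> bool" where
  "pair_le p q \<longleftrightarrow> fst p \<le> fst q \<and> snd p \<le> snd q"

abbreviation pair_tensor ::
  "('k, 'x) ring_scheme \<Rightarrow> ('k, 'v) pers \<Rightarrow> ('k, 'w) pers \<Rightarrow> real \<times> real \<Rightarrow>
   ('k, ('v \<times> 'w \<Rightarrow> 'k) set) module" where
  "pair_tensor K M N \<equiv> (\<lambda>p. tensor K (pspace M (fst p)) (pspace N (snd p)))"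

abbreviation pair_tensor_trans ::
  "('k, 'x) ring_scheme \<Rightarrow> ('k, 'v) pers \<Rightarrow> ('k, 'w) pers \<Rightarrow> real \<times> real \<Rightarrow> real \<times> real \<Rightarrow>
   ('v \<times> 'w \<Rightarrow> 'k) set \<Rightarrow> ('v \<times> 'w \<Rightarrow> 'k) set" where
  "pair_tensor_trans K M N \<equiv> (\<lambda>p q. tensor_map K (pspace M (fst q)) (pspace N (snd q))
     (ptrans M (fst p) (fst q)) (ptrans N (snd p) (snd q)))"

abbreviation graded_tensor_kernel ::
  "('k, 'x) ring_scheme \<Rightarrow> ('k, 'v) pers \<Rightarrow> ('k, 'w) pers \<Rightarrow> real \<Rightarrow>
   (real \<times> real \<Rightarrow> ('v \<times> 'w \<Rightarrow> 'k) set) set" where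
  "graded_tensor_kernel K M N r \<equiv>
     colim_kernel K (sum_le r) pair_le (pair_tensor K M N) (pair_tensor_trans K M N)"

text \<open>
  The transition maps are induced by the inclusions of direct sums, which are identity maps in
  this encoding.
\<close>

definition graded_tensor ::
  "('k, 'x) ring_scheme \<Rightarrow> ('k, 'v) pers \<Rightarrow> ('k, 'w) pers \<Rightarrow>
   ('k, (real \<times> real \<Rightarrow> ('v \<times> 'w \<Rightarrow> 'k) set) set) pers" where
  "graded_tensor K M N = \<lparr>
     pspace = (\<lambda>r. colim K (sum_le r) pair_le (pair_tensor K M N) (pair_tensor_trans K M N)),
     ptrans = (\<lambda>r r'. quotient_map (direct_sum (sum_le r') (pair_tensor K M N))
        (graded_tensor_kernel K M N r') (\<lambda>u. u))\<rparr>"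

text \<open>\<open>f \<otimes> N : M \<otimes> N \<rightarrow> M' \<otimes> N\<close>; its argument determines \<open>M\<close>.\<close>

definition graded_tensor_map ::
  "('k, 'x) ring_scheme \<Rightarrow> ('k, 'v') pers \<Rightarrow> ('k, 'w) pers \<Rightarrow> (real \<Rightarrow> 'v \<Rightarrow> 'v') \<Rightarrow> real \<Rightarrow>
   (real \<times> real \<Rightarrow> ('v \<times> 'w \<Rightarrow> 'k) set) set \<Rightarrow> (real \<times> real \<Rightarrow> ('v' \<times> 'w \<Rightarrow> 'k) set) set" where
  "graded_tensor_map K M' N f r =
     quotient_map (direct_sum (sum_le r) (pair_tensor K M' N)) (graded_tensor_kernel K M' N r)
       (\<lambda>u p. tensor_map K (pspace M' (fst p)) (pspace N (snd p)) (f (fst p)) (\<lambda>y. y) (u p))"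

text \<open>Exactness of \<open>0 \<rightarrow> A \<rightarrow> B \<rightarrow> C \<rightarrow> 0\<close>.\<close>

definition short_exact ::
  "('k, 'u) pers \<Rightarrow> (real \<Rightarrow> 'u \<Rightarrow> 'v) \<Rightarrow> ('k, 'v) pers \<Rightarrow> (real \<Rightarrow> 'v \<Rightarrow> 'w) \<Rightarrow> ('k, 'w) pers \<Rightarrow>
   bool" where
  "short_exact A f B g C \<longleftrightarrow> pers_mono A f \<and>
     (\<forall>a. f a ` carrier (pspace A a) = {y \<in> carrier (pspace B a). g a y = \<zero>\<^bsub>pspace C a\<^esub>}) \<and>
     pers_epi B C g"

definition flat_pers :: "'v itself \<Rightarrow> ('k, 'x) ring_scheme \<Rightarrow> ('k, 'm) pers \<Rightarrow> bool" where
  "flat_pers U K M \<longleftrightarrow>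
     (\<forall>(A :: ('k, 'v) pers) (B :: ('k, 'v) pers) (C :: ('k, 'v) pers) f g.
        persistence_module K A \<and> persistence_module K B \<and> persistence_module K C \<and>
        pers_morphism K A B f \<and> pers_morphism K B C g \<and> short_exact A f B g C \<longrightarrow>
        short_exact (graded_tensor K A M) (graded_tensor_map K B M f)
          (graded_tensor K B M) (graded_tensor_map K C M g) (graded_tensor K C M))"


subsection \<open>Graded free persistence modules\<close>

text \<open>The monoid ring \<open>K[U\<^sub>0]\<close> of \<open>U\<^sub>0 = [0, \<infinity>)\<close>; \<open>p s\<close> is the coefficient of \<open>x\<^sup>s\<close>.\<close>

definition monoid_ring :: "('k, 'x) ring_scheme \<Rightarrow> (real \<Rightarrow> 'k) ring" where
  "monoid_ring K = \<lparr>
     carrier = {p. (\<forall>s. p s \<in> carrier K) \<and> (\<forall>s<0. p s = \<zero>\<^bsub>K\<^esub>) \<and> finite {s. p s \<noteq> \<zero>\<^bsub>K\<^esub>}},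
     mult = (\<lambda>p q r. \<Oplus>\<^bsub>K\<^esub>s\<in>{s. p s \<noteq> \<zero>\<^bsub>K\<^esub>}. p s \<otimes>\<^bsub>K\<^esub> q (r - s)),
     one = (\<lambda>s. if s = 0 then \<one>\<^bsub>K\<^esub> else \<zero>\<^bsub>K\<^esub>),
     zero = (\<lambda>s. \<zero>\<^bsub>K\<^esub>),
     add = (\<lambda>p q s. p s \<oplus>\<^bsub>K\<^esub> q s)\<rparr>"

definition graded_module ::
  "('k, 'x) ring_scheme \<Rightarrow> ('k, 'v) pers \<Rightarrow> (real \<Rightarrow> 'k, real \<Rightarrow> 'v) module" where
  "graded_module K M = \<lparr>
     carrier = carrier (direct_sum UNIV (pspace M)),
     mult = undefined, one = undefined,
     zero = zero (direct_sum UNIV (pspace M)),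
     add = add (direct_sum UNIV (pspace M)),
     smult = (\<lambda>p v r. \<Oplus>\<^bsub>pspace M r\<^esub>s\<in>{s. p s \<noteq> \<zero>\<^bsub>K\<^esub>}.
        p s \<odot>\<^bsub>pspace M r\<^esub> ptrans M (r - s) r (v (r - s)))\<rparr>"

definition module_basis :: "('r, 'x) ring_scheme \<Rightarrow> ('r, 'v) module \<Rightarrow> 'v set \<Rightarrow> bool" where
  "module_basis R V B \<longleftrightarrow> B \<subseteq> carrier V \<and>
     (\<forall>v\<in>carrier V. \<exists>!c. (\<forall>b\<in>B. c b \<in> carrier R) \<and> (\<forall>b. b \<notin> B \<longrightarrow> c b = \<zero>\<^bsub>R\<^esub>) \<and>
        finite {b. c b \<noteq> \<zero>\<^bsub>R\<^esub>} \<and> v = (\<Oplus>\<^bsub>V\<^esub>b\<in>{b. c b \<noteq> \<zero>\<^bsub>R\<^esub>}. c b \<odot>\<^bsub>V\<^esub> b))"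

definition homogeneous :: "('k, 'v) pers \<Rightarrow> (real \<Rightarrow> 'v) \<Rightarrow> bool" where
  "homogeneous M v \<longleftrightarrow> (\<exists>a. \<forall>r. r \<noteq> a \<longrightarrow> v r = \<zero>\<^bsub>pspace M r\<^esub>)"

definition graded_free :: "('k, 'x) ring_scheme \<Rightarrow> ('k, 'v) pers \<Rightarrow> bool" where
  "graded_free K M \<longleftrightarrow>
     (\<exists>B. module_basis (monoid_ring K) (graded_module K M) B \<and> (\<forall>b\<in>B. homogeneous M b))"


section \<open>Basic facts\<close>

lemma linear_mapsD:
  assumes "f \<in> linear_maps K V W"
  shows "x \<in> carrier V \<Longrightarrow> f x \<in> carrier W"
    and "x \<in> carrier V \<Longrightarrow> y \<in> carrier V \<Longrightarrow> f (x \<oplus>\<^bsub>V\<^esub> y) = f x \<oplus>\<^bsub>W\<^esub> f y"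
    and "c \<in> carrier K \<Longrightarrow> x \<in> carrier V \<Longrightarrow> f (c \<odot>\<^bsub>V\<^esub> x) = c \<odot>\<^bsub>W\<^esub> f x"
  using assms by (auto simp: linear_maps_def)

lemma linear_maps_zero_minus:
  assumes V: "Module.module K V" and W: "Module.module K W" and f: "f \<in> linear_maps K V W"
  shows "f \<zero>\<^bsub>V\<^esub> = \<zero>\<^bsub>W\<^esub>"
    and "x \<in> carrier V \<Longrightarrow> f (\<ominus>\<^bsub>V\<^esub> x) = \<ominus>\<^bsub>W\<^esub> f x"
proof -
  interpret V: Module.module K V by fact
  interpret W: Module.module K W by fact
  note fD = linear_mapsD[OF f]
  have "f (\<zero>\<^bsub>K\<^esub> \<odot>\<^bsub>V\<^esub> \<zero>\<^bsub>V\<^esub>) = \<zero>\<^bsub>K\<^esub> \<odot>\<^bsub>W\<^esub> f \<zero>\<^bsub>V\<^esub>"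
    by (rule fD) auto
  then show z: "f \<zero>\<^bsub>V\<^esub> = \<zero>\<^bsub>W\<^esub>"
    using fD(1) by simp
  assume x: "x \<in> carrier V"
  have "f x \<oplus>\<^bsub>W\<^esub> f (\<ominus>\<^bsub>V\<^esub> x) = \<zero>\<^bsub>W\<^esub>"
    using x fD(2)[of x "\<ominus>\<^bsub>V\<^esub> x"] z by (simp add: V.M.r_neg)
  then show "f (\<ominus>\<^bsub>V\<^esub> x) = \<ominus>\<^bsub>W\<^esub> f x"
    using x fD(1) by (metis V.M.a_inv_closed W.M.minus_equality W.M.a_comm)
qed

lemma submodule_abelian_subgroup:
  assumes "Module.module K V" and "submodule W K V"
  shows "abelian_subgroup W V"
  using assms by (intro abelian_subgroupI3)
    (auto simp: additive_subgroup_def submodule_def Module.module_def)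

lemma quotient_map_coset:
  assumes V: "Module.module K V" "submodule W K V"
    and V': "Module.module K V'" "submodule W' K V'"
    and h: "h \<in> linear_maps K V V'" "h ` W \<subseteq> W'" and x: "x \<in> carrier V"
  shows "quotient_map V' W' h (W +>\<^bsub>V\<^esub> x) = W' +>\<^bsub>V'\<^esub> h x"
proof -
  interpret V: Module.module K V by fact
  interpret V': Module.module K V' by fact
  interpret W: abelian_subgroup W V by (rule submodule_abelian_subgroup) fact+
  interpret W': abelian_subgroup W' V' by (rule submodule_abelian_subgroup) fact+
  have "W' +>\<^bsub>V'\<^esub> h y = W' +>\<^bsub>V'\<^esub> h x" if y: "y \<in> W +>\<^bsub>V\<^esub> x" for y
  proof -
    obtain w where w: "w \<in> W" "y = w \<oplus>\<^bsub>V\<^esub> x"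
      using y by (auto simp: a_r_coset_def')
    have "h y = h w \<oplus>\<^bsub>V'\<^esub> h x"
      using w x by (simp add: linear_mapsD[OF h(1)])
    moreover have "h w \<in> W'"
      using w h(2) by auto
    ultimately have "h y \<in> W' +>\<^bsub>V'\<^esub> h x"
      by (auto simp: a_r_coset_def')
    then show ?thesis
      using W'.a_repr_independence' linear_mapsD(1)[OF h(1)] x by blast
  qed
  moreover have "x \<in> W +>\<^bsub>V\<^esub> x"
    using x by (rule W.a_rcos_self)
  ultimately show ?thesis
    unfolding quotient_map_def by blast
qed

lemma quotient_space_module:
  assumes V: "Module.module K V" "submodule W K V"
  shows "Module.module K (quotient_space V W)"
    and "(\<lambda>x. W +>\<^bsub>V\<^esub> x) \<in> linear_maps K V (quotient_space V W)"
proof -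
  interpret V: Module.module K V by fact
  interpret W: abelian_subgroup W V by (rule submodule_abelian_subgroup) fact+
  let ?Q = "quotient_space V W"
  have car: "carrier ?Q = (\<lambda>x. W +>\<^bsub>V\<^esub> x) ` carrier V"
    by (auto simp: quotient_space_def A_RCOSETS_def')
  have add: "(W +>\<^bsub>V\<^esub> x) \<oplus>\<^bsub>?Q\<^esub> (W +>\<^bsub>V\<^esub> y) = W +>\<^bsub>V\<^esub> (x \<oplus>\<^bsub>V\<^esub> y)"
    if "x \<in> carrier V" "y \<in> carrier V" for x y
    using that by (simp add: quotient_space_def W.a_rcos_sum)
  have zero: "\<zero>\<^bsub>?Q\<^esub> = W +>\<^bsub>V\<^esub> \<zero>\<^bsub>V\<^esub>"
    by (simp add: quotient_space_def W.a_rcos_const)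
  have smult: "c \<odot>\<^bsub>?Q\<^esub> (W +>\<^bsub>V\<^esub> x) = W +>\<^bsub>V\<^esub> (c \<odot>\<^bsub>V\<^esub> x)"
    if c: "c \<in> carrier K" and x: "x \<in> carrier V" for c x
  proof -
    have "(\<lambda>x. c \<odot>\<^bsub>V\<^esub> x) \<in> linear_maps K V V"
      using c by (auto simp: linear_maps_def V.smult_r_distr V.R.m_comm simp flip: V.smult_assoc1)
    moreover have "(\<lambda>x. c \<odot>\<^bsub>V\<^esub> x) ` W \<subseteq> W"
      using submodule.smult_closed[OF V(2) c] by auto
    ultimately show ?thesis
      using quotient_map_coset[OF V V] x by (simp add: quotient_space_def quotient_map_def)
  qed
  have grp: "abelian_group ?Q"
  proof (rule abelian_groupI)
    show "\<exists>Y\<in>carrier ?Q. Y \<oplus>\<^bsub>?Q\<^esub> X = \<zero>\<^bsub>?Q\<^esub>" if X: "X \<in> carrier ?Q" for X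
    proof -
      obtain x where x: "x \<in> carrier V" "X = W +>\<^bsub>V\<^esub> x"
        using X by (auto simp: car)
      then have "(W +>\<^bsub>V\<^esub> \<ominus>\<^bsub>V\<^esub> x) \<oplus>\<^bsub>?Q\<^esub> X = \<zero>\<^bsub>?Q\<^esub>"
        by (simp add: add zero V.M.l_neg)
      with x show ?thesis
        by (auto simp: car)
    qed
  qed (auto simp: car add zero V.M.a_assoc V.M.a_comm V.M.a_lcomm)
  show "Module.module K ?Q"
    by (rule moduleI)
      (auto simp: car add smult grp V.R.is_cring V.smult_l_distr V.smult_r_distr V.smult_assoc1)
  show "(\<lambda>x. W +>\<^bsub>V\<^esub> x) \<in> linear_maps K V ?Q"
    by (auto simp: linear_maps_def car add smult)
qed

lemma linear_image_submodule:
  assumes V: "Module.module K V" and W: "Module.module K W" and f: "f \<in> linear_maps K V W"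
  shows "submodule (f ` carrier V) K W"
proof -
  interpret V: Module.module K V by fact
  interpret W: Module.module K W by fact
  show ?thesis
  proof (rule W.submoduleI)
    show "\<zero>\<^bsub>W\<^esub> \<in> f ` carrier V"
      using linear_maps_zero_minus(1)[OF V W f] by (metis V.M.zero_closed image_eqI)
    show "\<ominus>\<^bsub>W\<^esub> y \<in> f ` carrier V" if "y \<in> f ` carrier V" for y
      using that linear_maps_zero_minus(2)[OF V W f, symmetric] by auto
    show "y \<oplus>\<^bsub>W\<^esub> z \<in> f ` carrier V" if "y \<in> f ` carrier V" "z \<in> f ` carrier V" for y z
      using that linear_mapsD(2)[OF f] by (metis (no_types, lifting) V.M.a_closed imageE image_eqI)
    show "c \<odot>\<^bsub>W\<^esub> y \<in> f ` carrier V" if "c \<in> carrier K" "y \<in> f ` carrier V" for c y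
      using that linear_mapsD(3)[OF f] by (metis (no_types, lifting) V.smult_closed imageE image_eqI)
  qed (use linear_mapsD[OF f] in auto)
qed

lemma linear_kernel_submodule:
  assumes V: "Module.module K V" and W: "Module.module K W" and f: "f \<in> linear_maps K V W"
  shows "submodule {x \<in> carrier V. f x = \<zero>\<^bsub>W\<^esub>} K V"
proof -
  interpret V: Module.module K V by fact
  interpret W: Module.module K W by fact
  show ?thesis
    by (rule V.submoduleI) (use linear_mapsD[OF f] linear_maps_zero_minus[OF V W f] in auto)
qed

lemma interval_module_persistence_module:
  assumes "field K" and I: "is_interval I"
  shows "persistence_module K (interval_module K I)"
proof -
  interpret field K by fact
  have "abelian_group (regular_space K)"
  proof (rule abelian_groupI)
    show "\<exists>y\<in>carrier (regular_space K). y \<oplus>\<^bsub>regular_space K\<^esub> x = \<zero>\<^bsub>regular_space K\<^esub>"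
      if "x \<in> carrier (regular_space K)" for x
      using that l_neg[of x] by (auto simp: regular_space_def intro!: bexI[of _ "\<ominus>\<^bsub>K\<^esub> x"])
  qed (auto simp: regular_space_def a_assoc a_comm a_lcomm)
  then have reg: "Module.module K (regular_space K)"
    by (intro moduleI) (auto simp: regular_space_def l_distr r_distr m_assoc is_cring)
  have "abelian_group ((regular_space K)\<lparr>carrier := {\<zero>\<^bsub>K\<^esub>}\<rparr>)"
    by (rule abelian_groupI) (auto simp: regular_space_def)
  then have "Module.module K ((regular_space K)\<lparr>carrier := {\<zero>\<^bsub>K\<^esub>}\<rparr>)"
    by (intro moduleI) (auto simp: regular_space_def is_cring)
  with reg show ?thesis
    unfolding persistence_module_def interval_module_def
    by (auto simp: linear_maps_def regular_space_def) (use I is_interval_1 in blast)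
qed

lemma pers_mono_iff_cancel:
  fixes M :: "('k, 'v) pers" and N :: "('k, 'w) pers"
  assumes M: "persistence_module K M" and N: "persistence_module K N"
    and f: "pers_morphism K M N f"
  shows "pers_mono M f \<longleftrightarrow>
    (\<forall>(L :: ('k, 'v) pers) g h. persistence_module K L \<and> pers_morphism K L M g \<and>
       pers_morphism K L M h \<and> (\<forall>a. \<forall>x\<in>carrier (pspace L a). f a (g a x) = f a (h a x)) \<longrightarrow>
       (\<forall>a. \<forall>x\<in>carrier (pspace L a). g a x = h a x))" (is "_ \<longleftrightarrow> ?cancel")
proof
  assume "pers_mono M f"
  then show ?cancel
    unfolding pers_mono_def pers_morphism_def by (meson inj_onD linear_mapsD(1))
next
  assume cancel: ?cancel
  have modM: "Module.module K (pspace M a)" and modN: "Module.module K (pspace N a)"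
    and lin: "f a \<in> linear_maps K (pspace M a) (pspace N a)" for a
    using M N f by (auto simp: persistence_module_def pers_morphism_def)
  define Z where "Z a = {x \<in> carrier (pspace M a). f a x = \<zero>\<^bsub>pspace N a\<^esub>}" for a
  have sub: "submodule (Z a) K (pspace M a)" for a
    unfolding Z_def by (rule linear_kernel_submodule[OF modM modN lin])
  define L :: "('k, 'v) pers" where
    "L = \<lparr>pspace = (\<lambda>a. (pspace M a)\<lparr>carrier := Z a\<rparr>), ptrans = ptrans M\<rparr>"
  have Zc: "x \<in> carrier (pspace M a)" if "x \<in> Z a" for x a
    using that by (simp add: Z_def)
  have tr: "ptrans M a b \<in> linear_maps K (pspace M a) (pspace M b)" if "a \<le> b" for a b
    using M that by (auto simp: persistence_module_def)
  have tN: "ptrans N a b \<in> linear_maps K (pspace N a) (pspace N b)" if "a \<le> b" for a b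
    using N that by (auto simp: persistence_module_def)
  have trZ: "ptrans M a b x \<in> Z b" if "a \<le> b" "x \<in> Z a" for a b x
    using that f linear_mapsD(1)[OF tr] linear_maps_zero_minus(1)[OF modN modN tN[OF that(1)]]
    by (auto simp: Z_def pers_morphism_def)
  have L: "persistence_module K L"
    using M tr Zc trZ submodule.submodule_is_module[OF sub modM]
    by (auto simp: persistence_module_def L_def linear_maps_def)
  have g: "pers_morphism K L M (\<lambda>a x. x)"
    using Zc by (auto simp: pers_morphism_def L_def linear_maps_def)
  have h: "pers_morphism K L M (\<lambda>a x. \<zero>\<^bsub>pspace M a\<^esub>)"
  proof -
    have "(\<lambda>x. \<zero>\<^bsub>pspace M a\<^esub>) \<in> linear_maps K (pspace L a) (pspace M a)" for a
    proof -
      interpret A: Module.module K "pspace M a" by (rule modM)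
      show ?thesis by (auto simp: linear_maps_def)
    qed
    then show ?thesis
      using linear_maps_zero_minus(1)[OF modM modM tr]
      by (auto simp: pers_morphism_def)
  qed
  have zero: "x = \<zero>\<^bsub>pspace M a\<^esub>" if "x \<in> Z a" for a x
    using cancel L g h that linear_maps_zero_minus(1)[OF modM modN lin]
    by (fastforce simp: L_def Z_def)
  show "pers_mono M f"
    unfolding pers_mono_def
  proof (intro allI inj_onI)
    fix a x y
    assume x: "x \<in> carrier (pspace M a)" and y: "y \<in> carrier (pspace M a)" and eq: "f a x = f a y"
    interpret A: Module.module K "pspace M a" by (rule modM)
    interpret B: Module.module K "pspace N a" by (rule modN)
    have "x \<ominus>\<^bsub>pspace M a\<^esub> y \<in> Z a"
      using x y eq linear_mapsD[OF lin] linear_maps_zero_minus(2)[OF modM modN lin]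
      by (auto simp: Z_def a_minus_def B.M.r_neg)
    then have "x \<oplus>\<^bsub>pspace M a\<^esub> \<ominus>\<^bsub>pspace M a\<^esub> y = \<zero>\<^bsub>pspace M a\<^esub>"
      using zero by (simp add: a_minus_def)
    then show "x = y"
      using x y by (metis A.M.a_inv_closed A.M.minus_equality A.M.minus_minus)
  qed
qed

lemma pers_epi_iff_cancel:
  fixes M :: "('k, 'v) pers" and N :: "('k, 'w) pers"
  assumes M: "persistence_module K M" and N: "persistence_module K N"
    and f: "pers_morphism K M N f"
  shows "pers_epi M N f \<longleftrightarrow>
    (\<forall>(L :: ('k, 'w set) pers) g h. persistence_module K L \<and> pers_morphism K N L g \<and>
       pers_morphism K N L h \<and> (\<forall>a. \<forall>x\<in>carrier (pspace M a). g a (f a x) = h a (f a x)) \<longrightarrow>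
       (\<forall>a. \<forall>x\<in>carrier (pspace N a). g a x = h a x))" (is "_ \<longleftrightarrow> ?cancel")
proof
  assume "pers_epi M N f"
  then show ?cancel
    unfolding pers_epi_def by (metis imageE)
next
  assume cancel: ?cancel
  have modM: "Module.module K (pspace M a)" and modN: "Module.module K (pspace N a)"
    and lin: "f a \<in> linear_maps K (pspace M a) (pspace N a)" for a
    using M N f by (auto simp: persistence_module_def pers_morphism_def)
  define W where "W a = f a ` carrier (pspace M a)" for a
  have sub: "submodule (W a) K (pspace N a)" for a
    unfolding W_def by (rule linear_image_submodule[OF modM modN lin])
  have trM: "ptrans M a b \<in> linear_maps K (pspace M a) (pspace M b)"
    and trN: "ptrans N a b \<in> linear_maps K (pspace N a) (pspace N b)" if "a \<le> b" for a b
    using M N that by (auto simp: persistence_module_def)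
  have trW: "ptrans N a b ` W a \<subseteq> W b" if "a \<le> b" for a b
    using that f linear_mapsD(1)[OF trM[OF that]]
    by (force simp: W_def pers_morphism_def)
  define q where "q a y = W a +>\<^bsub>pspace N a\<^esub> y" for a y
  define L :: "('k, 'w set) pers" where
    "L = \<lparr>pspace = (\<lambda>a. quotient_space (pspace N a) (W a)),
          ptrans = (\<lambda>a b. quotient_map (pspace N b) (W b) (ptrans N a b))\<rparr>"
  have modL: "Module.module K (pspace L a)" and qlin: "q a \<in> linear_maps K (pspace N a) (pspace L a)"
    for a
    using quotient_space_module[OF modN sub] by (auto simp: L_def q_def[abs_def])
  have carL: "carrier (pspace L a) = q a ` carrier (pspace N a)" for a
    by (auto simp: L_def quotient_space_def A_RCOSETS_def' q_def)
  have trL: "ptrans L a b (q a y) = q b (ptrans N a b y)"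
    if "a \<le> b" "y \<in> carrier (pspace N a)" for a b y
    using quotient_map_coset[OF modN sub modN sub trN trW] that by (simp add: L_def q_def)
  have NN: "ptrans N a a y = y" if "y \<in> carrier (pspace N a)" for a y
    using N that by (simp add: persistence_module_def)
  have NNN: "ptrans N b c (ptrans N a b y) = ptrans N a c y"
    if "a \<le> b" "b \<le> c" "y \<in> carrier (pspace N a)" for a b c y
    using N that by (simp add: persistence_module_def)
  have Nc: "ptrans N a b y \<in> carrier (pspace N b)" if "a \<le> b" "y \<in> carrier (pspace N a)" for a b y
    using linear_mapsD(1)[OF trN] that by blast
  have "ptrans L a b \<in> linear_maps K (pspace L a) (pspace L b)" if ab: "a \<le> b" for a b
  proof -
    interpret A: Module.module K "pspace N a" by (rule modN)
    show ?thesis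
      using ab Nc linear_mapsD(2,3)[OF trN[OF ab]] trL[OF ab]
      by (auto simp: linear_maps_def carL simp flip: linear_mapsD(2,3)[OF qlin])
  qed
  then have L: "persistence_module K L"
    using modL by (auto simp: persistence_module_def carL trL NN NNN Nc)
  have g: "pers_morphism K N L q"
    using qlin trL by (auto simp: pers_morphism_def)
  have h: "pers_morphism K N L (\<lambda>a y. \<zero>\<^bsub>pspace L a\<^esub>)"
  proof -
    have "(\<lambda>y. \<zero>\<^bsub>pspace L a\<^esub>) \<in> linear_maps K (pspace N a) (pspace L a)" for a
    proof -
      interpret A: Module.module K "pspace L a" by (rule modL)
      show ?thesis by (auto simp: linear_maps_def)
    qed
    moreover have "ptrans L a b \<zero>\<^bsub>pspace L a\<^esub> = \<zero>\<^bsub>pspace L b\<^esub>" if "a \<le> b" for a b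
      using L that linear_maps_zero_minus(1)[OF modL modL] by (auto simp: persistence_module_def)
    ultimately show ?thesis
      by (auto simp: pers_morphism_def)
  qed
  have Wq: "y \<in> W a \<longleftrightarrow> q a y = \<zero>\<^bsub>pspace L a\<^esub>" if y: "y \<in> carrier (pspace N a)" for a y
  proof -
    interpret A: abelian_subgroup "W a" "pspace N a"
      by (rule submodule_abelian_subgroup[OF modN sub])
    show ?thesis
      using A.a_rcos_const A.a_rcos_self[OF y] by (auto simp: L_def q_def quotient_space_def)
  qed
  have "q a (f a x) = \<zero>\<^bsub>pspace L a\<^esub>" if "x \<in> carrier (pspace M a)" for a x
    using that Wq linear_mapsD(1)[OF lin] by (force simp: W_def)
  then have "\<forall>a. \<forall>y\<in>carrier (pspace N a). q a y = \<zero>\<^bsub>pspace L a\<^esub>"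
    using cancel L g h by blast
  then have "carrier (pspace N a) \<subseteq> W a" for a
    using Wq by blast
  then show "pers_epi M N f"
    using linear_mapsD(1)[OF lin] by (fastforce simp: pers_epi_def W_def)
qed

end

theory Submission
  imports Defs
begin

text \<open>
  \<^emph>\<open>Flatness.\<close> If \<open>I\<close> is an up-set, then \<open>(M \<otimes> k[I])\<^sub>r\<close> is the directed colimit of the \<open>M\<^sub>s\<close>
  over the \<open>s\<close> with \<open>r - s \<in> I\<close>, and directed colimits are exact. If \<open>I\<close> is bounded above, then tensoring
  the inclusion of \<open>k[b, \<infinity>)\<close> into \<open>k[0, \<infinity>)\<close> with \<open>k[I]\<close> yields transition maps of \<open>k[I]\<close>, and some
  of these are zero on a nonzero space.

  \<^emph>\<open>Injectivity.\<close> If \<open>D\<close> is a down-set, then a morphism \<open>B \<rightarrow> k[D]\<close> is a linear functional on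
  the directed colimit of \<open>B\<close> over \<open>D\<close>, and functionals extend from subspaces. If \<open>m \<notin> I\<close> lies below
  \<open>t \<in> I\<close>, then the morphism \<open>k[t, \<infinity>) \<rightarrow> k[I]\<close> does not extend to \<open>k[m, \<infinity>)\<close>.

  \<^emph>\<open>Projectivity.\<close> Only the interval modules of the form \<open>k[a, \<infinity>)\<close> are direct summands of a
  sum of modules \<open>k[s, \<infinity>)\<close>.
\<close>


section \<open>Linear maps, quotients and direct sums\<close>

text \<open>Universal properties of tensor products and colimits produce maps out of them and hence
  equations; that an element is nonzero can only be seen by mapping it to a space where vanishing is
  visible. This obstacle shapes the proof. Exactness of the directed colimits rests on such a
  detecting map, into families modulo those that vanish from some degree on; the failure of flatness
  rests on an explicit functional. In degree r the tensor product with k[I], for an up-set I, is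
  governed by the s with r - s \<in> I because r - s is the largest degree left to the second
  factor, and the vector 1 can always be moved there. Non-projectivity is not derived from
  non-flatness: k(a, \<infinity>) and k[R] are flat, so a separate criterion is required for them,
  and it settles the remaining cases as well. The test modules of the negative results have elements
  in \<open>'k\<close> or \<open>real \<Rightarrow> 'k\<close> and must be moved into the universe;
  this is the purpose of the injections \<open>e\<close> there.\<close>

lemma linear_mapsI:
  assumes "\<And>x. x \<in> carrier V \<Longrightarrow> f x \<in> carrier W"
    and "\<And>x y. x \<in> carrier V \<Longrightarrow> y \<in> carrier V \<Longrightarrow> f (x \<oplus>\<^bsub>V\<^esub> y) = f x \<oplus>\<^bsub>W\<^esub> f y"
    and "\<And>c x. c \<in> carrier K \<Longrightarrow> x \<in> carrier V \<Longrightarrow> f (c \<odot>\<^bsub>V\<^esub> x) = c \<odot>\<^bsub>W\<^esub> f x"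
  shows "f \<in> linear_maps K V W"
  using assms by (auto simp: linear_maps_def)

lemma linear_maps_comp:
  assumes "f \<in> linear_maps K U V" and "g \<in> linear_maps K V W"
  shows "(\<lambda>x. g (f x)) \<in> linear_maps K U W"
  using assms by (auto simp: linear_maps_def Pi_iff)

lemma linear_maps_id: "(\<lambda>x. x) \<in> linear_maps K V V"
  by (auto simp: linear_maps_def)

lemma linear_maps_zero:
  assumes "Module.module K W"
  shows "(\<lambda>x. \<zero>\<^bsub>W\<^esub>) \<in> linear_maps K V W"
proof -
  interpret W: Module.module K W by fact
  show ?thesis by (auto simp: linear_maps_def)
qed

lemma linear_maps_diff:
  assumes V: "Module.module K V" and W: "Module.module K W" and f: "f \<in> linear_maps K V W"
    and x: "x \<in> carrier V" "y \<in> carrier V"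
  shows "f (x \<ominus>\<^bsub>V\<^esub> y) = f x \<ominus>\<^bsub>W\<^esub> f y"
proof -
  interpret V: Module.module K V by fact
  show ?thesis
    using x linear_mapsD[OF f] linear_maps_zero_minus[OF V W f] by (simp add: a_minus_def)
qed

lemma module_diff_eq_zero_iff:
  assumes "Module.module K V" and x: "x \<in> carrier V" "y \<in> carrier V"
  shows "x \<ominus>\<^bsub>V\<^esub> y = \<zero>\<^bsub>V\<^esub> \<longleftrightarrow> x = y"
proof -
  interpret V: Module.module K V by fact
  show ?thesis
    unfolding a_minus_def
    using x by (metis V.M.a_inv_closed V.M.minus_equality V.M.minus_minus V.M.r_neg)
qed

lemma linear_inj_onI:
  assumes V: "Module.module K V" and W: "Module.module K W" and f: "f \<in> linear_maps K V W"
    and ker: "\<And>x. x \<in> carrier V \<Longrightarrow> f x = \<zero>\<^bsub>W\<^esub> \<Longrightarrow> x = \<zero>\<^bsub>V\<^esub>"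
  shows "inj_on f (carrier V)"
proof (rule inj_onI)
  interpret V: Module.module K V by fact
  interpret W: Module.module K W by fact
  fix x y assume xy: "x \<in> carrier V" "y \<in> carrier V" "f x = f y"
  then have "f (x \<ominus>\<^bsub>V\<^esub> y) = \<zero>\<^bsub>W\<^esub>"
    using linear_maps_diff[OF V W f] linear_mapsD(1)[OF f] module_diff_eq_zero_iff[OF W] by simp
  then have "x \<ominus>\<^bsub>V\<^esub> y = \<zero>\<^bsub>V\<^esub>"
    using xy ker by simp
  then show "x = y"
    using xy module_diff_eq_zero_iff[OF V] by simp
qed

lemma submodule_zero_mem:
  assumes "Module.module K V" "submodule H K V"
  shows "\<zero>\<^bsub>V\<^esub> \<in> H"
proof -
  interpret V: Module.module K V by fact
  show ?thesis
    using V.submoduleE[OF assms(2)] by (metis V.M.r_neg subset_iff ex_in_conv)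
qed

lemma linear_preimage_submodule:
  assumes V: "Module.module K V" and W: "Module.module K W" and f: "f \<in> linear_maps K V W"
    and H: "submodule H K W"
  shows "submodule {x \<in> carrier V. f x \<in> H} K V"
proof -
  interpret V: Module.module K V by fact
  interpret W: Module.module K W by fact
  show ?thesis
    using linear_mapsD[OF f] linear_maps_zero_minus[OF V W f] W.submoduleE[OF H]
      submodule_zero_mem[OF W H]
    by (intro V.submoduleI) auto
qed

lemma equalizer_submodule:
  assumes V: "Module.module K V" and W: "Module.module K W"
    and f: "f \<in> linear_maps K V W" and g: "g \<in> linear_maps K V W"
  shows "submodule {x \<in> carrier V. f x = g x} K V"
proof -
  interpret V: Module.module K V by fact
  show ?thesis
    using linear_mapsD[OF f] linear_mapsD[OF g] linear_maps_zero_minus[OF V W f]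
      linear_maps_zero_minus[OF V W g]
    by (intro V.submoduleI) auto
qed

lemma submodule_generated_submodule:
  assumes V: "Module.module K V" and S: "S \<subseteq> carrier V"
  shows "submodule (submodule_generated K V S) K V"
proof -
  interpret V: Module.module K V by fact
  have H: "submodule (carrier V) K V"
    by (rule V.carrier_is_submodule)
  show ?thesis
    unfolding submodule_generated_def
    by (rule V.submoduleI) (use H S submodule_zero_mem[OF V] V.submoduleE in auto)
qed

lemma submodule_generated_incl: "S \<subseteq> submodule_generated K V S"
  by (auto simp: submodule_generated_def)

lemma submodule_generated_least:
  "submodule H K V \<Longrightarrow> S \<subseteq> H \<Longrightarrow> submodule_generated K V S \<subseteq> H"
  by (auto simp: submodule_generated_def)

text \<open>The preimage of \<open>H\<close> is a submodule, so a check on the generators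
  \<open>S\<close> suffices. Maps are shown in this way to respect the relations of tensor products
  and colimits.\<close>

lemma linear_image_generated:
  assumes V: "Module.module K V" and W: "Module.module K W" and f: "f \<in> linear_maps K V W"
    and H: "submodule H K W" and S: "S \<subseteq> carrier V" "\<And>x. x \<in> S \<Longrightarrow> f x \<in> H"
  shows "f ` submodule_generated K V S \<subseteq> H"
  using submodule_generated_least[OF linear_preimage_submodule[OF V W f H], of S] S by auto

lemma zero_submodule:
  assumes "Module.module K V"
  shows "submodule {\<zero>\<^bsub>V\<^esub>} K V"
proof -
  interpret V: Module.module K V by fact
  show ?thesis by (rule V.submoduleI) auto
qed

subsection \<open>Quotients\<close>

lemma carrier_quotient_space: "carrier (quotient_space V H) = (\<lambda>x. H +>\<^bsub>V\<^esub> x) ` carrier V"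
  by (auto simp: quotient_space_def A_RCOSETS_def')

lemma coset_eq_zero_iff:
  assumes V: "Module.module K V" "submodule H K V" and x: "x \<in> carrier V"
  shows "H +>\<^bsub>V\<^esub> x = \<zero>\<^bsub>quotient_space V H\<^esub> \<longleftrightarrow> x \<in> H"
proof -
  interpret A: abelian_subgroup H V by (rule submodule_abelian_subgroup[OF V])
  show ?thesis
    using A.a_rcos_const A.a_rcos_self[OF x] by (auto simp: quotient_space_def)
qed

lemma coset_eqI:
  assumes V: "Module.module K V" "submodule H K V" and x: "x \<in> carrier V" "y \<in> carrier V"
    and d: "x \<ominus>\<^bsub>V\<^esub> y \<in> H"
  shows "H +>\<^bsub>V\<^esub> x = H +>\<^bsub>V\<^esub> y"
proof -
  interpret V: Module.module K V by fact
  interpret A: abelian_subgroup H V by (rule submodule_abelian_subgroup[OF V])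
  have "x \<in> H +>\<^bsub>V\<^esub> y"
    using A.a_rcos_module[OF x(2,1)] d by (simp add: a_minus_def)
  then show ?thesis
    using A.a_repr_independence' x by blast
qed

lemma quotient_map_linear:
  assumes V: "Module.module K V" "submodule H K V"
    and V': "Module.module K V'" "submodule H' K V'"
    and h: "h \<in> linear_maps K V V'" "h ` H \<subseteq> H'"
  shows "quotient_map V' H' h \<in> linear_maps K (quotient_space V H) (quotient_space V' H')"
proof -
  interpret V: Module.module K V by fact
  note q = linear_mapsD(2,3)[OF quotient_space_module(2)[OF V]]
    and q' = linear_mapsD(2,3)[OF quotient_space_module(2)[OF V']] and hD = linear_mapsD[OF h(1)]
  show ?thesis
    by (rule linear_mapsI)
      (auto simp: carrier_quotient_space quotient_map_coset[OF V V' h] hD q'[symmetric] q[symmetric])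
qed

text \<open>The induced map is \<open>quotient_map\<close> into \<open>W\<close> modulo its zero
  submodule: cosets there are singletons, and \<open>the_elem\<close> reads off their element.
  Well-definedness is thus inherited from \<open>quotient_map_coset\<close>.\<close>

lemma quotient_lift:
  assumes V: "Module.module K V" "submodule H K V" and W: "Module.module K W"
    and h: "h \<in> linear_maps K V W" "\<And>x. x \<in> H \<Longrightarrow> h x = \<zero>\<^bsub>W\<^esub>"
  obtains h' where "h' \<in> linear_maps K (quotient_space V H) W"
    and "\<And>x. x \<in> carrier V \<Longrightarrow> h' (H +>\<^bsub>V\<^esub> x) = h x"
proof -
  interpret V: Module.module K V by fact
  interpret W: Module.module K W by fact
  have "{\<zero>\<^bsub>W\<^esub>} +>\<^bsub>W\<^esub> y = {y}" if "y \<in> carrier W" for y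
    using that by (auto simp: a_r_coset_def')
  then have eq: "the_elem (quotient_map W {\<zero>\<^bsub>W\<^esub>} h (H +>\<^bsub>V\<^esub> x)) = h x" if "x \<in> carrier V" for x
    using quotient_map_coset[OF V W zero_submodule[OF W] h(1) _ that] h(2)
      linear_mapsD(1)[OF h(1) that] by fastforce
  have "(\<lambda>X. the_elem (quotient_map W {\<zero>\<^bsub>W\<^esub>} h X)) \<in> linear_maps K (quotient_space V H) W"
    by (rule linear_mapsI) (auto simp: carrier_quotient_space eq linear_mapsD[OF h(1)]
        simp flip: linear_mapsD(2,3)[OF quotient_space_module(2)[OF V]])
  with eq show ?thesis using that by blast
qed

text \<open>Generation is phrased through submodules: a set generates if every submodule containing
  it is everything. In this form it passes to a quotient by pulling \<open>G\<close> back along the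
  projection, without handling linear combinations.\<close>

lemma quotient_generation:
  assumes V: "Module.module K V" "submodule H K V" and G: "submodule G K (quotient_space V H)"
    and gen: "\<And>L. submodule L K V \<Longrightarrow> (\<And>x. x \<in> S \<Longrightarrow> x \<in> L) \<Longrightarrow> carrier V \<subseteq> L"
    and S: "\<And>x. x \<in> S \<Longrightarrow> x \<in> carrier V \<and> H +>\<^bsub>V\<^esub> x \<in> G"
  shows "carrier (quotient_space V H) \<subseteq> G"
proof -
  have "carrier V \<subseteq> {x \<in> carrier V. H +>\<^bsub>V\<^esub> x \<in> G}"
    by (rule gen[OF linear_preimage_submodule[OF V(1) quotient_space_module[OF V] G]]) (use S in auto)
  then show ?thesis
    by (auto simp: carrier_quotient_space)
qed


subsection \<open>Direct sums\<close>

lemma direct_sum_simps: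
  "\<zero>\<^bsub>direct_sum J D\<^esub> = (\<lambda>j. \<zero>\<^bsub>D j\<^esub>)"
  "u \<oplus>\<^bsub>direct_sum J D\<^esub> v = (\<lambda>j. u j \<oplus>\<^bsub>D j\<^esub> v j)"
  "c \<odot>\<^bsub>direct_sum J D\<^esub> u = (\<lambda>j. c \<odot>\<^bsub>D j\<^esub> u j)"
  by (simp_all add: direct_sum_def)

lemma direct_sum_carrier:
  "u \<in> carrier (direct_sum J D) \<longleftrightarrow> (\<forall>j\<in>J. u j \<in> carrier (D j)) \<and>
     (\<forall>j. j \<notin> J \<longrightarrow> u j = \<zero>\<^bsub>D j\<^esub>) \<and> finite {j. u j \<noteq> \<zero>\<^bsub>D j\<^esub>}"
  by (simp add: direct_sum_def)

lemma direct_sum_module: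
  assumes "cring K" and D: "\<And>j. Module.module K (D j)"
  shows "Module.module K (direct_sum J D)"
proof -
  interpret D: Module.module K "D j" for j by (rule D)
  have car: "u j \<in> carrier (D j)" if "u \<in> carrier (direct_sum J D)" for u j
    using that by (cases "j \<in> J") (auto simp: direct_sum_carrier)
  have add: "(\<lambda>j. u j \<oplus>\<^bsub>D j\<^esub> v j) \<in> carrier (direct_sum J D)"
    if u: "u \<in> carrier (direct_sum J D)" and v: "v \<in> carrier (direct_sum J D)" for u v
  proof -
    have "finite ({j. u j \<noteq> \<zero>\<^bsub>D j\<^esub>} \<union> {j. v j \<noteq> \<zero>\<^bsub>D j\<^esub>})"
      using u v by (auto simp: direct_sum_carrier)
    moreover have "{j. u j \<oplus>\<^bsub>D j\<^esub> v j \<noteq> \<zero>\<^bsub>D j\<^esub>} \<subseteq> {j. u j \<noteq> \<zero>\<^bsub>D j\<^esub>} \<union> {j. v j \<noteq> \<zero>\<^bsub>D j\<^esub>}"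
      by auto
    ultimately show ?thesis
      using u v finite_subset by (auto simp: direct_sum_carrier)
  qed
  have smult: "(\<lambda>j. c \<odot>\<^bsub>D j\<^esub> u j) \<in> carrier (direct_sum J D)"
    if c: "c \<in> carrier K" and u: "u \<in> carrier (direct_sum J D)" for c u
  proof -
    have "{j. c \<odot>\<^bsub>D j\<^esub> u j \<noteq> \<zero>\<^bsub>D j\<^esub>} \<subseteq> {j. u j \<noteq> \<zero>\<^bsub>D j\<^esub>}"
      using c by auto
    then show ?thesis
      using u c finite_subset by (auto simp: direct_sum_carrier)
  qed
  have "abelian_group (direct_sum J D)"
  proof (rule abelian_groupI)
    fix u assume u: "u \<in> carrier (direct_sum J D)"
    have "{j. \<ominus>\<^bsub>D j\<^esub> u j \<noteq> \<zero>\<^bsub>D j\<^esub>} \<subseteq> {j. u j \<noteq> \<zero>\<^bsub>D j\<^esub>}"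
      by auto
    then have "(\<lambda>j. \<ominus>\<^bsub>D j\<^esub> u j) \<in> carrier (direct_sum J D)"
      using u finite_subset by (auto simp: direct_sum_carrier)
    then show "\<exists>v\<in>carrier (direct_sum J D). v \<oplus>\<^bsub>direct_sum J D\<^esub> u = \<zero>\<^bsub>direct_sum J D\<^esub>"
      using u car by (auto simp: direct_sum_simps D.M.l_neg intro!: bexI[of _ "\<lambda>j. \<ominus>\<^bsub>D j\<^esub> u j"])
  next
    show "\<zero>\<^bsub>direct_sum J D\<^esub> \<in> carrier (direct_sum J D)"
      by (simp add: direct_sum_simps direct_sum_carrier)
  qed (use car add in \<open>auto simp: direct_sum_simps D.M.a_assoc intro: D.M.a_comm\<close>)
  then show ?thesis
    by (intro moduleI)
      (use assms(1) smult car in \<open>auto simp: direct_sum_simps D.smult_l_distr D.smult_r_distr D.smult_assoc1\<close>)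
qed

lemma in_summand_linear:
  assumes D: "\<And>j. Module.module K (D j)" and j: "j \<in> J"
  shows "in_summand D j \<in> linear_maps K (D j) (direct_sum J D)"
proof -
  interpret D: Module.module K "D j" for j by (rule D)
  show ?thesis
    using j by (intro linear_mapsI)
      (auto simp: direct_sum_carrier direct_sum_simps in_summand_def fun_eq_iff
        intro: finite_subset[of _ "{j}"])
qed

lemma direct_sum_generation:
  assumes D: "\<And>j. Module.module K (D j)" and H: "submodule H K (direct_sum J D)"
    and gen: "\<And>j x. j \<in> J \<Longrightarrow> x \<in> carrier (D j) \<Longrightarrow> in_summand D j x \<in> H"
  shows "carrier (direct_sum J D) \<subseteq> H"
proof
  interpret D: Module.module K "D j" for j by (rule D)
  have mod: "Module.module K (direct_sum J D)"
    by (rule direct_sum_module[OF D.R.is_cring D])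
  interpret S: Module.module K "direct_sum J D" by (rule mod)
  \<comment> \<open>\<open>F\<close> only bounds the support, so deleting one coordinate keeps the
    induction hypothesis applicable even if that coordinate was already zero.\<close>
  have *: "u \<in> carrier (direct_sum J D) \<longrightarrow> {j. u j \<noteq> \<zero>\<^bsub>D j\<^esub>} \<subseteq> F \<longrightarrow> u \<in> H" if "finite F" for F u
    using that
  proof (induction F arbitrary: u)
    case empty
    have "\<zero>\<^bsub>direct_sum J D\<^esub> \<in> H"
      by (rule submodule_zero_mem[OF mod H])
    then show ?case
      by (auto simp: direct_sum_simps simp flip: fun_eq_iff)
  next
    case (insert j F)
    show ?case
    proof (intro impI)
      assume u: "u \<in> carrier (direct_sum J D)" and sub: "{j. u j \<noteq> \<zero>\<^bsub>D j\<^esub>} \<subseteq> insert j F"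
      let ?v = "u(j := \<zero>\<^bsub>D j\<^esub>)"
      have uj: "u j \<in> carrier (D j)" for j
        using u by (cases "j \<in> J") (auto simp: direct_sum_carrier)
      have "finite {i. u i \<noteq> \<zero>\<^bsub>D i\<^esub>}"
        using u by (auto simp: direct_sum_carrier)
      then have "finite {i. ?v i \<noteq> \<zero>\<^bsub>D i\<^esub>}"
        by (rule rev_finite_subset) auto
      then have "?v \<in> carrier (direct_sum J D)"
        using u by (auto simp: direct_sum_carrier)
      moreover have "{i. ?v i \<noteq> \<zero>\<^bsub>D i\<^esub>} \<subseteq> F"
        using sub by auto
      ultimately have v: "?v \<in> H"
        using insert.IH by blast
      show "u \<in> H"
      proof (cases "j \<in> J")
        case True
        have "u = in_summand D j (u j) \<oplus>\<^bsub>direct_sum J D\<^esub> ?v"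
          using uj by (auto simp: direct_sum_simps in_summand_def fun_eq_iff)
        moreover have "in_summand D j (u j) \<in> H"
          using gen True uj by blast
        ultimately show ?thesis
          using v S.submoduleE(5)[OF H] by metis
      next
        case False
        then have "?v = u"
          using u by (auto simp: direct_sum_carrier)
        then show ?thesis using v by simp
      qed
    qed
  qed
  fix u assume "u \<in> carrier (direct_sum J D)"
  then show "u \<in> H"
    using *[of "{j. u j \<noteq> \<zero>\<^bsub>D j\<^esub>}" u] by (auto simp: direct_sum_carrier)
qed

text \<open>The map that the universal property of direct sums attaches to the family
  \<open>\<phi>\<close>, as an explicit sum over the support. For a free space and maps sending
  \<open>c\<close> to \<open>c\<close> times a fixed vector, it is the very sum in the definition of
  \<open>tensor_map\<close>.\<close>

definition direct_sum_lift ::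
  "('j \<Rightarrow> ('k, 'v) module) \<Rightarrow> ('k, 'w) module \<Rightarrow> ('j \<Rightarrow> 'v \<Rightarrow> 'w) \<Rightarrow> ('j \<Rightarrow> 'v) \<Rightarrow> 'w" where
  "direct_sum_lift D W \<phi> u = (\<Oplus>\<^bsub>W\<^esub>j\<in>{j. u j \<noteq> \<zero>\<^bsub>D j\<^esub>}. \<phi> j (u j))"

lemma direct_sum_lift:
  assumes D: "\<And>j. Module.module K (D j)" and W: "Module.module K W"
    and \<phi>: "\<And>j. j \<in> J \<Longrightarrow> \<phi> j \<in> linear_maps K (D j) W"
  shows "direct_sum_lift D W \<phi> \<in> linear_maps K (direct_sum J D) W"
    and "j \<in> J \<Longrightarrow> x \<in> carrier (D j) \<Longrightarrow> direct_sum_lift D W \<phi> (in_summand D j x) = \<phi> j x"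
proof -
  interpret D: Module.module K "D j" for j by (rule D)
  interpret W: Module.module K W by (rule W)
  interpret S: Module.module K "direct_sum J D"
    by (rule direct_sum_module[OF D.R.is_cring D])
  have zero: "\<phi> j \<zero>\<^bsub>D j\<^esub> = \<zero>\<^bsub>W\<^esub>" if "j \<in> J" for j
    by (rule linear_maps_zero_minus(1)[OF D W \<phi>[OF that]])
  have car: "\<phi> j (u j) \<in> carrier W" if "u \<in> carrier (direct_sum J D)" "j \<in> J" for u j
    using that linear_mapsD(1)[OF \<phi>] by (auto simp: direct_sum_carrier)
  \<comment> \<open>The support of a sum may be smaller than the union of the supports. Sums over
    supports become comparable once they are extended by zero terms to a common finite set.\<close>
  have superset: "direct_sum_lift D W \<phi> u = (\<Oplus>\<^bsub>W\<^esub>j\<in>F. \<phi> j (u j))"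
    if u: "u \<in> carrier (direct_sum J D)" and F: "finite F" "F \<subseteq> J" "{j. u j \<noteq> \<zero>\<^bsub>D j\<^esub>} \<subseteq> F" for u F
    unfolding direct_sum_lift_def
    using F zero car[OF u] by (intro W.M.add.finprod_mono_neutral_cong_left) auto
  have supp: "finite {j. u j \<noteq> \<zero>\<^bsub>D j\<^esub>}" "{j. u j \<noteq> \<zero>\<^bsub>D j\<^esub>} \<subseteq> J" if "u \<in> carrier (direct_sum J D)" for u
    using that by (auto simp: direct_sum_carrier)
  show "direct_sum_lift D W \<phi> \<in> linear_maps K (direct_sum J D) W"
  proof (rule linear_mapsI)
    show "direct_sum_lift D W \<phi> u \<in> carrier W" if "u \<in> carrier (direct_sum J D)" for u
      unfolding direct_sum_lift_def using car[OF that] supp[OF that] by (intro W.M.finsum_closed) auto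
  next
    fix u v assume u: "u \<in> carrier (direct_sum J D)" and v: "v \<in> carrier (direct_sum J D)"
    let ?F = "{j. u j \<noteq> \<zero>\<^bsub>D j\<^esub>} \<union> {j. v j \<noteq> \<zero>\<^bsub>D j\<^esub>}"
    have F: "finite ?F" "?F \<subseteq> J"
      using supp u v by auto
    have "direct_sum_lift D W \<phi> (u \<oplus>\<^bsub>direct_sum J D\<^esub> v) = (\<Oplus>\<^bsub>W\<^esub>j\<in>?F. \<phi> j (u j \<oplus>\<^bsub>D j\<^esub> v j))"
      unfolding direct_sum_simps
      by (rule superset[OF S.M.a_closed[OF u v, unfolded direct_sum_simps] F]) auto
    also have "\<dots> = (\<Oplus>\<^bsub>W\<^esub>j\<in>?F. \<phi> j (u j) \<oplus>\<^bsub>W\<^esub> \<phi> j (v j))"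
    proof (rule W.M.finsum_cong'[OF refl])
      show "(\<lambda>j. \<phi> j (u j) \<oplus>\<^bsub>W\<^esub> \<phi> j (v j)) \<in> ?F \<rightarrow> carrier W"
        using F(2) car[OF u] car[OF v] by blast
      show "\<phi> j (u j \<oplus>\<^bsub>D j\<^esub> v j) = \<phi> j (u j) \<oplus>\<^bsub>W\<^esub> \<phi> j (v j)" if "j \<in> ?F" for j
        using F(2) that u v by (intro linear_mapsD(2)[OF \<phi>]) (auto simp: direct_sum_carrier)
    qed
    also have "\<dots> = (\<Oplus>\<^bsub>W\<^esub>j\<in>?F. \<phi> j (u j)) \<oplus>\<^bsub>W\<^esub> (\<Oplus>\<^bsub>W\<^esub>j\<in>?F. \<phi> j (v j))"
      using F(2) car[OF u] car[OF v] by (intro W.M.finsum_addf) blast+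
    finally show "direct_sum_lift D W \<phi> (u \<oplus>\<^bsub>direct_sum J D\<^esub> v) =
        direct_sum_lift D W \<phi> u \<oplus>\<^bsub>W\<^esub> direct_sum_lift D W \<phi> v"
      using superset[OF u F] superset[OF v F] by auto
  next
    fix c u assume c: "c \<in> carrier K" and u: "u \<in> carrier (direct_sum J D)"
    let ?F = "{j. u j \<noteq> \<zero>\<^bsub>D j\<^esub>}"
    have "direct_sum_lift D W \<phi> (c \<odot>\<^bsub>direct_sum J D\<^esub> u) = (\<Oplus>\<^bsub>W\<^esub>j\<in>?F. \<phi> j (c \<odot>\<^bsub>D j\<^esub> u j))"
      unfolding direct_sum_simps using c
      by (intro superset[OF S.smult_closed[OF c u, unfolded direct_sum_simps] supp[OF u]]) auto
    also have "\<dots> = (\<Oplus>\<^bsub>W\<^esub>j\<in>?F. c \<odot>\<^bsub>W\<^esub> \<phi> j (u j))"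
    proof (rule W.M.finsum_cong'[OF refl])
      show "(\<lambda>j. c \<odot>\<^bsub>W\<^esub> \<phi> j (u j)) \<in> ?F \<rightarrow> carrier W"
        using supp(2)[OF u] car[OF u] c by blast
      show "\<phi> j (c \<odot>\<^bsub>D j\<^esub> u j) = c \<odot>\<^bsub>W\<^esub> \<phi> j (u j)" if "j \<in> ?F" for j
        using supp(2)[OF u] that u c by (intro linear_mapsD(3)[OF \<phi>]) (auto simp: direct_sum_carrier)
    qed
    also have "\<dots> = c \<odot>\<^bsub>W\<^esub> (\<Oplus>\<^bsub>W\<^esub>j\<in>?F. \<phi> j (u j))"
      using supp[OF u] car[OF u] c by (intro W.finsum_smult_ldistr[symmetric]) auto
    finally show "direct_sum_lift D W \<phi> (c \<odot>\<^bsub>direct_sum J D\<^esub> u) = c \<odot>\<^bsub>W\<^esub> direct_sum_lift D W \<phi> u"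
      by (simp add: direct_sum_lift_def)
  qed
  assume j: "j \<in> J" and x: "x \<in> carrier (D j)"
  have "in_summand D j x \<in> carrier (direct_sum J D)"
    by (rule linear_mapsD(1)[OF in_summand_linear[where D = D, OF D j] x])
  then have "direct_sum_lift D W \<phi> (in_summand D j x) = (\<Oplus>\<^bsub>W\<^esub>i\<in>{j}. \<phi> i (in_summand D j x i))"
    using j by (intro superset) (auto simp: in_summand_def split: if_splits)
  also have "\<dots> = \<phi> j x"
    using linear_mapsD(1)[OF \<phi>[OF j] x] by (simp add: in_summand_def)
  finally show "direct_sum_lift D W \<phi> (in_summand D j x) = \<phi> j x" .
qed

section \<open>Tensor products and colimits\<close>

lemma regular_space_module:
  assumes "cring K"
  shows "Module.module K (regular_space K)"
proof -
  interpret cring K by fact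
  have "abelian_group (regular_space K)"
  proof (rule abelian_groupI)
    show "\<exists>y\<in>carrier (regular_space K). y \<oplus>\<^bsub>regular_space K\<^esub> x = \<zero>\<^bsub>regular_space K\<^esub>"
      if "x \<in> carrier (regular_space K)" for x
      using that l_neg[of x] by (auto simp: regular_space_def intro!: bexI[of _ "\<ominus>\<^bsub>K\<^esub> x"])
  qed (auto simp: regular_space_def a_assoc a_comm a_lcomm)
  then show ?thesis
    by (intro moduleI) (auto simp: regular_space_def l_distr r_distr m_assoc is_cring)
qed

lemma regular_space_simps [simp]:
  "carrier (regular_space K) = carrier K" "\<zero>\<^bsub>regular_space K\<^esub> = \<zero>\<^bsub>K\<^esub>"
  "x \<oplus>\<^bsub>regular_space K\<^esub> y = x \<oplus>\<^bsub>K\<^esub> y" "c \<odot>\<^bsub>regular_space K\<^esub> x = c \<otimes>\<^bsub>K\<^esub> x"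
  by (simp_all add: regular_space_def)

lemma free_space_module: "cring K \<Longrightarrow> Module.module K (free_space K X)"
  unfolding free_space_def by (intro direct_sum_module regular_space_module)

lemma free_gen_closed:
  assumes "cring K" "x \<in> X"
  shows "free_gen K x \<in> carrier (free_space K X)"
proof -
  interpret cring K by fact
  show ?thesis
    using linear_mapsD(1)[OF in_summand_linear[where D = "\<lambda>_. regular_space K", OF regular_space_module[OF assms(1)] assms(2)]]
    by (simp add: free_gen_def free_space_def)
qed

lemma in_summand_eq_smult_free_gen:
  assumes "cring K" "c \<in> carrier K" "x \<in> X"
  shows "in_summand (\<lambda>_. regular_space K) x c = c \<odot>\<^bsub>free_space K X\<^esub> free_gen K x"
proof -
  interpret cring K by fact
  show ?thesis
    using assms by (auto simp: free_gen_def free_space_def direct_sum_simps in_summand_def fun_eq_iff)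
qed

lemma free_space_generation:
  assumes K: "cring K" and H: "submodule H K (free_space K X)"
    and gen: "\<And>x. x \<in> X \<Longrightarrow> free_gen K x \<in> H"
  shows "carrier (free_space K X) \<subseteq> H"
proof -
  have "c \<odot>\<^bsub>free_space K X\<^esub> free_gen K x \<in> H" if "c \<in> carrier K" "x \<in> X" for c x
    using submodule.smult_closed[OF H that(1) gen[OF that(2)]] .
  then show ?thesis
    using H direct_sum_generation[OF regular_space_module[OF K], of H X]
    by (simp add: free_space_def in_summand_eq_smult_free_gen[OF K, unfolded free_space_def])
qed

section \<open>Bilinear maps and the universal property of the tensor product\<close>

definition bilinear_map ::
  "('k, 'x) ring_scheme \<Rightarrow> ('k, 'v) module \<Rightarrow> ('k, 'w) module \<Rightarrow> ('k, 'z) module \<Rightarrow>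
   ('v \<Rightarrow> 'w \<Rightarrow> 'z) \<Rightarrow> bool" where
  "bilinear_map K V W Z \<beta> \<longleftrightarrow> (\<forall>x\<in>carrier V. \<beta> x \<in> linear_maps K W Z) \<and>
     (\<forall>y\<in>carrier W. (\<lambda>x. \<beta> x y) \<in> linear_maps K V Z)"

lemma bilinear_mapD:
  assumes "bilinear_map K V W Z \<beta>" and "x \<in> carrier V" and "y \<in> carrier W"
  shows "\<beta> x y \<in> carrier Z"
    and "x' \<in> carrier V \<Longrightarrow> \<beta> (x \<oplus>\<^bsub>V\<^esub> x') y = \<beta> x y \<oplus>\<^bsub>Z\<^esub> \<beta> x' y"
    and "y' \<in> carrier W \<Longrightarrow> \<beta> x (y \<oplus>\<^bsub>W\<^esub> y') = \<beta> x y \<oplus>\<^bsub>Z\<^esub> \<beta> x y'"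
    and "c \<in> carrier K \<Longrightarrow> \<beta> (c \<odot>\<^bsub>V\<^esub> x) y = c \<odot>\<^bsub>Z\<^esub> \<beta> x y"
    and "c \<in> carrier K \<Longrightarrow> \<beta> x (c \<odot>\<^bsub>W\<^esub> y) = c \<odot>\<^bsub>Z\<^esub> \<beta> x y"
  using assms by (auto simp: bilinear_map_def linear_maps_def)

definition pure_tensor ::
  "('k, 'x) ring_scheme \<Rightarrow> ('k, 'v) module \<Rightarrow> ('k, 'w) module \<Rightarrow> 'v \<Rightarrow> 'w \<Rightarrow> ('v \<times> 'w \<Rightarrow> 'k) set" where
  "pure_tensor K V W x y = tensor_kernel K V W +>\<^bsub>pair_space K V W\<^esub> free_gen K (x, y)"

lemma bilinear_relations_closed:
  assumes V: "Module.module K V" and W: "Module.module K W"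
  shows "bilinear_relations K V W \<subseteq> carrier (pair_space K V W)"
proof -
  interpret V: Module.module K V by fact
  interpret W: Module.module K W by fact
  interpret F: Module.module K "pair_space K V W"
    by (rule free_space_module[OF V.R.is_cring])
  have "free_gen K (x, y) \<in> carrier (pair_space K V W)" if "x \<in> carrier V" "y \<in> carrier W" for x y
    using that by (intro free_gen_closed V.R.is_cring) auto
  then show ?thesis
    unfolding bilinear_relations_def Let_def by auto
qed

lemma tensor_kernel_submodule:
  assumes V: "Module.module K V" and W: "Module.module K W"
  shows "submodule (tensor_kernel K V W) K (pair_space K V W)"
proof -
  interpret V: Module.module K V by fact
  show ?thesis
    unfolding tensor_kernel_def
    by (intro submodule_generated_submodule free_space_module[OF V.R.is_cring]
        bilinear_relations_closed assms)
qed

lemma tensor_module: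
  assumes V: "Module.module K V" and W: "Module.module K W"
  shows "Module.module K (tensor K V W)"
proof -
  interpret V: Module.module K V by fact
  show ?thesis
    unfolding tensor_def
    by (intro quotient_space_module(1) free_space_module[OF V.R.is_cring] tensor_kernel_submodule assms)
qed

text \<open>The four families in \<open>bilinear_relations\<close> are the four laws of bilinearity:
  each time the two cosets to be compared differ by a single relation.\<close>

lemma pure_tensor_bilinear:
  assumes V: "Module.module K V" and W: "Module.module K W"
  shows "bilinear_map K V W (tensor K V W) (pure_tensor K V W)"
proof -
  interpret V: Module.module K V by fact
  interpret W: Module.module K W by fact
  let ?F = "pair_space K V W" and ?H = "tensor_kernel K V W"
  note F = free_space_module[OF V.R.is_cring, of "carrier V \<times> carrier W"]
  note H = tensor_kernel_submodule[OF V W]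
  interpret F: Module.module K ?F by (rule F)
  have e: "free_gen K (x, y) \<in> carrier ?F" if "x \<in> carrier V" "y \<in> carrier W" for x y
    using that by (intro free_gen_closed V.R.is_cring) auto
  have rel: "r \<in> ?H" if "r \<in> bilinear_relations K V W" for r
    unfolding tensor_kernel_def using that by (rule subsetD[OF submodule_generated_incl])
  note q = linear_mapsD(2,3)[OF quotient_space_module(2)[OF F H], folded tensor_def, symmetric]
  show ?thesis
    unfolding bilinear_map_def
  proof (intro conjI ballI linear_mapsI)
    fix x y assume x: "x \<in> carrier V" and y: "y \<in> carrier W"
    show "pure_tensor K V W x y \<in> carrier (tensor K V W)"
         "pure_tensor K V W x y \<in> carrier (tensor K V W)"
      using e[OF x y] by (auto simp: pure_tensor_def tensor_def carrier_quotient_space)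
    show "pure_tensor K V W (x \<oplus>\<^bsub>V\<^esub> x') y =
        pure_tensor K V W x y \<oplus>\<^bsub>tensor K V W\<^esub> pure_tensor K V W x' y" if "x' \<in> carrier V" for x'
      unfolding pure_tensor_def q(1)[OF e e, OF x y that y]
      by (rule coset_eqI[OF F H _ _ rel], unfold bilinear_relations_def Let_def)
        (use x y that e in \<open>simp, simp, blast\<close>)
    show "pure_tensor K V W x (y \<oplus>\<^bsub>W\<^esub> y') =
        pure_tensor K V W x y \<oplus>\<^bsub>tensor K V W\<^esub> pure_tensor K V W x y'" if "y' \<in> carrier W" for y'
      unfolding pure_tensor_def q(1)[OF e e, OF x y x that]
      by (rule coset_eqI[OF F H _ _ rel], unfold bilinear_relations_def Let_def)
        (use x y that e in \<open>simp, simp, blast\<close>)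
    show "pure_tensor K V W (c \<odot>\<^bsub>V\<^esub> x) y = c \<odot>\<^bsub>tensor K V W\<^esub> pure_tensor K V W x y"
      if "c \<in> carrier K" for c
      unfolding pure_tensor_def q(2)[OF that e, OF x y]
      by (rule coset_eqI[OF F H _ _ rel], unfold bilinear_relations_def Let_def)
        (use x y that e in \<open>simp, simp, blast\<close>)
    show "pure_tensor K V W x (c \<odot>\<^bsub>W\<^esub> y) = c \<odot>\<^bsub>tensor K V W\<^esub> pure_tensor K V W x y"
      if "c \<in> carrier K" for c
      unfolding pure_tensor_def q(2)[OF that e, OF x y]
      by (rule coset_eqI[OF F H _ _ rel], unfold bilinear_relations_def Let_def)
        (use x y that e in \<open>simp, simp, blast\<close>)
  qed
qed

lemma tensor_generation:
  assumes V: "Module.module K V" and W: "Module.module K W" and G: "submodule G K (tensor K V W)"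
    and gen: "\<And>x y. x \<in> carrier V \<Longrightarrow> y \<in> carrier W \<Longrightarrow> pure_tensor K V W x y \<in> G"
  shows "carrier (tensor K V W) \<subseteq> G"
proof -
  interpret V: Module.module K V by fact
  show ?thesis
    unfolding tensor_def
  proof (rule quotient_generation[OF free_space_module[OF V.R.is_cring] tensor_kernel_submodule[OF V W]
        G[unfolded tensor_def]])
    show "carrier (pair_space K V W) \<subseteq> L"
      if "submodule L K (pair_space K V W)" and "\<And>u. u \<in> free_gen K ` (carrier V \<times> carrier W) \<Longrightarrow> u \<in> L" for L
      using that by (intro free_space_generation[OF V.R.is_cring]) auto
    show "u \<in> carrier (pair_space K V W) \<and> tensor_kernel K V W +>\<^bsub>pair_space K V W\<^esub> u \<in> G"
      if "u \<in> free_gen K ` (carrier V \<times> carrier W)" for u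
    proof -
      obtain x y where "u = free_gen K (x, y)" "x \<in> carrier V" "y \<in> carrier W"
        using \<open>u \<in> free_gen K ` (carrier V \<times> carrier W)\<close> by auto
      then show ?thesis
        using gen[of x y] free_gen_closed[OF V.R.is_cring, of "(x, y)"] by (simp add: pure_tensor_def)
    qed
  qed
qed

text \<open>Formulated on the free space, before the quotient is taken: the study of
  \<open>tensor_map\<close> compares this map with another one on the free space and then needs its
  vanishing on the kernel.\<close>

lemma tensor_lift:
  assumes V: "Module.module K V" and W: "Module.module K W" and Z: "Module.module K Z"
    and \<beta>: "bilinear_map K V W Z \<beta>"
  shows "direct_sum_lift (\<lambda>_. regular_space K) Z (\<lambda>p c. c \<odot>\<^bsub>Z\<^esub> \<beta> (fst p) (snd p))
      \<in> linear_maps K (pair_space K V W) Z" (is "?h \<in> _")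
    and "x \<in> carrier V \<Longrightarrow> y \<in> carrier W \<Longrightarrow>
      direct_sum_lift (\<lambda>_. regular_space K) Z (\<lambda>p c. c \<odot>\<^bsub>Z\<^esub> \<beta> (fst p) (snd p)) (free_gen K (x, y)) = \<beta> x y"
    and "u \<in> tensor_kernel K V W \<Longrightarrow>
      direct_sum_lift (\<lambda>_. regular_space K) Z (\<lambda>p c. c \<odot>\<^bsub>Z\<^esub> \<beta> (fst p) (snd p)) u = \<zero>\<^bsub>Z\<^esub>"
proof -
  interpret V: Module.module K V by fact
  interpret W: Module.module K W by fact
  interpret Z: Module.module K Z by fact
  let ?F = "pair_space K V W"
  note F = free_space_module[OF V.R.is_cring, of "carrier V \<times> carrier W"]
  interpret F: Module.module K ?F by (rule F)
  have lin: "(\<lambda>c. c \<odot>\<^bsub>Z\<^esub> \<beta> (fst p) (snd p)) \<in> linear_maps K (regular_space K) Z"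
    if "p \<in> carrier V \<times> carrier W" for p
    using that bilinear_mapD(1)[OF \<beta>]
    by (intro linear_mapsI) (auto simp: Z.smult_l_distr Z.smult_assoc1)
  note lift = direct_sum_lift[where J = "carrier V \<times> carrier W" and D = "\<lambda>_. regular_space K",
      OF regular_space_module[OF V.R.is_cring] Z lin]
  show h: "?h \<in> linear_maps K ?F Z"
    using lift(1) by (simp add: free_space_def)
  have e: "free_gen K (x, y) \<in> carrier ?F" if "x \<in> carrier V" "y \<in> carrier W" for x y
    using that by (intro free_gen_closed V.R.is_cring) auto
  show he: "?h (free_gen K (x, y)) = \<beta> x y" if "x \<in> carrier V" "y \<in> carrier W" for x y
    using that bilinear_mapD(1)[OF \<beta>] by (simp add: free_gen_def lift(2))
  have z: "a \<ominus>\<^bsub>Z\<^esub> a = \<zero>\<^bsub>Z\<^esub>" if "a \<in> carrier Z" for a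
    using that by (simp add: a_minus_def Z.M.r_neg)
  have rel: "?h r = \<zero>\<^bsub>Z\<^esub>" if "r \<in> bilinear_relations K V W" for r
    using that bilinear_mapD[OF \<beta>]
    by (auto simp: bilinear_relations_def Let_def linear_maps_diff[OF F Z h] e he z
        linear_mapsD(2,3)[OF h])
  have "?h ` tensor_kernel K V W \<subseteq> {\<zero>\<^bsub>Z\<^esub>}"
    unfolding tensor_kernel_def
    by (rule linear_image_generated[OF F Z h zero_submodule[OF Z] bilinear_relations_closed[OF V W]])
      (simp add: rel)
  then show "u \<in> tensor_kernel K V W \<Longrightarrow> ?h u = \<zero>\<^bsub>Z\<^esub>"
    by auto
qed

lemma tensor_universal:
  assumes V: "Module.module K V" and W: "Module.module K W" and Z: "Module.module K Z"
    and \<beta>: "bilinear_map K V W Z \<beta>"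
  obtains h where "h \<in> linear_maps K (tensor K V W) Z"
    and "\<And>x y. x \<in> carrier V \<Longrightarrow> y \<in> carrier W \<Longrightarrow> h (pure_tensor K V W x y) = \<beta> x y"
proof -
  interpret V: Module.module K V by fact
  note F = free_space_module[OF V.R.is_cring, of "carrier V \<times> carrier W"]
  obtain h where h: "h \<in> linear_maps K (tensor K V W) Z"
    "\<And>u. u \<in> carrier (pair_space K V W) \<Longrightarrow> h (tensor_kernel K V W +>\<^bsub>pair_space K V W\<^esub> u) =
      direct_sum_lift (\<lambda>_. regular_space K) Z (\<lambda>p c. c \<odot>\<^bsub>Z\<^esub> \<beta> (fst p) (snd p)) u"
    unfolding tensor_def
    by (rule quotient_lift[OF F tensor_kernel_submodule[OF V W] Z tensor_lift(1,3)[OF assms]]) blast+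
  show ?thesis
    by (rule that[OF h(1)])
      (simp add: pure_tensor_def h(2) tensor_lift(2)[OF assms] free_gen_closed[OF V.R.is_cring])
qed

lemma tensor_map:
  assumes V: "Module.module K V" and W: "Module.module K W"
    and V': "Module.module K V'" and W': "Module.module K W'"
    and f: "f \<in> linear_maps K V V'" and g: "g \<in> linear_maps K W W'"
  shows "tensor_map K V' W' f g \<in> linear_maps K (tensor K V W) (tensor K V' W')"
    and "x \<in> carrier V \<Longrightarrow> y \<in> carrier W \<Longrightarrow>
      tensor_map K V' W' f g (pure_tensor K V W x y) = pure_tensor K V' W' (f x) (g y)"
proof -
  interpret V: Module.module K V by fact
  let ?F = "pair_space K V W" and ?F' = "pair_space K V' W'"
    and ?H = "tensor_kernel K V W" and ?H' = "tensor_kernel K V' W'"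
  note F = free_space_module[OF V.R.is_cring, of "carrier V \<times> carrier W"]
    and F' = free_space_module[OF V.R.is_cring, of "carrier V' \<times> carrier W'"]
  note H = tensor_kernel_submodule[OF V W] and H' = tensor_kernel_submodule[OF V' W']
  interpret F: Module.module K ?F by (rule F)
  interpret F': Module.module K ?F' by (rule F')
  let ?e = "\<lambda>p. free_gen K (f (fst p), g (snd p))"
  let ?h = "direct_sum_lift (\<lambda>_. regular_space K) ?F' (\<lambda>p c. c \<odot>\<^bsub>?F'\<^esub> ?e p)"
  have map: "tensor_map K V' W' f g = quotient_map ?F' ?H' ?h"
    by (simp add: tensor_map_def direct_sum_lift_def[abs_def])
  have e: "?e p \<in> carrier ?F'" if "p \<in> carrier V \<times> carrier W" for p
    using that linear_mapsD(1)[OF f] linear_mapsD(1)[OF g]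
    by (intro free_gen_closed V.R.is_cring) auto
  have lin: "(\<lambda>c. c \<odot>\<^bsub>?F'\<^esub> ?e p) \<in> linear_maps K (regular_space K) ?F'"
    if "p \<in> carrier V \<times> carrier W" for p
    using e[OF that] by (intro linear_mapsI) (auto simp: F'.smult_l_distr F'.smult_assoc1)
  note lift = direct_sum_lift[where J = "carrier V \<times> carrier W" and D = "\<lambda>_. regular_space K",
      OF regular_space_module[OF V.R.is_cring] F' lin]
  have h: "?h \<in> linear_maps K ?F ?F'"
    using lift(1) by (simp add: free_space_def)
  have he: "?h (free_gen K (x, y)) = free_gen K (f x, g y)"
    if "x \<in> carrier V" "y \<in> carrier W" for x y
    unfolding free_gen_def[of K "(x, y)"] using that e[of "(x, y)"] by (simp add: lift(2))
  \<comment> \<open>Composition with the pure tensors of the target is bilinear, so its lift kills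
    \<open>tensor_kernel\<close> by \<open>tensor_lift\<close>. This spares a second inspection of
    the four kinds of relations.\<close>
  have \<beta>: "bilinear_map K V W (tensor K V' W') (\<lambda>x y. pure_tensor K V' W' (f x) (g y))"
    using bilinear_mapD[OF pure_tensor_bilinear[OF V' W']] linear_mapsD[OF f] linear_mapsD[OF g]
    by (auto simp: bilinear_map_def intro!: linear_mapsI)
  have q': "(\<lambda>u. ?H' +>\<^bsub>?F'\<^esub> u) \<in> linear_maps K ?F' (tensor K V' W')"
    unfolding tensor_def by (rule quotient_space_module(2)[OF F' H'])
  \<comment> \<open>Both sides are linear in \<open>u\<close> and agree on generators, so \<open>h\<close> maps the kernel into the kernel.\<close>
  let ?k = "direct_sum_lift (\<lambda>_. regular_space K) (tensor K V' W')
    (\<lambda>p c. c \<odot>\<^bsub>tensor K V' W'\<^esub> pure_tensor K V' W' (f (fst p)) (g (snd p)))"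
  note k = tensor_lift[OF V W tensor_module[OF V' W'] \<beta>]
  have hk: "carrier ?F \<subseteq> {u \<in> carrier ?F. ?H' +>\<^bsub>?F'\<^esub> ?h u = ?k u}"
  proof (rule free_space_generation[OF V.R.is_cring])
    show "submodule {u \<in> carrier ?F. ?H' +>\<^bsub>?F'\<^esub> ?h u = ?k u} K ?F"
      by (rule equalizer_submodule[OF F tensor_module[OF V' W'] linear_maps_comp[OF h q'] k(1)])
    show "free_gen K p \<in> {u \<in> carrier ?F. ?H' +>\<^bsub>?F'\<^esub> ?h u = ?k u}"
      if "p \<in> carrier V \<times> carrier W" for p
      using that free_gen_closed[OF V.R.is_cring that]
      by (cases p) (simp add: he k(2) flip: pure_tensor_def)
  qed
  have ker: "?h ` ?H \<subseteq> ?H'"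
  proof safe
    fix u assume u: "u \<in> ?H"
    then have uF: "u \<in> carrier ?F"
      using F.submoduleE(1)[OF H] by auto
    then have "?H' +>\<^bsub>?F'\<^esub> ?h u = ?k u"
      using hk by blast
    then have "?H' +>\<^bsub>?F'\<^esub> ?h u = \<zero>\<^bsub>tensor K V' W'\<^esub>"
      using k(3)[OF u] by simp
    then show "?h u \<in> ?H'"
      using coset_eq_zero_iff[OF F' H' linear_mapsD(1)[OF h uF]] by (simp add: tensor_def)
  qed
  show "tensor_map K V' W' f g \<in> linear_maps K (tensor K V W) (tensor K V' W')"
    unfolding map tensor_def by (rule quotient_map_linear[OF F H F' H' h ker])
  show "tensor_map K V' W' f g (pure_tensor K V W x y) = pure_tensor K V' W' (f x) (g y)"
    if "x \<in> carrier V" "y \<in> carrier W"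
    using that by (simp add: map pure_tensor_def quotient_map_coset[OF F H F' H' h ker] he
        free_gen_closed[OF V.R.is_cring])
qed


subsection \<open>Colimits\<close>

locale diagram =
  fixes K :: "('k, 'x) ring_scheme" and J :: "'j set" and leq :: "'j \<Rightarrow> 'j \<Rightarrow> bool"
    and D :: "'j \<Rightarrow> ('k, 'v) module" and \<phi> :: "'j \<Rightarrow> 'j \<Rightarrow> 'v \<Rightarrow> 'v"
  assumes D: "\<And>j. Module.module K (D j)"
    and \<phi>: "\<And>i j. i \<in> J \<Longrightarrow> j \<in> J \<Longrightarrow> leq i j \<Longrightarrow> \<phi> i j \<in> linear_maps K (D i) (D j)"
begin

abbreviation "relations \<equiv> {in_summand D i x \<ominus>\<^bsub>direct_sum J D\<^esub> in_summand D j (\<phi> i j x) |i j x.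
        i \<in> J \<and> j \<in> J \<and> leq i j \<and> x \<in> carrier (D i)}"

definition colim_in :: "'j \<Rightarrow> 'v \<Rightarrow> ('j \<Rightarrow> 'v) set" where
  "colim_in j x = colim_kernel K J leq D \<phi> +>\<^bsub>direct_sum J D\<^esub> in_summand D j x"

lemma cring: "cring K"
  using D by (simp add: Module.module_def)

lemma sum_module: "Module.module K (direct_sum J D)"
  by (rule direct_sum_module[OF cring D])

lemma in_summand_closed: "j \<in> J \<Longrightarrow> x \<in> carrier (D j) \<Longrightarrow> in_summand D j x \<in> carrier (direct_sum J D)"
  using linear_mapsD(1)[OF in_summand_linear[where D = D, OF D]] .

lemma relations_closed: "relations \<subseteq> carrier (direct_sum J D)"
proof -
  interpret S: Module.module K "direct_sum J D" by (rule sum_module)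
  show ?thesis
    using in_summand_closed linear_mapsD(1)[OF \<phi>] by auto
qed

lemma kernel_submodule: "submodule (colim_kernel K J leq D \<phi>) K (direct_sum J D)"
  unfolding colim_kernel_def by (rule submodule_generated_submodule[OF sum_module relations_closed])

lemma colim_module: "Module.module K (colim K J leq D \<phi>)"
  unfolding colim_def by (rule quotient_space_module(1)[OF sum_module kernel_submodule])

lemma colim_in_linear:
  assumes "j \<in> J"
  shows "colim_in j \<in> linear_maps K (D j) (colim K J leq D \<phi>)"
  using linear_maps_comp[OF in_summand_linear[where D = D, OF D assms] quotient_space_module(2)[OF sum_module kernel_submodule]]
  by (simp add: colim_in_def[abs_def] colim_def)

lemma colim_in_compat:
  assumes "i \<in> J" "j \<in> J" "leq i j" "x \<in> carrier (D i)"
  shows "colim_in j (\<phi> i j x) = colim_in i x"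
  unfolding colim_in_def
  by (rule coset_eqI[symmetric, OF sum_module kernel_submodule])
    (use assms in_summand_closed linear_mapsD(1)[OF \<phi>]
      in \<open>auto simp: colim_kernel_def intro!: subsetD[OF submodule_generated_incl]\<close>)

lemma colim_generation:
  assumes G: "submodule G K (colim K J leq D \<phi>)"
    and gen: "\<And>j x. j \<in> J \<Longrightarrow> x \<in> carrier (D j) \<Longrightarrow> colim_in j x \<in> G"
  shows "carrier (colim K J leq D \<phi>) \<subseteq> G"
  unfolding colim_def
proof (rule quotient_generation[OF sum_module kernel_submodule G[unfolded colim_def]])
  let ?S = "{in_summand D j x |j x. j \<in> J \<and> x \<in> carrier (D j)}"
  show "carrier (direct_sum J D) \<subseteq> L"
    if "submodule L K (direct_sum J D)" and "\<And>u. u \<in> ?S \<Longrightarrow> u \<in> L" for L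
    by (rule direct_sum_generation[where D = D, OF D that(1)]) (use that(2) in blast)
  show "u \<in> carrier (direct_sum J D) \<and> colim_kernel K J leq D \<phi> +>\<^bsub>direct_sum J D\<^esub> u \<in> G" if "u \<in> ?S" for u
    using that gen in_summand_closed by (auto simp: colim_in_def)
qed

lemma colim_universal:
  assumes Z: "Module.module K Z" and \<psi>: "\<And>j. j \<in> J \<Longrightarrow> \<psi> j \<in> linear_maps K (D j) Z"
    and compat: "\<And>i j x. i \<in> J \<Longrightarrow> j \<in> J \<Longrightarrow> leq i j \<Longrightarrow> x \<in> carrier (D i) \<Longrightarrow> \<psi> j (\<phi> i j x) = \<psi> i x"
  obtains h where "h \<in> linear_maps K (colim K J leq D \<phi>) Z"
    and "\<And>j x. j \<in> J \<Longrightarrow> x \<in> carrier (D j) \<Longrightarrow> h (colim_in j x) = \<psi> j x"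
proof -
  interpret Z: Module.module K Z by fact
  note l = direct_sum_lift[where J = J, OF D Z \<psi>]
  have z: "a \<ominus>\<^bsub>Z\<^esub> a = \<zero>\<^bsub>Z\<^esub>" if "a \<in> carrier Z" for a
    using that by (simp add: a_minus_def Z.M.r_neg)
  have "direct_sum_lift D Z \<psi> ` colim_kernel K J leq D \<phi> \<subseteq> {\<zero>\<^bsub>Z\<^esub>}"
    unfolding colim_kernel_def
    by (rule linear_image_generated[OF sum_module Z l(1) zero_submodule[OF Z] relations_closed])
      (auto simp: linear_maps_diff[OF sum_module Z l(1)] in_summand_closed linear_mapsD(1)[OF \<phi>]
        linear_mapsD(1)[OF \<psi>] l(2) compat z)
  then obtain h where "h \<in> linear_maps K (colim K J leq D \<phi>) Z"
    "\<And>u. u \<in> carrier (direct_sum J D) \<Longrightarrow>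
      h (colim_kernel K J leq D \<phi> +>\<^bsub>direct_sum J D\<^esub> u) = direct_sum_lift D Z \<psi> u"
    using quotient_lift[OF sum_module kernel_submodule Z l(1)] unfolding colim_def by blast
  then show ?thesis
    using that in_summand_closed l(2) by (simp add: colim_in_def)
qed

end

lemma tensor_linear_eqI:
  assumes V: "Module.module K V" and W: "Module.module K W" and Z: "Module.module K Z"
    and f: "f \<in> linear_maps K (tensor K V W) Z" and g: "g \<in> linear_maps K (tensor K V W) Z"
    and eq: "\<And>x y. x \<in> carrier V \<Longrightarrow> y \<in> carrier W \<Longrightarrow>
      f (pure_tensor K V W x y) = g (pure_tensor K V W x y)"
    and u: "u \<in> carrier (tensor K V W)"
  shows "f u = g u"
proof -
  have "carrier (tensor K V W) \<subseteq> {u \<in> carrier (tensor K V W). f u = g u}"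
    by (rule tensor_generation[OF V W equalizer_submodule[OF tensor_module[OF V W] Z f g]])
      (use eq bilinear_mapD(1)[OF pure_tensor_bilinear[OF V W]] in auto)
  with u show ?thesis by auto
qed

text \<open>The map acts on all coordinates of a family at once. Linearity of every
  \<open>F j\<close> keeps zero coordinates zero, so supports stay finite, and naturality turns each
  relation of the first diagram into one of the second.\<close>

lemma colim_map:
  assumes "diagram K J leq D \<phi>" and "diagram K J leq D' \<phi>'"
    and F: "\<And>j. F j \<in> linear_maps K (D j) (D' j)"
    and nat: "\<And>i j x. i \<in> J \<Longrightarrow> j \<in> J \<Longrightarrow> leq i j \<Longrightarrow> x \<in> carrier (D i) \<Longrightarrow>
      F j (\<phi> i j x) = \<phi>' i j (F i x)"
  shows "quotient_map (direct_sum J D') (colim_kernel K J leq D' \<phi>') (\<lambda>u j. F j (u j))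
      \<in> linear_maps K (colim K J leq D \<phi>) (colim K J leq D' \<phi>')"
    and "j \<in> J \<Longrightarrow> x \<in> carrier (D j) \<Longrightarrow>
      quotient_map (direct_sum J D') (colim_kernel K J leq D' \<phi>') (\<lambda>u j. F j (u j))
        (diagram.colim_in K J leq D \<phi> j x) = diagram.colim_in K J leq D' \<phi>' j (F j x)"
proof -
  interpret D: diagram K J leq D \<phi> by fact
  interpret D': diagram K J leq D' \<phi>' by fact
  interpret S': Module.module K "direct_sum J D'" by (rule D'.sum_module)
  let ?h = "\<lambda>u j. F j (u j)"
  have zero: "F j \<zero>\<^bsub>D j\<^esub> = \<zero>\<^bsub>D' j\<^esub>" for j
    by (rule linear_maps_zero_minus(1)[OF D.D D'.D F])
  have car: "u j \<in> carrier (D j)" if "u \<in> carrier (direct_sum J D)" for u j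
  proof -
    interpret Dj: Module.module K "D j" by (rule D.D)
    show ?thesis
      using that by (cases "j \<in> J") (auto simp: direct_sum_carrier)
  qed
  have h: "?h \<in> linear_maps K (direct_sum J D) (direct_sum J D')"
  proof (rule linear_mapsI)
    fix u assume u: "u \<in> carrier (direct_sum J D)"
    have "{j. F j (u j) \<noteq> \<zero>\<^bsub>D' j\<^esub>} \<subseteq> {j. u j \<noteq> \<zero>\<^bsub>D j\<^esub>}"
      using zero by auto
    then show "?h u \<in> carrier (direct_sum J D')"
      using u car[OF u] zero linear_mapsD(1)[OF F] finite_subset by (auto simp: direct_sum_carrier)
  qed (use car linear_mapsD(2,3)[OF F] in \<open>auto simp: direct_sum_simps\<close>)
  have hin: "?h (in_summand D j x) = in_summand D' j (F j x)" for j x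
    by (auto simp: in_summand_def fun_eq_iff zero)
  have "?h ` colim_kernel K J leq D \<phi> \<subseteq> colim_kernel K J leq D' \<phi>'"
    unfolding colim_kernel_def[of K J leq D]
  proof (rule linear_image_generated[OF D.sum_module D'.sum_module h D'.kernel_submodule D.relations_closed])
    fix r assume "r \<in> D.relations"
    then obtain i j x where ij: "i \<in> J" "j \<in> J" "leq i j" and x: "x \<in> carrier (D i)"
      and r: "r = in_summand D i x \<ominus>\<^bsub>direct_sum J D\<^esub> in_summand D j (\<phi> i j x)"
      by blast
    have "?h r = in_summand D' i (F i x) \<ominus>\<^bsub>direct_sum J D'\<^esub> in_summand D' j (\<phi>' i j (F i x))"
      using ij x nat by (simp add: r linear_maps_diff[OF D.sum_module D'.sum_module h]
          D.in_summand_closed linear_mapsD(1)[OF D.\<phi>] hin)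
    then have "?h r \<in> D'.relations"
      using ij linear_mapsD(1)[OF F x] by blast
    then show "?h r \<in> colim_kernel K J leq D' \<phi>'"
      unfolding colim_kernel_def by (rule subsetD[OF submodule_generated_incl])
  qed
  note * = D.sum_module D.kernel_submodule D'.sum_module D'.kernel_submodule h this
  show "quotient_map (direct_sum J D') (colim_kernel K J leq D' \<phi>') ?h
      \<in> linear_maps K (colim K J leq D \<phi>) (colim K J leq D' \<phi>')"
    unfolding colim_def by (rule quotient_map_linear[OF *])
  show "quotient_map (direct_sum J D') (colim_kernel K J leq D' \<phi>') ?h (D.colim_in j x) =
      D'.colim_in j (F j x)" if "j \<in> J" "x \<in> carrier (D j)"
    unfolding D.colim_in_def D'.colim_in_def
    by (subst quotient_map_coset[OF *]) (simp_all add: D.in_summand_closed that hin)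
qed


section \<open>The graded tensor product\<close>

lemma persistence_moduleD:
  assumes "persistence_module K M"
  shows "Module.module K (pspace M a)"
    and "a \<le> b \<Longrightarrow> ptrans M a b \<in> linear_maps K (pspace M a) (pspace M b)"
    and "x \<in> carrier (pspace M a) \<Longrightarrow> ptrans M a a x = x"
    and "a \<le> b \<Longrightarrow> b \<le> c \<Longrightarrow> x \<in> carrier (pspace M a) \<Longrightarrow>
      ptrans M b c (ptrans M a b x) = ptrans M a c x"
    and "a \<le> b \<Longrightarrow> x \<in> carrier (pspace M a) \<Longrightarrow> ptrans M a b x \<in> carrier (pspace M b)"
proof -
  show tr: "a \<le> b \<Longrightarrow> ptrans M a b \<in> linear_maps K (pspace M a) (pspace M b)" for a b
    using assms by (simp add: persistence_module_def)
  show "a \<le> b \<Longrightarrow> x \<in> carrier (pspace M a) \<Longrightarrow> ptrans M a b x \<in> carrier (pspace M b)"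
    by (rule linear_mapsD(1)[OF tr])
qed (use assms in \<open>simp_all add: persistence_module_def\<close>)

lemma pers_morphismD:
  assumes "pers_morphism K M N f"
  shows "f a \<in> linear_maps K (pspace M a) (pspace N a)"
    and "a \<le> b \<Longrightarrow> x \<in> carrier (pspace M a) \<Longrightarrow> f b (ptrans M a b x) = ptrans N a b (f a x)"
    and "x \<in> carrier (pspace M a) \<Longrightarrow> f a x \<in> carrier (pspace N a)"
  using assms by (auto simp: pers_morphism_def linear_maps_def)

text \<open>The class of x \<otimes> y in degree \<open>r\<close>, entering the colimit at the index
  \<open>(s, t)\<close>. These elements are bilinear, compatible with the transition maps and
  generating, which lets the later arguments ignore the nested quotients.\<close>

definition graded_pure ::
  "('k, 'x) ring_scheme \<Rightarrow> ('k, 'v) pers \<Rightarrow> ('k, 'w) pers \<Rightarrow> real \<Rightarrow> real \<Rightarrow> real \<Rightarrow> 'v \<Rightarrow> 'w \<Rightarrow>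
   (real \<times> real \<Rightarrow> ('v \<times> 'w \<Rightarrow> 'k) set) set" where
  "graded_pure K M N r s t x y =
     diagram.colim_in K (sum_le r) pair_le (pair_tensor K M N) (pair_tensor_trans K M N) (s, t)
       (pure_tensor K (pspace M s) (pspace N t) x y)"

locale graded_pair =
  fixes K :: "('k, 'x) ring_scheme" and M :: "('k, 'v) pers" and N :: "('k, 'w) pers"
  assumes M: "persistence_module K M" and N: "persistence_module K N"
begin

lemmas Mmod = persistence_moduleD(1)[OF M] and Nmod = persistence_moduleD(1)[OF N]

lemma diagram: "diagram K (sum_le r) pair_le (pair_tensor K M N) (pair_tensor_trans K M N)"
  by (intro diagram.intro tensor_module tensor_map(1) Mmod Nmod persistence_moduleD(2)[OF M]
      persistence_moduleD(2)[OF N]) (simp_all add: pair_le_def)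

lemma graded_tensor_space:
  "pspace (graded_tensor K M N) r =
     colim K (sum_le r) pair_le (pair_tensor K M N) (pair_tensor_trans K M N)"
  by (simp add: graded_tensor_def)

lemma graded_tensor_module: "Module.module K (pspace (graded_tensor K M N) r)"
  unfolding graded_tensor_space by (rule diagram.colim_module[OF diagram])

lemma graded_pure_bilinear:
  assumes "s + t \<le> r"
  shows "bilinear_map K (pspace M s) (pspace N t) (pspace (graded_tensor K M N) r) (graded_pure K M N r s t)"
proof -
  interpret diagram K "sum_le r" pair_le "pair_tensor K M N" "pair_tensor_trans K M N"
    by (rule diagram)
  have "(s, t) \<in> sum_le r"
    using assms by (simp add: sum_le_def)
  from colim_in_linear[OF this] pure_tensor_bilinear[OF Mmod Nmod, of s t] show ?thesis
    unfolding bilinear_map_def graded_pure_def graded_tensor_space by (auto intro: linear_maps_comp)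
qed

lemma graded_pure_compat:
  assumes "s \<le> s'" "t \<le> t'" "s' + t' \<le> r" "x \<in> carrier (pspace M s)" "y \<in> carrier (pspace N t)"
  shows "graded_pure K M N r s' t' (ptrans M s s' x) (ptrans N t t' y) = graded_pure K M N r s t x y"
proof -
  interpret diagram K "sum_le r" pair_le "pair_tensor K M N" "pair_tensor_trans K M N"
    by (rule diagram)
  have "pure_tensor K (pspace M s') (pspace N t') (ptrans M s s' x) (ptrans N t t' y) =
      pair_tensor_trans K M N (s, t) (s', t') (pure_tensor K (pspace M s) (pspace N t) x y)"
    using assms by (simp add: tensor_map(2)[OF Mmod Nmod Mmod Nmod persistence_moduleD(2)[OF M]
          persistence_moduleD(2)[OF N]])
  then show ?thesis
    using assms colim_in_compat[of "(s, t)" "(s', t')"]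
      bilinear_mapD(1)[OF pure_tensor_bilinear[OF Mmod Nmod]]
    by (simp add: graded_pure_def sum_le_def pair_le_def)
qed

lemma graded_tensor_generation:
  assumes G: "submodule G K (pspace (graded_tensor K M N) r)"
    and gen: "\<And>s t x y. s + t \<le> r \<Longrightarrow> x \<in> carrier (pspace M s) \<Longrightarrow> y \<in> carrier (pspace N t) \<Longrightarrow>
      graded_pure K M N r s t x y \<in> G"
  shows "carrier (pspace (graded_tensor K M N) r) \<subseteq> G"
proof -
  interpret diagram K "sum_le r" pair_le "pair_tensor K M N" "pair_tensor_trans K M N"
    by (rule diagram)
  show ?thesis
    unfolding graded_tensor_space
  proof (rule colim_generation[OF G[unfolded graded_tensor_space]])
    fix p u assume p: "p \<in> sum_le r" and u: "u \<in> carrier (pair_tensor K M N p)"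
    obtain s t where st: "p = (s, t)" by (cases p)
    have "carrier (tensor K (pspace M s) (pspace N t)) \<subseteq>
        {u \<in> carrier (tensor K (pspace M s) (pspace N t)). colim_in p u \<in> G}"
    proof (rule tensor_generation[OF Mmod Nmod])
      show "submodule {u \<in> carrier (tensor K (pspace M s) (pspace N t)). colim_in p u \<in> G} K
          (tensor K (pspace M s) (pspace N t))"
        using linear_preimage_submodule[OF tensor_module[OF Mmod Nmod] colim_module
            colim_in_linear[OF p, unfolded st, simplified] G[unfolded graded_tensor_space]]
        by (simp add: st)
      show "pure_tensor K (pspace M s) (pspace N t) x y \<in>
          {u \<in> carrier (tensor K (pspace M s) (pspace N t)). colim_in p u \<in> G}"
        if "x \<in> carrier (pspace M s)" "y \<in> carrier (pspace N t)" for x y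
        using gen[of s t x y] that p bilinear_mapD(1)[OF pure_tensor_bilinear[OF Mmod Nmod]]
        by (simp add: st sum_le_def graded_pure_def)
    qed
    then show "colim_in p u \<in> G"
      using u by (auto simp: st)
  qed
qed

lemma graded_tensor_universal:
  assumes Z: "Module.module K Z"
    and \<beta>: "\<And>s t. s + t \<le> r \<Longrightarrow> bilinear_map K (pspace M s) (pspace N t) Z (\<beta> s t)"
    and compat: "\<And>s t s' t' x y. s \<le> s' \<Longrightarrow> t \<le> t' \<Longrightarrow> s' + t' \<le> r \<Longrightarrow> x \<in> carrier (pspace M s) \<Longrightarrow>
      y \<in> carrier (pspace N t) \<Longrightarrow> \<beta> s' t' (ptrans M s s' x) (ptrans N t t' y) = \<beta> s t x y"
  obtains h where "h \<in> linear_maps K (pspace (graded_tensor K M N) r) Z"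
    and "\<And>s t x y. s + t \<le> r \<Longrightarrow> x \<in> carrier (pspace M s) \<Longrightarrow> y \<in> carrier (pspace N t) \<Longrightarrow>
      h (graded_pure K M N r s t x y) = \<beta> s t x y"
proof -
  interpret diagram K "sum_le r" pair_le "pair_tensor K M N" "pair_tensor_trans K M N"
    by (rule diagram)
  \<comment> \<open>The tensor product at each index supplies one map. Choosing them simultaneously
    gives the candidate cocone, whose compatibility is then tested on pure tensors.\<close>
  have "\<forall>p\<in>sum_le r. \<exists>h. h \<in> linear_maps K (pair_tensor K M N p) Z \<and>
      (\<forall>x\<in>carrier (pspace M (fst p)). \<forall>y\<in>carrier (pspace N (snd p)).
        h (pure_tensor K (pspace M (fst p)) (pspace N (snd p)) x y) = \<beta> (fst p) (snd p) x y)"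
  proof
    fix p assume "p \<in> sum_le r"
    then have "fst p + snd p \<le> r"
      by (auto simp: sum_le_def)
    from \<beta>[OF this] show "\<exists>h. h \<in> linear_maps K (pair_tensor K M N p) Z \<and>
        (\<forall>x\<in>carrier (pspace M (fst p)). \<forall>y\<in>carrier (pspace N (snd p)).
          h (pure_tensor K (pspace M (fst p)) (pspace N (snd p)) x y) = \<beta> (fst p) (snd p) x y)"
      by (rule tensor_universal[OF Mmod Nmod Z]) blast
  qed
  from bchoice[OF this] obtain \<psi> where "\<forall>p\<in>sum_le r. \<psi> p \<in> linear_maps K (pair_tensor K M N p) Z \<and>
      (\<forall>x\<in>carrier (pspace M (fst p)). \<forall>y\<in>carrier (pspace N (snd p)).
        \<psi> p (pure_tensor K (pspace M (fst p)) (pspace N (snd p)) x y) = \<beta> (fst p) (snd p) x y)"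
    by (rule exE)
  then have \<psi>: "\<And>p. p \<in> sum_le r \<Longrightarrow> \<psi> p \<in> linear_maps K (pair_tensor K M N p) Z"
    and \<psi>\<beta>: "\<And>s t x y. s + t \<le> r \<Longrightarrow> x \<in> carrier (pspace M s) \<Longrightarrow> y \<in> carrier (pspace N t) \<Longrightarrow>
      \<psi> (s, t) (pure_tensor K (pspace M s) (pspace N t) x y) = \<beta> s t x y"
    by (auto simp: sum_le_def)
  have "\<psi> q (pair_tensor_trans K M N p q u) = \<psi> p u"
    if pq: "p \<in> sum_le r" "q \<in> sum_le r" "pair_le p q" and u: "u \<in> carrier (pair_tensor K M N p)" for p q u
  proof (rule tensor_linear_eqI[OF Mmod Nmod Z _ \<psi>[OF pq(1)] _ u])
    note T = tensor_map[OF Mmod Nmod Mmod Nmod persistence_moduleD(2)[OF M] persistence_moduleD(2)[OF N]]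
    have le: "fst p \<le> fst q" "snd p \<le> snd q"
      using pq by (auto simp: pair_le_def)
    show "(\<lambda>u. \<psi> q (pair_tensor_trans K M N p q u)) \<in> linear_maps K (pair_tensor K M N p) Z"
      by (rule linear_maps_comp[OF T(1)[OF le] \<psi>[OF pq(2)]])
    fix x y assume x: "x \<in> carrier (pspace M (fst p))" and y: "y \<in> carrier (pspace N (snd p))"
    show "\<psi> q (pair_tensor_trans K M N p q (pure_tensor K (pspace M (fst p)) (pspace N (snd p)) x y)) =
        \<psi> p (pure_tensor K (pspace M (fst p)) (pspace N (snd p)) x y)"
      using \<psi>\<beta>[of "fst p" "snd p"] \<psi>\<beta>[of "fst q" "snd q"] compat[of "fst p" "fst q" "snd p" "snd q"]
        pq le x y persistence_moduleD(5)[OF M] persistence_moduleD(5)[OF N]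
      by (simp add: T(2) sum_le_def split_beta)
  qed
  then obtain h where "h \<in> linear_maps K (pspace (graded_tensor K M N) r) Z"
    and "\<And>p u. p \<in> sum_le r \<Longrightarrow> u \<in> carrier (pair_tensor K M N p) \<Longrightarrow> h (colim_in p u) = \<psi> p u"
    using colim_universal[OF Z \<psi>] unfolding graded_tensor_space by blast
  then show ?thesis
    using that \<psi>\<beta> bilinear_mapD(1)[OF pure_tensor_bilinear[OF Mmod Nmod]]
    by (simp add: graded_pure_def sum_le_def)
qed

end

lemma graded_tensor_map:
  assumes M: "persistence_module K M" and M': "persistence_module K M'" and N: "persistence_module K N"
    and f: "pers_morphism K M M' f"
  shows "graded_tensor_map K M' N f r \<in>
      linear_maps K (pspace (graded_tensor K M N) r) (pspace (graded_tensor K M' N) r)"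
    and "s + t \<le> r \<Longrightarrow> x \<in> carrier (pspace M s) \<Longrightarrow> y \<in> carrier (pspace N t) \<Longrightarrow>
      graded_tensor_map K M' N f r (graded_pure K M N r s t x y) = graded_pure K M' N r s t (f s x) y"
proof -
  interpret A: graded_pair K M N by (intro graded_pair.intro M N)
  interpret A': graded_pair K M' N by (intro graded_pair.intro M' N)
  let ?F = "\<lambda>p. tensor_map K (pspace M' (fst p)) (pspace N (snd p)) (f (fst p)) (\<lambda>y. y)"
  note F = tensor_map[OF A.Mmod A.Nmod A'.Mmod A.Nmod pers_morphismD(1)[OF f] linear_maps_id]
  have nat: "?F q (pair_tensor_trans K M N p q u) = pair_tensor_trans K M' N p q (?F p u)"
    if pq: "pair_le p q" and u: "u \<in> carrier (pair_tensor K M N p)" for p q u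
  proof (rule tensor_linear_eqI[OF A.Mmod A.Nmod tensor_module[OF A'.Mmod A'.Nmod] _ _ _ u])
    have le: "fst p \<le> fst q" "snd p \<le> snd q"
      using pq by (auto simp: pair_le_def)
    note T = tensor_map[OF A.Mmod A.Nmod A.Mmod A.Nmod persistence_moduleD(2)[OF M] persistence_moduleD(2)[OF N], OF le]
    note T' = tensor_map[OF A'.Mmod A.Nmod A'.Mmod A.Nmod persistence_moduleD(2)[OF M'] persistence_moduleD(2)[OF N], OF le]
    show "(\<lambda>u. ?F q (pair_tensor_trans K M N p q u)) \<in> linear_maps K (pair_tensor K M N p) (pair_tensor K M' N q)"
      by (rule linear_maps_comp[OF T(1) F(1)])
    show "(\<lambda>u. pair_tensor_trans K M' N p q (?F p u)) \<in> linear_maps K (pair_tensor K M N p) (pair_tensor K M' N q)"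
      by (rule linear_maps_comp[OF F(1) T'(1)])
    fix x y assume "x \<in> carrier (pspace M (fst p))" and "y \<in> carrier (pspace N (snd p))"
    then show "?F q (pair_tensor_trans K M N p q (pure_tensor K (pspace M (fst p)) (pspace N (snd p)) x y)) =
        pair_tensor_trans K M' N p q (?F p (pure_tensor K (pspace M (fst p)) (pspace N (snd p)) x y))"
      using le by (simp add: F(2) T(2) T'(2) pers_morphismD[OF f] persistence_moduleD(5)[OF M] persistence_moduleD(5)[OF N])
  qed
  note C = colim_map[OF A.diagram A'.diagram, of ?F r, OF F(1) nat]
  show "graded_tensor_map K M' N f r \<in>
      linear_maps K (pspace (graded_tensor K M N) r) (pspace (graded_tensor K M' N) r)"
    unfolding graded_tensor_map_def A.graded_tensor_space A'.graded_tensor_space by (rule C(1))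
  show "graded_tensor_map K M' N f r (graded_pure K M N r s t x y) = graded_pure K M' N r s t (f s x) y"
    if "s + t \<le> r" "x \<in> carrier (pspace M s)" "y \<in> carrier (pspace N t)"
    using that C(2)[of "(s, t)"] bilinear_mapD(1)[OF pure_tensor_bilinear[OF A.Mmod A.Nmod]]
    by (simp add: graded_tensor_map_def graded_pure_def sum_le_def F(2))
qed

section \<open>Germs\<close>

text \<open>
  For a nonempty set \<open>S\<close> of reals, the colimit of \<open>M\<close> over \<open>S\<close> is realized inside the
  product of all \<open>M s\<close> modulo the families that vanish from some element of \<open>S\<close> on. There the
  vanishing of an element of the colimit can be read off directly.
\<close>

definition section_space :: "('k, 'v) pers \<Rightarrow> ('k, real \<Rightarrow> 'v) module" where
  "section_space M = \<lparr>carrier = {w. \<forall>s. w s \<in> carrier (pspace M s)}, mult = undefined, one = undefined,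
     zero = (\<lambda>s. \<zero>\<^bsub>pspace M s\<^esub>), add = (\<lambda>v w s. v s \<oplus>\<^bsub>pspace M s\<^esub> w s),
     smult = (\<lambda>c w s. c \<odot>\<^bsub>pspace M s\<^esub> w s)\<rparr>"

definition eventually_zero :: "('k, 'v) pers \<Rightarrow> real set \<Rightarrow> (real \<Rightarrow> 'v) set" where
  "eventually_zero M S = {w \<in> carrier (section_space M).
     \<exists>s0\<in>S. \<forall>s\<in>S. s0 \<le> s \<longrightarrow> w s = \<zero>\<^bsub>pspace M s\<^esub>}"

definition germ_space :: "('k, 'v) pers \<Rightarrow> real set \<Rightarrow> ('k, (real \<Rightarrow> 'v) set) module" where
  "germ_space M S = quotient_space (section_space M) (eventually_zero M S)"

text \<open>The zero below \<open>s\<close> is a default value. As soon as \<open>S\<close> has an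
  element at or above \<open>s\<close>, it does not affect the class, because families are compared
  only from some element of \<open>S\<close> on.\<close>

definition germ :: "('k, 'v) pers \<Rightarrow> real set \<Rightarrow> real \<Rightarrow> 'v \<Rightarrow> (real \<Rightarrow> 'v) set" where
  "germ M S s x = eventually_zero M S +>\<^bsub>section_space M\<^esub>
     (\<lambda>s'. if s \<le> s' then ptrans M s s' x else \<zero>\<^bsub>pspace M s'\<^esub>)"

lemma section_space_simps:
  "w \<in> carrier (section_space M) \<longleftrightarrow> (\<forall>s. w s \<in> carrier (pspace M s))"
  "\<zero>\<^bsub>section_space M\<^esub> = (\<lambda>s. \<zero>\<^bsub>pspace M s\<^esub>)"
  "v \<oplus>\<^bsub>section_space M\<^esub> w = (\<lambda>s. v s \<oplus>\<^bsub>pspace M s\<^esub> w s)"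
  "c \<odot>\<^bsub>section_space M\<^esub> w = (\<lambda>s. c \<odot>\<^bsub>pspace M s\<^esub> w s)"
  by (simp_all add: section_space_def)

locale germs =
  fixes K :: "('k, 'x) ring_scheme" and M :: "('k, 'v) pers" and S :: "real set"
  assumes M: "persistence_module K M" and S: "S \<noteq> {}"
begin

lemmas Mmod = persistence_moduleD(1)[OF M]

lemma section_space_module: "Module.module K (section_space M)"
proof -
  interpret M: Module.module K "pspace M r" for r by (rule Mmod)
  have "abelian_group (section_space M)"
  proof (rule abelian_groupI)
    show "\<exists>v\<in>carrier (section_space M). v \<oplus>\<^bsub>section_space M\<^esub> w = \<zero>\<^bsub>section_space M\<^esub>"
      if "w \<in> carrier (section_space M)" for w
      using that by (intro bexI[of _ "\<lambda>s. \<ominus>\<^bsub>pspace M s\<^esub> w s"])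
        (auto simp: section_space_simps M.M.l_neg)
  qed (auto simp: section_space_simps M.M.a_assoc intro: M.M.a_comm)
  then show ?thesis
    by (intro moduleI) (auto simp: M.R.is_cring section_space_simps M.smult_l_distr M.smult_r_distr
        M.smult_assoc1)
qed

lemma eventually_zero_submodule: "submodule (eventually_zero M S) K (section_space M)"
proof -
  interpret M: Module.module K "pspace M r" for r by (rule Mmod)
  interpret P: Module.module K "section_space M" by (rule section_space_module)
  have minus: "\<ominus>\<^bsub>section_space M\<^esub> w = (\<lambda>s. \<ominus>\<^bsub>pspace M s\<^esub> w s)" if "w \<in> carrier (section_space M)" for w
    using that by (intro P.M.minus_equality) (auto simp: section_space_simps M.M.l_neg)
  show ?thesis
  proof (rule P.submoduleI)
    show "v \<oplus>\<^bsub>section_space M\<^esub> w \<in> eventually_zero M S"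
      if v: "v \<in> eventually_zero M S" and w: "w \<in> eventually_zero M S" for v w
    proof -
      obtain s t where s: "s \<in> S" "\<And>s'. s' \<in> S \<Longrightarrow> s \<le> s' \<Longrightarrow> v s' = \<zero>\<^bsub>pspace M s'\<^esub>"
        and t: "t \<in> S" "\<And>s'. s' \<in> S \<Longrightarrow> t \<le> s' \<Longrightarrow> w s' = \<zero>\<^bsub>pspace M s'\<^esub>"
        using v w by (auto simp: eventually_zero_def)
      \<comment> \<open>Directedness enters here: a set of reals contains the maximum of any two of
        its elements, so one bound serves both families.\<close>
      have "max s t \<in> S"
        using s t by (simp add: max_def)
      then show ?thesis
        using v w s t by (auto simp: eventually_zero_def section_space_simps intro!: bexI[of _ "max s t"])
    qed
    show "c \<odot>\<^bsub>section_space M\<^esub> w \<in> eventually_zero M S"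
      if c: "c \<in> carrier K" and w: "w \<in> eventually_zero M S" for c w
    proof -
      have "w s = \<zero>\<^bsub>pspace M s\<^esub> \<Longrightarrow> c \<odot>\<^bsub>pspace M s\<^esub> w s = \<zero>\<^bsub>pspace M s\<^esub>" for s
        using c by simp
      then show ?thesis
        using c w unfolding eventually_zero_def section_space_simps by blast
    qed
  qed (use S in \<open>auto simp: eventually_zero_def minus section_space_simps\<close>)
qed

lemma germ_space_module: "Module.module K (germ_space M S)"
  unfolding germ_space_def by (rule quotient_space_module(1)[OF section_space_module eventually_zero_submodule])

lemma germ_section_linear:
  "(\<lambda>x s'. if s \<le> s' then ptrans M s s' x else \<zero>\<^bsub>pspace M s'\<^esub>)
    \<in> linear_maps K (pspace M s) (section_space M)"
proof -
  interpret M: Module.module K "pspace M r" for r by (rule Mmod)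
  show ?thesis
    using linear_mapsD[OF persistence_moduleD(2)[OF M]]
    by (intro linear_mapsI) (auto simp: section_space_simps)
qed

lemma germ_linear: "germ M S s \<in> linear_maps K (pspace M s) (germ_space M S)"
  using linear_maps_comp[OF germ_section_linear
      quotient_space_module(2)[OF section_space_module eventually_zero_submodule]]
  unfolding germ_space_def germ_def[abs_def] .


text \<open>From \<open>s'\<close> on both families consist of the same vectors, and
  \<open>s'\<close> is itself an admissible bound because it lies in \<open>S\<close>.\<close>

lemma germ_ptrans:
  assumes "s \<le> s'" "s' \<in> S" and x: "x \<in> carrier (pspace M s)"
  shows "germ M S s' (ptrans M s s' x) = germ M S s x"
  unfolding germ_def
proof (rule coset_eqI[OF section_space_module eventually_zero_submodule])
  interpret M: Module.module K "pspace M r" for r by (rule Mmod)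
  interpret P: Module.module K "section_space M" by (rule section_space_module)
  let ?v = "\<lambda>u. if s' \<le> u then ptrans M s' u (ptrans M s s' x) else \<zero>\<^bsub>pspace M u\<^esub>"
    and ?w = "\<lambda>u. if s \<le> u then ptrans M s u x else \<zero>\<^bsub>pspace M u\<^esub>"
  note tr = persistence_moduleD(5)[OF M]
  show v: "?v \<in> carrier (section_space M)"
    by (rule linear_mapsD(1)[OF germ_section_linear tr[OF assms(1) x]])
  show w: "?w \<in> carrier (section_space M)"
    by (rule linear_mapsD(1)[OF germ_section_linear x])
  have minus: "\<ominus>\<^bsub>section_space M\<^esub> ?w = (\<lambda>u. \<ominus>\<^bsub>pspace M u\<^esub> ?w u)"
  proof (rule P.M.minus_equality)
    show "(\<lambda>u. \<ominus>\<^bsub>pspace M u\<^esub> ?w u) \<oplus>\<^bsub>section_space M\<^esub> ?w = \<zero>\<^bsub>section_space M\<^esub>"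
      using w unfolding section_space_simps by (intro ext M.M.l_neg) blast
    show "(\<lambda>u. \<ominus>\<^bsub>pspace M u\<^esub> ?w u) \<in> carrier (section_space M)"
      using w unfolding section_space_simps by blast
  qed fact
  have "(?v \<ominus>\<^bsub>section_space M\<^esub> ?w) u = \<zero>\<^bsub>pspace M u\<^esub>" if "s' \<le> u" for u
    using that assms x tr persistence_moduleD(4)[OF M] M.M.r_neg
    by (simp add: a_minus_def minus section_space_simps)
  then show "?v \<ominus>\<^bsub>section_space M\<^esub> ?w \<in> eventually_zero M S"
    using P.M.minus_closed[OF v w] assms(2) unfolding eventually_zero_def by blast
qed

text \<open>The detection principle for which germs are introduced. Vanishing from some bound on
  gives vanishing at the maximum of that bound and \<open>s\<close>; conversely, a zero in one
  degree is carried upwards by the transition maps.\<close>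

lemma germ_eq_zero_iff:
  assumes s: "s \<in> S" and x: "x \<in> carrier (pspace M s)"
  shows "germ M S s x = \<zero>\<^bsub>germ_space M S\<^esub> \<longleftrightarrow>
    (\<exists>s'\<in>S. s \<le> s' \<and> ptrans M s s' x = \<zero>\<^bsub>pspace M s'\<^esub>)"
proof -
  note W = linear_mapsD(1)[OF germ_section_linear x]
  show ?thesis
    unfolding germ_def germ_space_def
      coset_eq_zero_iff[OF section_space_module eventually_zero_submodule W]
  proof
    assume "(\<lambda>s'. if s \<le> s' then ptrans M s s' x else \<zero>\<^bsub>pspace M s'\<^esub>) \<in> eventually_zero M S"
    then obtain t where "t \<in> S" "\<And>s'. s' \<in> S \<Longrightarrow> t \<le> s' \<Longrightarrow> s \<le> s' \<Longrightarrow> ptrans M s s' x = \<zero>\<^bsub>pspace M s'\<^esub>"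
      by (fastforce simp: eventually_zero_def)
    then show "\<exists>s'\<in>S. s \<le> s' \<and> ptrans M s s' x = \<zero>\<^bsub>pspace M s'\<^esub>"
      using s by (intro bexI[of _ "max s t"]) (auto simp: max_def)
  next
    assume "\<exists>s'\<in>S. s \<le> s' \<and> ptrans M s s' x = \<zero>\<^bsub>pspace M s'\<^esub>"
    then obtain t where t: "t \<in> S" "s \<le> t" "ptrans M s t x = \<zero>\<^bsub>pspace M t\<^esub>"
      by auto
    have "ptrans M s u x = \<zero>\<^bsub>pspace M u\<^esub>" if "t \<le> u" for u
      using persistence_moduleD(4)[OF M t(2) that x] t(3)
        linear_maps_zero_minus(1)[OF Mmod Mmod persistence_moduleD(2)[OF M that]] by simp
    then show "(\<lambda>s'. if s \<le> s' then ptrans M s s' x else \<zero>\<^bsub>pspace M s'\<^esub>) \<in> eventually_zero M S"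
      using t W by (auto simp: eventually_zero_def)
  qed
qed

end


section \<open>Injective interval modules\<close>

text \<open>Zorn's lemma supplies a complement to a line. With g(x0) = 1, a submodule that is
  maximal among those containing the kernel of \<open>g\<close> and avoiding \<open>x0\<close> is a
  hyperplane, and \<open>h\<close> reads the coefficient of \<open>x0\<close> modulo it. A vanishing
  \<open>g\<close> is extended by zero.\<close>

lemma linear_functional_extension:
  assumes "field K" and V: "Module.module K V" and H: "submodule H K V"
    and g: "g \<in> linear_maps K (V\<lparr>carrier := H\<rparr>) (regular_space K)"
  obtains h where "h \<in> linear_maps K V (regular_space K)" and "\<And>x. x \<in> H \<Longrightarrow> h x = g x"
proof (cases "\<forall>x\<in>H. g x = \<zero>\<^bsub>K\<^esub>")
  case True
  interpret field K by fact
  show ?thesis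
    using that[of "\<lambda>x. \<zero>\<^bsub>K\<^esub>"] True linear_maps_zero[OF regular_space_module[OF is_cring], of V] by simp
next
  case False
  interpret field K by fact
  interpret V: Module.module K V by (rule V)
  have HV: "x \<in> carrier V" if "x \<in> H" for x
    using V.submoduleE(1)[OF H] that by auto
  note sub = V.submoduleE[OF H]
  have gK: "g x \<in> carrier K" and g_add: "g (x \<oplus>\<^bsub>V\<^esub> y) = g x \<oplus>\<^bsub>K\<^esub> g y"
    and g_smult: "c \<in> carrier K \<Longrightarrow> g (c \<odot>\<^bsub>V\<^esub> x) = c \<otimes>\<^bsub>K\<^esub> g x" if "x \<in> H" "y \<in> H" for x y c
    using linear_mapsD[OF g] that by auto
  from False obtain x1 where x1: "x1 \<in> H" "g x1 \<noteq> \<zero>\<^bsub>K\<^esub>"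
    by blast
  define x0 where "x0 = inv\<^bsub>K\<^esub> (g x1) \<odot>\<^bsub>V\<^esub> x1"
  have unit: "g x1 \<in> Units K"
    using x1 gK by (simp add: field_Units)
  then have x0: "x0 \<in> H" "g x0 = \<one>\<^bsub>K\<^esub>"
    using x1 sub(4) g_smult by (auto simp: x0_def)
  note x0V = HV[OF x0(1)]
  define \<N> where "\<N> = {N. submodule N K V \<and> {x \<in> H. g x = \<zero>\<^bsub>K\<^esub>} \<subseteq> N \<and> x0 \<notin> N}"
  have "{x \<in> H. g x = \<zero>\<^bsub>K\<^esub>} \<in> \<N>"
  proof -
    have "submodule {x \<in> H. g x = \<zero>\<^bsub>K\<^esub>} K V"
    proof (rule V.submoduleI)
      show "\<ominus>\<^bsub>V\<^esub> x \<in> {x \<in> H. g x = \<zero>\<^bsub>K\<^esub>}" if x: "x \<in> {x \<in> H. g x = \<zero>\<^bsub>K\<^esub>}" for x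
      proof -
        have "\<ominus>\<^bsub>V\<^esub> x = (\<ominus>\<^bsub>K\<^esub> \<one>\<^bsub>K\<^esub>) \<odot>\<^bsub>V\<^esub> x"
          using x HV by (simp add: V.smult_l_minus)
        then have "g (\<ominus>\<^bsub>V\<^esub> x) = \<zero>\<^bsub>K\<^esub>"
          using x g_smult[of x x "\<ominus>\<^bsub>K\<^esub> \<one>\<^bsub>K\<^esub>"] by simp
        then show ?thesis
          using x sub(3) by blast
      qed
      have "\<zero>\<^bsub>V\<^esub> = \<zero>\<^bsub>K\<^esub> \<odot>\<^bsub>V\<^esub> x0"
        using x0V by simp
      then show "\<zero>\<^bsub>V\<^esub> \<in> {x \<in> H. g x = \<zero>\<^bsub>K\<^esub>}"
        using submodule_zero_mem[OF V H] g_smult[of x0 x0 "\<zero>\<^bsub>K\<^esub>"] x0 by simp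
    qed (use sub g_add g_smult HV in auto)
    then show ?thesis
      using x0 by (simp add: \<N>_def)
  qed
  moreover have "\<Union>\<C> \<in> \<N>" if "\<C> \<noteq> {}" "subset.chain \<N> \<C>" for \<C>
  proof -
    have C: "N \<in> \<N>" if "N \<in> \<C>" for N
      using \<open>subset.chain \<N> \<C>\<close> that by (auto simp: subset.chain_def)
    note CS = V.submoduleE[of N for N]
    have "submodule (\<Union>\<C>) K V"
    proof (rule V.submoduleI)
      fix x y assume "x \<in> \<Union>\<C>" "y \<in> \<Union>\<C>"
      then obtain N N' where N: "N \<in> \<C>" "x \<in> N" "N' \<in> \<C>" "y \<in> N'"
        by blast
      then have "N \<subseteq> N' \<or> N' \<subseteq> N"
        using \<open>subset.chain \<N> \<C>\<close> by (auto simp: subset.chain_def)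
      then obtain L where "L \<in> \<C>" "x \<in> L" "y \<in> L"
        using N by blast
      then show "x \<oplus>\<^bsub>V\<^esub> y \<in> \<Union>\<C>"
        using C CS(5)[of L] unfolding \<N>_def by blast
    next
      obtain N where "N \<in> \<C>"
        using \<open>\<C> \<noteq> {}\<close> by auto
      then show "\<zero>\<^bsub>V\<^esub> \<in> \<Union>\<C>"
        using C submodule_zero_mem[OF V, of N] unfolding \<N>_def by blast
    qed (use C CS(1,3,4) in \<open>unfold \<N>_def, blast+\<close>)
    then show ?thesis
      using C \<open>\<C> \<noteq> {}\<close> unfolding \<N>_def by blast
  qed
  ultimately obtain N where N: "N \<in> \<N>" and max: "\<And>N'. N' \<in> \<N> \<Longrightarrow> N \<subseteq> N' \<Longrightarrow> N' = N"
    using subset_Zorn_nonempty[of \<N>] by blast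
  have subN: "submodule N K V" and x0N: "x0 \<notin> N" and kerN: "x \<in> H \<Longrightarrow> g x = \<zero>\<^bsub>K\<^esub> \<Longrightarrow> x \<in> N" for x
    using N by (auto simp: \<N>_def)
  note N = V.submoduleE[OF subN] and N0 = submodule_zero_mem[OF V subN]
  have NV: "x \<in> carrier V" if "x \<in> N" for x
    using N(1) that by auto
  have ex: "\<exists>c\<in>carrier K. x \<ominus>\<^bsub>V\<^esub> c \<odot>\<^bsub>V\<^esub> x0 \<in> N" if x: "x \<in> carrier V" for x
  proof -
    \<comment> \<open>\<open>N'\<close> is N + K x. If it avoids \<open>x0\<close>, maximality puts
      \<open>x\<close> into \<open>N\<close> and the coefficient is zero. Otherwise x0 = n + c x,
      where c is nonzero because \<open>x0\<close> is not in \<open>N\<close>, and solving for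
      \<open>x\<close> gives the coefficient 1/c.\<close>
    define N' where "N' = {n \<oplus>\<^bsub>V\<^esub> c \<odot>\<^bsub>V\<^esub> x |n c. n \<in> N \<and> c \<in> carrier K}"
    have N'I: "n \<oplus>\<^bsub>V\<^esub> c \<odot>\<^bsub>V\<^esub> x \<in> N'" if "n \<in> N" "c \<in> carrier K" for n c
      using that by (auto simp: N'_def)
    have N': "submodule N' K V"
    proof (rule V.submoduleI)
      show "N' \<subseteq> carrier V"
        using x NV by (auto simp: N'_def)
      show "\<zero>\<^bsub>V\<^esub> \<in> N'"
        using N'I[OF N0, of "\<zero>\<^bsub>K\<^esub>"] x by simp
      fix y assume "y \<in> N'"
      then obtain n c where y: "y = n \<oplus>\<^bsub>V\<^esub> c \<odot>\<^bsub>V\<^esub> x" "n \<in> N" "c \<in> carrier K"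
        by (auto simp: N'_def)
      have "\<ominus>\<^bsub>V\<^esub> y = \<ominus>\<^bsub>V\<^esub> n \<oplus>\<^bsub>V\<^esub> (\<ominus>\<^bsub>K\<^esub> c) \<odot>\<^bsub>V\<^esub> x"
        using y x NV by (simp add: V.M.minus_add V.smult_l_minus)
      then show "\<ominus>\<^bsub>V\<^esub> y \<in> N'"
        using N'I[OF N(3)[OF y(2)], of "\<ominus>\<^bsub>K\<^esub> c"] y by simp
      show "d \<odot>\<^bsub>V\<^esub> y \<in> N'" if d: "d \<in> carrier K" for d
      proof -
        have "d \<odot>\<^bsub>V\<^esub> y = d \<odot>\<^bsub>V\<^esub> n \<oplus>\<^bsub>V\<^esub> (d \<otimes>\<^bsub>K\<^esub> c) \<odot>\<^bsub>V\<^esub> x"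
          using y x d NV by (simp add: V.smult_r_distr V.smult_assoc1)
        then show ?thesis
          using N'I[OF N(4)[OF d y(2)], of "d \<otimes>\<^bsub>K\<^esub> c"] d y by simp
      qed
      fix z assume "z \<in> N'"
      then obtain m b where z: "z = m \<oplus>\<^bsub>V\<^esub> b \<odot>\<^bsub>V\<^esub> x" "m \<in> N" "b \<in> carrier K"
        by (auto simp: N'_def)
      have "y \<oplus>\<^bsub>V\<^esub> z = (n \<oplus>\<^bsub>V\<^esub> m) \<oplus>\<^bsub>V\<^esub> (c \<oplus>\<^bsub>K\<^esub> b) \<odot>\<^bsub>V\<^esub> x"
        using y z x NV by (simp add: V.smult_l_distr V.M.a_ac)
      then show "y \<oplus>\<^bsub>V\<^esub> z \<in> N'"
        using N'I[OF N(5)[OF y(2) z(2)], of "c \<oplus>\<^bsub>K\<^esub> b"] y z by simp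
    qed
    have NN': "N \<subseteq> N'"
    proof
      show "n \<in> N'" if "n \<in> N" for n
        using N'I[OF that, of "\<zero>\<^bsub>K\<^esub>"] x NV[OF that] by simp
    qed
    show ?thesis
    proof (cases "x0 \<in> N'")
      case False
      then have "N' = N"
        using max N' NN' kerN by (auto simp: \<N>_def)
      then have "x \<in> N"
        using N'I[OF N0, of "\<one>\<^bsub>K\<^esub>"] x by simp
      then show ?thesis
        using x x0V N(3)[OF N0] N(5) by (intro bexI[of _ "\<zero>\<^bsub>K\<^esub>"]) (simp_all add: a_minus_def)
    next
      case True
      then obtain n c where c: "x0 = n \<oplus>\<^bsub>V\<^esub> c \<odot>\<^bsub>V\<^esub> x" "n \<in> N" "c \<in> carrier K"
        by (auto simp: N'_def)
      have "c \<noteq> \<zero>\<^bsub>K\<^esub>"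
        using c x x0N NV by auto
      then have u: "c \<in> Units K"
        using c by (simp add: field_Units)
      let ?d = "inv\<^bsub>K\<^esub> c"
      have d: "?d \<in> carrier K"
        using u by simp
      have "?d \<odot>\<^bsub>V\<^esub> x0 = ?d \<odot>\<^bsub>V\<^esub> n \<oplus>\<^bsub>V\<^esub> x"
        using c d u x NV by (simp add: V.smult_r_distr flip: V.smult_assoc1)
      then have "x \<ominus>\<^bsub>V\<^esub> ?d \<odot>\<^bsub>V\<^esub> x0 = \<ominus>\<^bsub>V\<^esub> (?d \<odot>\<^bsub>V\<^esub> n)"
        using x d NV[OF c(2)] by (simp add: a_minus_def V.M.minus_add V.M.a_ac V.M.r_neg1 V.M.r_neg2)
      then show ?thesis
        using d N(3)[OF N(4)[OF d c(2)]] by (intro bexI[of _ ?d]) simp_all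
    qed
  qed
  \<comment> \<open>Two different coefficients would put a nonzero multiple of \<open>x0\<close>,
    hence \<open>x0\<close> itself, into \<open>N\<close>.\<close>
  have uniq: "c = d" if c: "c \<in> carrier K" "x \<ominus>\<^bsub>V\<^esub> c \<odot>\<^bsub>V\<^esub> x0 \<in> N"
    and d: "d \<in> carrier K" "x \<ominus>\<^bsub>V\<^esub> d \<odot>\<^bsub>V\<^esub> x0 \<in> N" and x: "x \<in> carrier V" for c d x
  proof (rule ccontr)
    assume "c \<noteq> d"
    then have "c \<ominus>\<^bsub>K\<^esub> d \<noteq> \<zero>\<^bsub>K\<^esub>"
      using c(1) d(1) unfolding a_minus_def by (metis minus_equality minus_minus a_inv_closed)
    then have u: "c \<ominus>\<^bsub>K\<^esub> d \<in> Units K"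
      using c d by (simp add: field_Units)
    have "(x \<ominus>\<^bsub>V\<^esub> d \<odot>\<^bsub>V\<^esub> x0) \<oplus>\<^bsub>V\<^esub> \<ominus>\<^bsub>V\<^esub> (x \<ominus>\<^bsub>V\<^esub> c \<odot>\<^bsub>V\<^esub> x0) = (c \<ominus>\<^bsub>K\<^esub> d) \<odot>\<^bsub>V\<^esub> x0"
      using x c d x0V
      by (simp add: a_minus_def V.M.minus_add V.smult_l_distr V.smult_l_minus V.M.a_ac V.M.r_neg1 V.M.r_neg2)
    then have "(c \<ominus>\<^bsub>K\<^esub> d) \<odot>\<^bsub>V\<^esub> x0 \<in> N"
      using N(5)[OF d(2) N(3)[OF c(2)]] by simp
    then have "inv\<^bsub>K\<^esub> (c \<ominus>\<^bsub>K\<^esub> d) \<odot>\<^bsub>V\<^esub> ((c \<ominus>\<^bsub>K\<^esub> d) \<odot>\<^bsub>V\<^esub> x0) \<in> N"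
      using u by (intro N(4)[of "inv\<^bsub>K\<^esub> (c \<ominus>\<^bsub>K\<^esub> d)"]) auto
    moreover have "inv\<^bsub>K\<^esub> (c \<ominus>\<^bsub>K\<^esub> d) \<odot>\<^bsub>V\<^esub> ((c \<ominus>\<^bsub>K\<^esub> d) \<odot>\<^bsub>V\<^esub> x0) = x0"
      using u x0V c(1) d(1) by (subst V.smult_assoc1[symmetric]) simp_all
    ultimately show False
      using x0N by simp
  qed
  define h where "h x = (THE c. c \<in> carrier K \<and> x \<ominus>\<^bsub>V\<^esub> c \<odot>\<^bsub>V\<^esub> x0 \<in> N)" for x
  have h_eq: "h x = c" if "x \<in> carrier V" "c \<in> carrier K" "x \<ominus>\<^bsub>V\<^esub> c \<odot>\<^bsub>V\<^esub> x0 \<in> N" for x c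
    unfolding h_def using that uniq by blast
  have h: "h x \<in> carrier K" "x \<ominus>\<^bsub>V\<^esub> h x \<odot>\<^bsub>V\<^esub> x0 \<in> N" if "x \<in> carrier V" for x
    using ex[OF that] h_eq[OF that] by auto
  show ?thesis
  proof (rule that[of h])
    show "h \<in> linear_maps K V (regular_space K)"
    proof (rule linear_mapsI)
      fix x y assume x: "x \<in> carrier V" and y: "y \<in> carrier V"
      have "(x \<oplus>\<^bsub>V\<^esub> y) \<ominus>\<^bsub>V\<^esub> (h x \<oplus>\<^bsub>K\<^esub> h y) \<odot>\<^bsub>V\<^esub> x0 =
          (x \<ominus>\<^bsub>V\<^esub> h x \<odot>\<^bsub>V\<^esub> x0) \<oplus>\<^bsub>V\<^esub> (y \<ominus>\<^bsub>V\<^esub> h y \<odot>\<^bsub>V\<^esub> x0)"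
        using x y h(1)[OF x] h(1)[OF y] x0V
        by (simp add: a_minus_def V.smult_l_distr V.M.minus_add V.M.a_ac)
      then show "h (x \<oplus>\<^bsub>V\<^esub> y) = h x \<oplus>\<^bsub>regular_space K\<^esub> h y"
        using x y h(1)[OF x] h(1)[OF y] N(5)[OF h(2)[OF x] h(2)[OF y]]
          h_eq[of "x \<oplus>\<^bsub>V\<^esub> y" "h x \<oplus>\<^bsub>K\<^esub> h y"] by simp
    next
      fix c x assume c: "c \<in> carrier K" and x: "x \<in> carrier V"
      have "c \<odot>\<^bsub>V\<^esub> x \<ominus>\<^bsub>V\<^esub> (c \<otimes>\<^bsub>K\<^esub> h x) \<odot>\<^bsub>V\<^esub> x0 = c \<odot>\<^bsub>V\<^esub> (x \<ominus>\<^bsub>V\<^esub> h x \<odot>\<^bsub>V\<^esub> x0)"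
        using x c h(1)[OF x] x0V
        by (simp add: a_minus_def V.smult_r_distr V.smult_r_minus V.smult_assoc1)
      then show "h (c \<odot>\<^bsub>V\<^esub> x) = c \<odot>\<^bsub>regular_space K\<^esub> h x"
        using c x h(1)[OF x] N(4)[OF c h(2)[OF x]] h_eq[of "c \<odot>\<^bsub>V\<^esub> x" "c \<otimes>\<^bsub>K\<^esub> h x"] by simp
    qed (use h in simp)
    fix x assume x: "x \<in> H"
    \<comment> \<open>For \<open>x\<close> in \<open>H\<close> the vector x - g(x) x0 lies in the
      kernel of \<open>g\<close> and therefore in \<open>N\<close>; so \<open>h\<close> must return
      g(x).\<close>
    have y: "g x \<odot>\<^bsub>V\<^esub> x0 \<in> H"
      by (rule sub(4)[OF gK[OF x x] x0(1)])
    have m: "\<ominus>\<^bsub>V\<^esub> (g x \<odot>\<^bsub>V\<^esub> x0) = (\<ominus>\<^bsub>K\<^esub> g x) \<odot>\<^bsub>V\<^esub> x0"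
      using x x0V gK by (simp add: V.smult_l_minus)
    have "x \<ominus>\<^bsub>V\<^esub> g x \<odot>\<^bsub>V\<^esub> x0 \<in> H"
      unfolding a_minus_def by (rule sub(5)[OF x sub(3)[OF y]])
    moreover have "g (x \<ominus>\<^bsub>V\<^esub> g x \<odot>\<^bsub>V\<^esub> x0) = \<zero>\<^bsub>K\<^esub>"
      using g_add[OF x sub(4)[OF a_inv_closed[OF gK[OF x x]] x0(1)]]
        g_smult[OF x0(1,1) a_inv_closed[OF gK[OF x x]]] gK[OF x x] x0(2)
      by (simp add: a_minus_def m r_neg)
    ultimately show "h x = g x"
      using h_eq[OF HV[OF x] gK[OF x x]] kerN by blast
  qed
qed


section \<open>Interval modules and injectivity over down-sets\<close>

lemma interval_module_simps:
  "carrier (pspace (interval_module K I) t) = (if t \<in> I then carrier K else {\<zero>\<^bsub>K\<^esub>})"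
  "\<zero>\<^bsub>pspace (interval_module K I) t\<^esub> = \<zero>\<^bsub>K\<^esub>"
  "x \<oplus>\<^bsub>pspace (interval_module K I) t\<^esub> y = x \<oplus>\<^bsub>K\<^esub> y"
  "c \<odot>\<^bsub>pspace (interval_module K I) t\<^esub> x = c \<otimes>\<^bsub>K\<^esub> x"
  "ptrans (interval_module K I) s t x = (if s \<in> I \<and> t \<in> I then x else \<zero>\<^bsub>K\<^esub>)"
  by (simp_all add: interval_module_def)

lemma linear_maps_interval_module:
  assumes "ring K" and "t \<in> I \<Longrightarrow> h \<in> linear_maps K V (regular_space K)"
    and "t \<notin> I \<Longrightarrow> (\<And>x. x \<in> carrier V \<Longrightarrow> h x = \<zero>\<^bsub>K\<^esub>)"
    and "Module.module K V"
  shows "h \<in> linear_maps K V (pspace (interval_module K I) t)"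
proof -
  interpret ring K by fact
  interpret V: Module.module K V by fact
  show ?thesis
    using assms(2,3) by (cases "t \<in> I") (auto simp: linear_maps_def interval_module_simps)
qed

text \<open>\<open>\<gamma>\<close> sends \<open>A\<close> to the germs of \<open>B\<close> along
  \<open>D\<close>. An element of a degree in \<open>D\<close> that it kills becomes zero in
  \<open>A\<close> at some later degree of \<open>D\<close>, because \<open>i\<close> is injective
  there, and then \<open>g\<close> kills it too, the transition maps of k[D] within \<open>D\<close>
  being identities. So \<open>g\<close> factors through the image \<open>H\<close> of
  \<open>\<gamma>\<close>, extends from \<open>H\<close> to all germs, and is pulled back to
  \<open>B\<close>.\<close>

lemma injective_interval_module:
  fixes D :: "real set" and K :: "('k, 'x) ring_scheme"
  assumes "field K" and D: "D \<noteq> {}" and down: "\<And>s t. t \<in> D \<Longrightarrow> s \<le> t \<Longrightarrow> s \<in> D"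
  shows "injective_pers U K (interval_module K D)"
  unfolding injective_pers_def
proof (intro allI impI; elim conjE)
  interpret field K by fact
  fix A B :: "('k, 'v) pers" and i g
  assume A: "persistence_module K A" and B: "persistence_module K B"
    and i: "pers_morphism K A B i" and mono: "pers_mono A i"
    and g: "pers_morphism K A (interval_module K D) g"
  interpret germs K B D by (intro germs.intro B D)
  interpret G: Module.module K "germ_space B D" by (rule germ_space_module)
  note Amod = persistence_moduleD(1)[OF A] and trA = persistence_moduleD(5)[OF A]
    and ic = pers_morphismD(3)[OF i]
  define \<gamma> where "\<gamma> s x = germ B D s (i s x)" for s x
  have \<gamma>_lin: "\<gamma> s \<in> linear_maps K (pspace A s) (germ_space B D)" for s
    unfolding \<gamma>_def by (rule linear_maps_comp[OF pers_morphismD(1)[OF i] germ_linear])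
  have \<gamma>_tr: "\<gamma> t (ptrans A s t x) = \<gamma> s x" if "s \<le> t" "t \<in> D" "x \<in> carrier (pspace A s)" for s t x
    using that germ_ptrans ic by (simp add: \<gamma>_def pers_morphismD(2)[OF i])
  have g_lin: "g s \<in> linear_maps K (pspace A s) (regular_space K)" if "s \<in> D" for s
    using pers_morphismD(1)[OF g, of s] that by (simp add: interval_module_def)
  have g_tr: "g t (ptrans A s t x) = g s x" if "s \<le> t" "t \<in> D" "x \<in> carrier (pspace A s)" for s t x
    using that down[of t s] by (simp add: pers_morphismD(2)[OF g] interval_module_simps)
  have ker: "g s x = \<zero>\<^bsub>K\<^esub>" if s: "s \<in> D" and x: "x \<in> carrier (pspace A s)"
    and z: "\<gamma> s x = \<zero>\<^bsub>germ_space B D\<^esub>" for s x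
  proof -
    obtain t where t: "t \<in> D" "s \<le> t" "ptrans B s t (i s x) = \<zero>\<^bsub>pspace B t\<^esub>"
      using z germ_eq_zero_iff[OF s ic[OF x]] by (auto simp: \<gamma>_def)
    interpret At: Module.module K "pspace A t" by (rule Amod)
    have "i t (ptrans A s t x) = i t \<zero>\<^bsub>pspace A t\<^esub>"
      using t x by (simp add: pers_morphismD(2)[OF i]
          linear_maps_zero_minus(1)[OF Amod persistence_moduleD(1)[OF B] pers_morphismD(1)[OF i]])
    then have "ptrans A s t x = \<zero>\<^bsub>pspace A t\<^esub>"
      using mono trA[OF t(2) x] by (auto simp: pers_mono_def inj_on_def)
    then show ?thesis
      using g_tr[OF t(2,1) x] linear_maps_zero_minus(1)[OF Amod regular_space_module[OF is_cring] g_lin[OF t(1)]]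
      by simp
  qed
  define H where "H = {\<gamma> s x |s x. s \<in> D \<and> x \<in> carrier (pspace A s)}"
  have HI: "\<gamma> s x \<in> H" if "s \<in> D" "x \<in> carrier (pspace A s)" for s x
    using that by (auto simp: H_def)
  \<comment> \<open>Any two elements of \<open>H\<close> are represented in one degree, the larger
    of the two; this makes the union of the images closed under addition.\<close>
  have common: "\<exists>s x y. s \<in> D \<and> x \<in> carrier (pspace A s) \<and> y \<in> carrier (pspace A s) \<and>
      v = \<gamma> s x \<and> w = \<gamma> s y" if "v \<in> H" "w \<in> H" for v w
  proof -
    obtain s x t y where s: "s \<in> D" "x \<in> carrier (pspace A s)" "v = \<gamma> s x"
      and t: "t \<in> D" "y \<in> carrier (pspace A t)" "w = \<gamma> t y"
      using \<open>v \<in> H\<close> \<open>w \<in> H\<close> by (auto simp: H_def)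
    have m: "max s t \<in> D" "s \<le> max s t" "t \<le> max s t"
      using s t by (auto simp: max_def)
    have "v = \<gamma> (max s t) (ptrans A s (max s t) x)" "w = \<gamma> (max s t) (ptrans A t (max s t) y)"
      using \<gamma>_tr[OF m(2,1) s(2)] \<gamma>_tr[OF m(3,1) t(2)] s(3) t(3) by simp_all
    then show ?thesis
      using m trA[OF m(2) s(2)] trA[OF m(3) t(2)] by blast
  qed
  have H: "submodule H K (germ_space B D)"
  proof (rule G.submoduleI)
    show "H \<subseteq> carrier (germ_space B D)"
      using linear_mapsD(1)[OF \<gamma>_lin] by (auto simp: H_def)
    obtain s where s: "s \<in> D" using D by auto
    interpret As: Module.module K "pspace A s" by (rule Amod)
    show "\<zero>\<^bsub>germ_space B D\<^esub> \<in> H"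
      using HI[OF s As.M.zero_closed] linear_maps_zero_minus(1)[OF Amod germ_space_module \<gamma>_lin] by simp
  next
    fix v assume v: "v \<in> H"
    then obtain s x where s: "s \<in> D" "x \<in> carrier (pspace A s)" "v = \<gamma> s x"
      by (auto simp: H_def)
    interpret As: Module.module K "pspace A s" by (rule Amod)
    show "\<ominus>\<^bsub>germ_space B D\<^esub> v \<in> H"
      using HI[OF s(1) As.M.a_inv_closed[OF s(2)]] s
        linear_maps_zero_minus(2)[OF Amod germ_space_module \<gamma>_lin] by simp
    show "c \<odot>\<^bsub>germ_space B D\<^esub> v \<in> H" if "c \<in> carrier K" for c
      using HI[OF s(1) As.smult_closed[OF that s(2)]] s that linear_mapsD(3)[OF \<gamma>_lin] by simp
    fix w assume "w \<in> H"
    then obtain s x y where s: "s \<in> D" "x \<in> carrier (pspace A s)" "y \<in> carrier (pspace A s)"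
      "v = \<gamma> s x" "w = \<gamma> s y"
      using common[OF v] by blast
    interpret As: Module.module K "pspace A s" by (rule Amod)
    show "v \<oplus>\<^bsub>germ_space B D\<^esub> w \<in> H"
      using HI[OF s(1) As.M.a_closed[OF s(2,3)]] s linear_mapsD(2)[OF \<gamma>_lin] by simp
  qed
  \<comment> \<open>Well defined: two representatives of one germ can be moved to a common degree,
    where their difference is killed by \<open>\<gamma>\<close> and thus by
    \<open>g\<close>.\<close>
  define g' where "g' v = (THE c. \<exists>s\<in>D. \<exists>x\<in>carrier (pspace A s). v = \<gamma> s x \<and> c = g s x)" for v
  have g': "g' (\<gamma> s x) = g s x" if s: "s \<in> D" and x: "x \<in> carrier (pspace A s)" for s x
    unfolding g'_def
  proof (rule the_equality)
    show "\<exists>t\<in>D. \<exists>y\<in>carrier (pspace A t). \<gamma> s x = \<gamma> t y \<and> g s x = g t y"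
      using s x by blast
    fix c assume "\<exists>t\<in>D. \<exists>y\<in>carrier (pspace A t). \<gamma> s x = \<gamma> t y \<and> c = g t y"
    then obtain t y where t: "t \<in> D" "y \<in> carrier (pspace A t)" "\<gamma> s x = \<gamma> t y" "c = g t y"
      by auto
    let ?m = "max s t"
    have m: "?m \<in> D" "s \<le> ?m" "t \<le> ?m"
      using s t by (auto simp: max_def)
    interpret Am: Module.module K "pspace A ?m" by (rule Amod)
    let ?x = "ptrans A s ?m x" and ?y = "ptrans A t ?m y"
    have xy: "?x \<in> carrier (pspace A ?m)" "?y \<in> carrier (pspace A ?m)"
      using trA[OF m(2) x] trA[OF m(3) t(2)] by auto
    have "\<gamma> ?m (?x \<ominus>\<^bsub>pspace A ?m\<^esub> ?y) = \<zero>\<^bsub>germ_space B D\<^esub>"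
      using t(3) \<gamma>_tr[OF m(2,1) x] \<gamma>_tr[OF m(3,1) t(2)] linear_mapsD(1)[OF \<gamma>_lin]
      by (simp add: linear_maps_diff[OF Amod germ_space_module \<gamma>_lin xy]
          module_diff_eq_zero_iff[OF germ_space_module] t(2))
    then have "g ?m (?x \<ominus>\<^bsub>pspace A ?m\<^esub> ?y) = \<zero>\<^bsub>K\<^esub>"
      by (intro ker m(1) Am.M.minus_closed xy)
    then have "g ?m ?x = g ?m ?y"
      using linear_maps_diff[OF Amod regular_space_module[OF is_cring] g_lin[OF m(1)] xy]
        module_diff_eq_zero_iff[OF regular_space_module[OF is_cring]] linear_mapsD(1)[OF g_lin[OF m(1)]] xy
      by simp
    then show "c = g s x"
      using g_tr[OF m(2,1) x] g_tr[OF m(3,1) t(2)] t(4) by simp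
  qed
  have "g' \<in> linear_maps K ((germ_space B D)\<lparr>carrier := H\<rparr>) (regular_space K)"
  proof (rule linear_mapsI; simp)
    fix v assume v: "v \<in> H"
    then obtain s x where s: "s \<in> D" "x \<in> carrier (pspace A s)" "v = \<gamma> s x"
      by (auto simp: H_def)
    interpret As: Module.module K "pspace A s" by (rule Amod)
    show "g' v \<in> carrier K"
      using s g' linear_mapsD(1)[OF g_lin[OF s(1)]] by simp
    show "g' (c \<odot>\<^bsub>germ_space B D\<^esub> v) = c \<otimes>\<^bsub>K\<^esub> g' v" if "c \<in> carrier K" for c
      using g'[OF s(1) As.smult_closed[OF that s(2)]] g'[OF s(1,2)] s that
        linear_mapsD(3)[OF \<gamma>_lin] linear_mapsD(3)[OF g_lin[OF s(1)]] by simp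
    fix w assume "w \<in> H"
    then obtain s x y where s: "s \<in> D" "x \<in> carrier (pspace A s)" "y \<in> carrier (pspace A s)"
      "v = \<gamma> s x" "w = \<gamma> s y"
      using common[OF v] by blast
    interpret As: Module.module K "pspace A s" by (rule Amod)
    show "g' (v \<oplus>\<^bsub>germ_space B D\<^esub> w) = g' v \<oplus>\<^bsub>K\<^esub> g' w"
      using g'[OF s(1) As.M.a_closed[OF s(2,3)]] g'[OF s(1,2)] g'[OF s(1,3)] s
        linear_mapsD(2)[OF \<gamma>_lin] linear_mapsD(2)[OF g_lin[OF s(1)]] by simp
  qed
  then obtain \<Lambda> where \<Lambda>: "\<Lambda> \<in> linear_maps K (germ_space B D) (regular_space K)"
    and \<Lambda>g: "\<And>v. v \<in> H \<Longrightarrow> \<Lambda> v = g' v"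
    using linear_functional_extension[OF assms(1) germ_space_module H] by blast
  \<comment> \<open>Outside \<open>D\<close> the target is zero. Naturality from \<open>s\<close> to
    \<open>t\<close> is then clear for \<open>t\<close> outside \<open>D\<close>, while
    \<open>t\<close> in \<open>D\<close> forces \<open>s\<close> in \<open>D\<close>, and both sides
    evaluate \<open>\<Lambda>\<close> at the same germ.\<close>
  let ?h = "\<lambda>t y. if t \<in> D then \<Lambda> (germ B D t y) else \<zero>\<^bsub>K\<^esub>"
  have "?h t \<in> linear_maps K (pspace B t) (pspace (interval_module K D) t)" for t
    by (rule linear_maps_interval_module[OF ring_axioms])
      (use linear_maps_comp[OF germ_linear \<Lambda>] Mmod in auto)
  moreover have "?h t (ptrans B s t y) = ptrans (interval_module K D) s t (?h s y)"
    if "s \<le> t" "y \<in> carrier (pspace B s)" for s t y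
    using that germ_ptrans down[of t s] by (auto simp: interval_module_simps)
  ultimately have "pers_morphism K B (interval_module K D) ?h"
    by (auto simp: pers_morphism_def)
  moreover have "?h s (i s x) = g s x" if "x \<in> carrier (pspace A s)" for s x
  proof (cases "s \<in> D")
    case True
    then show ?thesis
      using \<Lambda>g[OF HI[OF True that]] g'[OF True that] by (simp add: \<gamma>_def)
  next
    case False
    then show ?thesis
      using pers_morphismD(3)[OF g that] by (simp add: interval_module_simps)
  qed
  ultimately show "\<exists>h. pers_morphism K B (interval_module K D) h \<and>
      (\<forall>a. \<forall>x\<in>carrier (pspace A a). h a (i a x) = g a x)"
    by blast
qed


section \<open>Flat interval modules\<close>

locale up_interval =
  fixes K :: "('k, 'x) ring_scheme" and I :: "real set"
  assumes K: "field K" and nonempty: "I \<noteq> {}" and up: "\<And>s t. s \<in> I \<Longrightarrow> s \<le> t \<Longrightarrow> t \<in> I"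
begin

interpretation field K by (rule K)

lemma pers: "persistence_module K (interval_module K I)"
  by (rule interval_module_persistence_module[OF K]) (use up in \<open>auto simp: is_interval_1\<close>)

definition indices :: "real \<Rightarrow> real set" where
  "indices r = {s. r - s \<in> I}"

text \<open>For given \<open>s\<close> the degree \<open>r - s\<close> is the largest one allowed
  for the second factor. As \<open>I\<close> is an up-set, every x \<otimes> y with \<open>y\<close>
  in a degree of \<open>I\<close> can be moved there, and the scalar \<open>y\<close> can be shifted
  to \<open>x\<close>; so the second factor is normalized to 1.\<close>

abbreviation gpure :: "('k, 'v) pers \<Rightarrow> real \<Rightarrow> real \<Rightarrow> 'v \<Rightarrow> (real \<times> real \<Rightarrow> ('v \<times> 'k \<Rightarrow> 'k) set) set" where
  "gpure A r s x \<equiv> graded_pure K A (interval_module K I) r s (r - s) x \<one>\<^bsub>K\<^esub>"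

abbreviation gtensor :: "('k, 'v) pers \<Rightarrow> real \<Rightarrow> ('k, (real \<times> real \<Rightarrow> ('v \<times> 'k \<Rightarrow> 'k) set) set) module" where
  "gtensor A r \<equiv> pspace (graded_tensor K A (interval_module K I)) r"

lemma indices_nonempty: "indices r \<noteq> {}"
proof -
  obtain t where "t \<in> I" using nonempty by auto
  then have "r - t \<in> indices r" by (simp add: indices_def)
  then show ?thesis by auto
qed

lemma indices_down: "s \<in> indices r \<Longrightarrow> s' \<le> s \<Longrightarrow> s' \<in> indices r"
  using up[of "r - s" "r - s'"] by (simp add: indices_def)

lemma one_mem: "t \<in> I \<Longrightarrow> \<one>\<^bsub>K\<^esub> \<in> carrier (pspace (interval_module K I) t)"
  by (simp add: interval_module_simps)

context
  fixes A :: "('k, 'v) pers"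
  assumes A: "persistence_module K A"
begin

interpretation graded_pair K A "interval_module K I"
  by (intro graded_pair.intro A pers)

lemma gpure_linear:
  assumes "s \<in> indices r"
  shows "gpure A r s \<in> linear_maps K (pspace A s) (gtensor A r)"
  using graded_pure_bilinear[of s "r - s" r] one_mem[of "r - s"] assms
  by (simp add: bilinear_map_def indices_def)

lemma gpure_ptrans:
  assumes "s \<le> s'" "s' \<in> indices r" "x \<in> carrier (pspace A s)"
  shows "gpure A r s' (ptrans A s s' x) = gpure A r s x"
proof -
  have s: "r - s' \<in> I" "r - s \<in> I"
    using assms indices_down by (auto simp: indices_def)
  \<comment> \<open>The indices (s', r - s') and (s, r - s) are in general incomparable. The index
    (s, r - s') lies below both, and the second factor is 1 at all three.\<close>
  have "gpure A r s' (ptrans A s s' x) = graded_pure K A (interval_module K I) r s (r - s') x \<one>\<^bsub>K\<^esub>"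
    using graded_pure_compat[of s s' "r - s'" "r - s'" r x "\<one>\<^bsub>K\<^esub>"] assms s one_mem
    by (simp add: interval_module_simps)
  also have "\<dots> = gpure A r s x"
    using graded_pure_compat[of s s "r - s'" "r - s" r x "\<one>\<^bsub>K\<^esub>"] assms s one_mem
    by (simp add: interval_module_simps persistence_moduleD(3)[OF A])
  finally show ?thesis .
qed

text \<open>Sums collapse: two such elements can be moved to the larger of their degrees and added
  there. Hence these elements already form a submodule, and it contains all generators.\<close>

lemma graded_tensor_eq_gpure:
  assumes v: "v \<in> carrier (gtensor A r)"
  obtains s x where "s \<in> indices r" and "x \<in> carrier (pspace A s)" and "v = gpure A r s x"
proof -
  define G where "G = {gpure A r s x |s x. s \<in> indices r \<and> x \<in> carrier (pspace A s)}"
  have GI: "gpure A r s x \<in> G" if "s \<in> indices r" "x \<in> carrier (pspace A s)" for s x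
    using that by (auto simp: G_def)
  interpret T: Module.module K "gtensor A r" by (rule graded_tensor_module)
  note trA = persistence_moduleD(5)[OF A]
  have G0: "\<zero>\<^bsub>gtensor A r\<^esub> \<in> G"
  proof -
    obtain s where s: "s \<in> indices r" using indices_nonempty by auto
    interpret As: Module.module K "pspace A s" by (rule Mmod)
    show ?thesis
      using GI[OF s As.M.zero_closed] linear_maps_zero_minus(1)[OF Mmod graded_tensor_module gpure_linear[OF s]]
      by simp
  qed
  have "submodule G K (gtensor A r)"
  proof (rule T.submoduleI)
    show "G \<subseteq> carrier (gtensor A r)"
      using linear_mapsD(1)[OF gpure_linear] by (auto simp: G_def)
  next
    fix v w assume v: "v \<in> G"
    then obtain s x where s: "s \<in> indices r" "x \<in> carrier (pspace A s)" "v = gpure A r s x"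
      by (auto simp: G_def)
    interpret As: Module.module K "pspace A s" by (rule Mmod)
    show "\<ominus>\<^bsub>gtensor A r\<^esub> v \<in> G"
      using GI[OF s(1) As.M.a_inv_closed[OF s(2)]] s
        linear_maps_zero_minus(2)[OF Mmod graded_tensor_module gpure_linear] by simp
    show "c \<odot>\<^bsub>gtensor A r\<^esub> v \<in> G" if "c \<in> carrier K" for c
      using GI[OF s(1) As.smult_closed[OF that s(2)]] s that linear_mapsD(3)[OF gpure_linear] by simp
    assume "w \<in> G"
    then obtain t y where t: "t \<in> indices r" "y \<in> carrier (pspace A t)" "w = gpure A r t y"
      by (auto simp: G_def)
    let ?m = "max s t"
    have m: "?m \<in> indices r" "s \<le> ?m" "t \<le> ?m"
      using s t by (auto simp: max_def)
    interpret Am: Module.module K "pspace A ?m" by (rule Mmod)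
    have "v \<oplus>\<^bsub>gtensor A r\<^esub> w = gpure A r ?m (ptrans A s ?m x \<oplus>\<^bsub>pspace A ?m\<^esub> ptrans A t ?m y)"
      using gpure_ptrans[OF m(2,1) s(2)] gpure_ptrans[OF m(3,1) t(2)] s t
        linear_mapsD(2)[OF gpure_linear[OF m(1)] trA[OF m(2) s(2)] trA[OF m(3) t(2)]] by simp
    then show "v \<oplus>\<^bsub>gtensor A r\<^esub> w \<in> G"
      using GI[OF m(1) Am.M.a_closed[OF trA[OF m(2) s(2)] trA[OF m(3) t(2)]]] by simp
  qed (rule G0)
  then have "carrier (gtensor A r) \<subseteq> G"
  proof (rule graded_tensor_generation)
    fix s t x y
    assume st: "s + t \<le> r" and x: "x \<in> carrier (pspace A s)"
      and y: "y \<in> carrier (pspace (interval_module K I) t)"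
    interpret As: Module.module K "pspace A s" by (rule Mmod)
    note B = bilinear_mapD[OF graded_pure_bilinear]
    show "graded_pure K A (interval_module K I) r s t x y \<in> G"
    proof (cases "t \<in> I")
      case False
      then have "y = \<zero>\<^bsub>pspace (interval_module K I) t\<^esub>"
        using y by (simp add: interval_module_simps)
      moreover have "graded_pure K A (interval_module K I) r s t x \<in>
          linear_maps K (pspace (interval_module K I) t) (gtensor A r)"
        using graded_pure_bilinear[OF st] x by (simp add: bilinear_map_def)
      ultimately show ?thesis
        using linear_maps_zero_minus(1)[OF Nmod graded_tensor_module] G0 by simp
    next
      case True
      \<comment> \<open>Since s + t \<le> r, the degree \<open>t\<close> lies below
        \<open>r - s\<close>; \<open>y\<close> is transported there and then pulled out as a
        scalar.\<close>
      have rs: "r - s \<in> I"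
        using up[OF True, of "r - s"] st by simp
      then have s: "s \<in> indices r"
        by (simp add: indices_def)
      have yK: "y \<in> carrier K"
        using y True by (simp add: interval_module_simps)
      have "graded_pure K A (interval_module K I) r s t x y =
          graded_pure K A (interval_module K I) r s (r - s) x y"
        using graded_pure_compat[of s s t "r - s" r x y] st x y True rs
        by (simp add: persistence_moduleD(3)[OF A] interval_module_simps)
      also have "\<dots> = y \<odot>\<^bsub>gtensor A r\<^esub> gpure A r s x"
        using B(5)[of s "r - s" r x "\<one>\<^bsub>K\<^esub>" y] x yK one_mem[OF rs] by (simp add: interval_module_simps)
      also have "\<dots> = gpure A r s (y \<odot>\<^bsub>pspace A s\<^esub> x)"
        by (rule linear_mapsD(3)[OF gpure_linear[OF s] yK x, symmetric])
      finally show ?thesis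
        using GI[OF s As.smult_closed[OF yK x]] by simp
    qed
  qed
  then show ?thesis
    using that v by (auto simp: G_def)
qed

text \<open>One direction moves \<open>x\<close> to the degree where it becomes zero. For the other,
  \<open>y\<close> times the germ of \<open>x\<close> is compatible with all transition maps and
  defines a map from the tensor product to the germs, where vanishing is known to mean vanishing at
  a later index.\<close>

lemma gpure_eq_zero_iff:
  assumes s: "s \<in> indices r" and x: "x \<in> carrier (pspace A s)"
  shows "gpure A r s x = \<zero>\<^bsub>gtensor A r\<^esub> \<longleftrightarrow>
    (\<exists>s'\<in>indices r. s \<le> s' \<and> ptrans A s s' x = \<zero>\<^bsub>pspace A s'\<^esub>)"
proof
  assume "\<exists>s'\<in>indices r. s \<le> s' \<and> ptrans A s s' x = \<zero>\<^bsub>pspace A s'\<^esub>"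
  then show "gpure A r s x = \<zero>\<^bsub>gtensor A r\<^esub>"
    using gpure_ptrans[OF _ _ x] linear_maps_zero_minus(1)[OF Mmod graded_tensor_module gpure_linear]
    by metis
next
  assume z: "gpure A r s x = \<zero>\<^bsub>gtensor A r\<^esub>"
  interpret germs K A "indices r"
    by (intro germs.intro A indices_nonempty)
  interpret G: Module.module K "germ_space A (indices r)" by (rule germ_space_module)
  let ?\<beta> = "\<lambda>s t x y. y \<odot>\<^bsub>germ_space A (indices r)\<^esub> germ A (indices r) s x"
  have yK: "y \<in> carrier K" if "y \<in> carrier (pspace (interval_module K I) t)" for y t
    using that by (auto simp: interval_module_simps split: if_splits)
  note g = linear_mapsD[OF germ_linear]
  obtain h where h: "h \<in> linear_maps K (gtensor A r) (germ_space A (indices r))"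
    and h_pure: "\<And>s t x y. s + t \<le> r \<Longrightarrow> x \<in> carrier (pspace A s) \<Longrightarrow>
      y \<in> carrier (pspace (interval_module K I) t) \<Longrightarrow>
      h (graded_pure K A (interval_module K I) r s t x y) = ?\<beta> s t x y"
  proof (rule graded_tensor_universal[OF germ_space_module, of r ?\<beta>])
    fix s t :: real assume "s + t \<le> r"
    show "bilinear_map K (pspace A s) (pspace (interval_module K I) t) (germ_space A (indices r)) (?\<beta> s t)"
      unfolding bilinear_map_def
    proof (intro conjI ballI linear_mapsI)
    qed (use yK g in \<open>auto simp: interval_module_simps G.smult_l_distr G.smult_r_distr G.smult_assoc1
        m_comm simp flip: G.smult_assoc1\<close>)
  next
    fix s t s' t' x y
    assume le: "s \<le> s'" "t \<le> t'" "s' + t' \<le> r" and x: "x \<in> carrier (pspace A s)"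
      and y: "y \<in> carrier (pspace (interval_module K I) t)"
    show "?\<beta> s' t' (ptrans A s s' x) (ptrans (interval_module K I) t t' y) = ?\<beta> s t x y"
    proof (cases "t \<in> I")
      case True
      \<comment> \<open>By \<open>le\<close> the degree t' is at most r - s', so \<open>s'\<close>
        is an admissible index and \<open>germ_ptrans\<close> applies.\<close>
      then have "t' \<in> I" "r - s' \<in> I"
        using up le by (auto intro: up[of t])
      then show ?thesis
        using True le germ_ptrans[OF le(1) _ x] by (simp add: interval_module_simps indices_def)
    next
      case False
      then show ?thesis
        using y x g(1) persistence_moduleD(5)[OF A le(1) x] by (simp add: interval_module_simps)
    qed
  qed blast
  have "r - s \<in> I"
    using s by (simp add: indices_def)
  then have "germ A (indices r) s x = \<zero>\<^bsub>germ_space A (indices r)\<^esub>"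
    using h_pure[of s "r - s" x "\<one>\<^bsub>K\<^esub>"] x one_mem z g(1)[OF x]
      linear_maps_zero_minus(1)[OF graded_tensor_module germ_space_module h] by simp
  then show "\<exists>s'\<in>indices r. s \<le> s' \<and> ptrans A s s' x = \<zero>\<^bsub>pspace A s'\<^esub>"
    using germ_eq_zero_iff[OF s x] by simp
qed

end

text \<open>Every element of the three tensor products is a single \<open>gpure\<close>, and its
  vanishing is witnessed at a later index; so each exactness statement reduces to exactness of the
  given sequence in one degree.\<close>

lemma flat: "flat_pers U K (interval_module K I)"
  unfolding flat_pers_def
proof (intro allI impI; elim conjE)
  fix A B C :: "('k, 'v) pers" and f g
  assume A: "persistence_module K A" and B: "persistence_module K B" and C: "persistence_module K C"
    and f: "pers_morphism K A B f" and g: "pers_morphism K B C g" and exact: "short_exact A f B g C"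
  have tens: "Module.module K (gtensor X r)" if "persistence_module K X" for X :: "('k, 'v) pers" and r
    by (rule graded_pair.graded_tensor_module[OF graded_pair.intro[OF that pers]])
  note F = graded_tensor_map[OF A B pers f] and G = graded_tensor_map[OF B C pers g]
  let ?f = "graded_tensor_map K B (interval_module K I) f" and ?g = "graded_tensor_map K C (interval_module K I) g"
  have one: "\<one>\<^bsub>K\<^esub> \<in> carrier (pspace (interval_module K I) (r - s))" if "s \<in> indices r" for r s
    using that one_mem by (simp add: indices_def)
  have f_pure: "?f r (gpure A r s x) = gpure B r s (f s x)"
    if "s \<in> indices r" "x \<in> carrier (pspace A s)" for r s x
    using F(2)[of s "r - s" r x "\<one>\<^bsub>K\<^esub>"] that one by simp
  have g_pure: "?g r (gpure B r s x) = gpure C r s (g s x)"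
    if "s \<in> indices r" "x \<in> carrier (pspace B s)" for r s x
    using G(2)[of s "r - s" r x "\<one>\<^bsub>K\<^esub>"] that one by simp
  have inj: "inj_on (f s) (carrier (pspace A s))"
    and ker: "f s ` carrier (pspace A s) = {y \<in> carrier (pspace B s). g s y = \<zero>\<^bsub>pspace C s\<^esub>}"
    and surj: "g s ` carrier (pspace B s) = carrier (pspace C s)" for s
    using exact by (auto simp: short_exact_def pers_mono_def pers_epi_def)
  note trA = persistence_moduleD(5)[OF A] and trB = persistence_moduleD(5)[OF B]
  note Amod = persistence_moduleD(1)[OF A] and Bmod = persistence_moduleD(1)[OF B]
  show "short_exact (graded_tensor K A (interval_module K I)) ?f (graded_tensor K B (interval_module K I))
      ?g (graded_tensor K C (interval_module K I))"
    unfolding short_exact_def pers_mono_def pers_epi_def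
  proof (intro conjI allI)
    fix r
    show "inj_on (?f r) (carrier (gtensor A r))"
    proof (rule linear_inj_onI[OF tens[OF A] tens[OF B] F(1)])
      fix v assume v: "v \<in> carrier (gtensor A r)" and z: "?f r v = \<zero>\<^bsub>gtensor B r\<^esub>"
      obtain s x where s: "s \<in> indices r" "x \<in> carrier (pspace A s)" "v = gpure A r s x"
        by (rule graded_tensor_eq_gpure[OF A v])
      have fx: "f s x \<in> carrier (pspace B s)"
        by (rule pers_morphismD(3)[OF f s(2)])
      obtain t where t: "t \<in> indices r" "s \<le> t" "ptrans B s t (f s x) = \<zero>\<^bsub>pspace B t\<^esub>"
        using z gpure_eq_zero_iff[OF B s(1) fx] f_pure[OF s(1,2)] s(3) by auto
      interpret At: Module.module K "pspace A t" by (rule Amod)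
      have "f t (ptrans A s t x) = f t \<zero>\<^bsub>pspace A t\<^esub>"
        using t pers_morphismD(2)[OF f t(2) s(2)]
          linear_maps_zero_minus(1)[OF Amod Bmod pers_morphismD(1)[OF f]] by simp
      then have "ptrans A s t x = \<zero>\<^bsub>pspace A t\<^esub>"
        using inj_onD[OF inj _ trA[OF t(2) s(2)] At.M.zero_closed] by simp
      then show "v = \<zero>\<^bsub>gtensor A r\<^esub>"
        using gpure_eq_zero_iff[OF A s(1,2)] t(1,2) s(3) by auto
    qed
    show "?f r ` carrier (gtensor A r) = {v \<in> carrier (gtensor B r). ?g r v = \<zero>\<^bsub>gtensor C r\<^esub>}"
    proof (intro equalityI subsetI)
      fix w assume "w \<in> ?f r ` carrier (gtensor A r)"
      then obtain v where v: "v \<in> carrier (gtensor A r)" "w = ?f r v"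
        by auto
      obtain s x where s: "s \<in> indices r" "x \<in> carrier (pspace A s)" "v = gpure A r s x"
        by (rule graded_tensor_eq_gpure[OF A v(1)])
      have fx: "f s x \<in> carrier (pspace B s)" "g s (f s x) = \<zero>\<^bsub>pspace C s\<^esub>"
        using ker s(2) by auto
      have "?g r w = \<zero>\<^bsub>gtensor C r\<^esub>"
        using f_pure[OF s(1,2)] g_pure[OF s(1) fx(1)] fx(2) v(2) s(3)
          linear_maps_zero_minus(1)[OF persistence_moduleD(1)[OF C] tens[OF C] gpure_linear[OF C s(1)]]
        by simp
      then show "w \<in> {v \<in> carrier (gtensor B r). ?g r v = \<zero>\<^bsub>gtensor C r\<^esub>}"
        using linear_mapsD(1)[OF F(1)] v by simp
    next
      fix w assume w: "w \<in> {v \<in> carrier (gtensor B r). ?g r v = \<zero>\<^bsub>gtensor C r\<^esub>}"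
      then have wB: "w \<in> carrier (gtensor B r)"
        by simp
      obtain s y where s: "s \<in> indices r" "y \<in> carrier (pspace B s)" "w = gpure B r s y"
        by (rule graded_tensor_eq_gpure[OF B wB])
      obtain t where t: "t \<in> indices r" "s \<le> t" "ptrans C s t (g s y) = \<zero>\<^bsub>pspace C t\<^esub>"
        using w g_pure[OF s(1,2)] gpure_eq_zero_iff[OF C s(1) pers_morphismD(3)[OF g s(2)]] s(3) by auto
      \<comment> \<open>\<open>y\<close> itself need not come from \<open>A\<close>. It does after
        the move to degree \<open>t\<close>, where its image in \<open>C\<close> has become
        zero.\<close>
      have "ptrans B s t y \<in> f t ` carrier (pspace A t)"
        using ker[of t] trB[OF t(2) s(2)] t(3) pers_morphismD(2)[OF g t(2) s(2)] by auto
      then obtain x where x: "x \<in> carrier (pspace A t)" "ptrans B s t y = f t x"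
        by auto
      then have "w = ?f r (gpure A r t x)"
        using f_pure[OF t(1) x(1)] gpure_ptrans[OF B t(2,1) s(2)] s(3) by simp
      then show "w \<in> ?f r ` carrier (gtensor A r)"
        using linear_mapsD(1)[OF gpure_linear[OF A t(1)] x(1)] by blast
    qed
    show "?g r ` carrier (gtensor B r) = carrier (gtensor C r)"
    proof (intro equalityI subsetI)
      fix w assume w: "w \<in> carrier (gtensor C r)"
      obtain s z where s: "s \<in> indices r" "z \<in> carrier (pspace C s)" "w = gpure C r s z"
        by (rule graded_tensor_eq_gpure[OF C w])
      then obtain y where y: "y \<in> carrier (pspace B s)" "z = g s y"
        using surj[of s] by blast
      then have "w = ?g r (gpure B r s y)"
        using g_pure[OF s(1)] s(3) by simp
      then show "w \<in> ?g r ` carrier (gtensor B r)"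
        using linear_mapsD(1)[OF gpure_linear[OF B s(1)] y(1)] by blast
    qed (use linear_mapsD(1)[OF G(1)] in auto)
  qed
qed

end

section \<open>Transport along an injection\<close>

text \<open>
  Replaces the underlying type of a persistence module, so that concrete test modules become
  members of the universe \<open>'v\<close>.
\<close>

definition transport_space :: "('v \<Rightarrow> 'w) \<Rightarrow> ('k, 'v) module \<Rightarrow> ('k, 'w) module" where
  "transport_space e V = \<lparr>carrier = e ` carrier V, mult = undefined, one = undefined,
     zero = e \<zero>\<^bsub>V\<^esub>, add = (\<lambda>x y. e (inv_into UNIV e x \<oplus>\<^bsub>V\<^esub> inv_into UNIV e y)),
     smult = (\<lambda>c x. e (c \<odot>\<^bsub>V\<^esub> inv_into UNIV e x))\<rparr>"

definition transport_pers :: "('v \<Rightarrow> 'w) \<Rightarrow> ('k, 'v) pers \<Rightarrow> ('k, 'w) pers" where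
  "transport_pers e M = \<lparr>pspace = (\<lambda>t. transport_space e (pspace M t)),
     ptrans = (\<lambda>s t x. e (ptrans M s t (inv_into UNIV e x)))\<rparr>"

lemma transport_space_simps:
  "carrier (transport_space e V) = e ` carrier V"
  "\<zero>\<^bsub>transport_space e V\<^esub> = e \<zero>\<^bsub>V\<^esub>"
  "x \<oplus>\<^bsub>transport_space e V\<^esub> y = e (inv_into UNIV e x \<oplus>\<^bsub>V\<^esub> inv_into UNIV e y)"
  "c \<odot>\<^bsub>transport_space e V\<^esub> x = e (c \<odot>\<^bsub>V\<^esub> inv_into UNIV e x)"
  by (simp_all add: transport_space_def)

lemma transport_pers_simps:
  "pspace (transport_pers e M) t = transport_space e (pspace M t)"
  "ptrans (transport_pers e M) s t x = e (ptrans M s t (inv_into UNIV e x))"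
  by (simp_all add: transport_pers_def)

lemma transport_space_module:
  assumes e: "inj e" and V: "Module.module K V"
  shows "Module.module K (transport_space e V)"
proof -
  interpret V: Module.module K V by fact
  have "abelian_group (transport_space e V)"
  proof (rule abelian_groupI)
    show "\<exists>y\<in>carrier (transport_space e V). y \<oplus>\<^bsub>transport_space e V\<^esub> x = \<zero>\<^bsub>transport_space e V\<^esub>"
      if "x \<in> carrier (transport_space e V)" for x
      using that e by (auto simp: transport_space_simps V.M.l_neg intro!: bexI[of _ "\<ominus>\<^bsub>V\<^esub> z" for z])
  qed (use e in \<open>auto simp: transport_space_simps V.M.a_ac\<close>)
  then show ?thesis
    by (intro moduleI)
      (use e in \<open>auto simp: V.R.is_cring transport_space_simps V.smult_l_distr V.smult_r_distr V.smult_assoc1\<close>)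
qed

lemma transport_linear:
  assumes e: "inj e"
  shows "e \<in> linear_maps K V (transport_space e V)"
    and "inv_into UNIV e \<in> linear_maps K (transport_space e V) V"
  using e by (auto simp: linear_maps_def transport_space_simps)

lemma transport_persistence_module:
  assumes e: "inj e" and M: "persistence_module K M"
  shows "persistence_module K (transport_pers e M)"
  unfolding persistence_module_def
proof (intro conjI allI impI ballI)
  show "Module.module K (pspace (transport_pers e M) t)" for t
    by (simp add: transport_pers_simps transport_space_module[OF e persistence_moduleD(1)[OF M]])
  show "ptrans (transport_pers e M) s t \<in> linear_maps K (pspace (transport_pers e M) s) (pspace (transport_pers e M) t)"
    if "s \<le> t" for s t
    using linear_maps_comp[OF linear_maps_comp[OF transport_linear(2)[OF e] persistence_moduleD(2)[OF M that]]
        transport_linear(1)[OF e]]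
    by (simp add: transport_pers_def)
qed (use e persistence_moduleD(3,4)[OF M] in \<open>auto simp: transport_pers_simps transport_space_simps\<close>)

lemma pers_morphism_comp:
  assumes f: "pers_morphism K L M f" and g: "pers_morphism K M N g"
  shows "pers_morphism K L N (\<lambda>t x. g t (f t x))"
  unfolding pers_morphism_def
  using linear_maps_comp[OF pers_morphismD(1)[OF f] pers_morphismD(1)[OF g]]
  by (simp add: pers_morphismD(2,3)[OF f] pers_morphismD(2)[OF g])

lemma transport_morphism:
  assumes e: "inj e" and M: "persistence_module K M"
  shows "pers_morphism K M (transport_pers e M) (\<lambda>_. e)"
    and "pers_morphism K (transport_pers e M) M (\<lambda>_. inv_into UNIV e)"
  using e transport_linear[OF e] by (auto simp: pers_morphism_def transport_pers_simps transport_space_simps)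

lemma short_exact_transport:
  assumes e: "inj e" and exact: "short_exact A f B g C"
  shows "short_exact (transport_pers e A) (\<lambda>s x. e (f s (inv_into UNIV e x))) (transport_pers e B)
    (\<lambda>s x. e (g s (inv_into UNIV e x))) (transport_pers e C)"
  unfolding short_exact_def pers_mono_def pers_epi_def
proof (intro conjI allI)
  fix s
  have inj: "inj_on (f s) (carrier (pspace A s))"
    and ker: "f s ` carrier (pspace A s) = {y \<in> carrier (pspace B s). g s y = \<zero>\<^bsub>pspace C s\<^esub>}"
    and surj: "g s ` carrier (pspace B s) = carrier (pspace C s)"
    using exact by (auto simp: short_exact_def pers_mono_def pers_epi_def)
  let ?f = "\<lambda>x. e (f s (inv_into UNIV e x))" and ?g = "\<lambda>x. e (g s (inv_into UNIV e x))"
  show "inj_on ?f (carrier (pspace (transport_pers e A) s))"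
    using inj e by (auto simp: inj_on_def transport_pers_simps transport_space_simps inj_eq[OF e])
  have "?f ` e ` X = e ` f s ` X" and "?g ` e ` X = e ` g s ` X" for X
    using e by (simp_all add: image_image)
  then show "?f ` carrier (pspace (transport_pers e A) s) =
      {y \<in> carrier (pspace (transport_pers e B) s). ?g y = \<zero>\<^bsub>pspace (transport_pers e C) s\<^esub>}"
    and "?g ` carrier (pspace (transport_pers e B) s) = carrier (pspace (transport_pers e C) s)"
    using ker surj e by (auto simp: transport_pers_simps transport_space_simps inj_eq[OF e])
qed

text \<open>Test modules over other types are admissible once their types embed into the universe:
  the extension problem is transported along \<open>eA\<close> and \<open>eB\<close>, solved there,
  and the solution is composed with \<open>eB\<close>.\<close>

lemma injective_pers_extend:
  fixes A :: "('k, 'a) pers" and B :: "('k, 'b) pers" and U :: "'v itself"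
  assumes inj: "injective_pers U K M" and eA: "inj (eA :: 'a \<Rightarrow> 'v)" and eB: "inj (eB :: 'b \<Rightarrow> 'v)"
    and A: "persistence_module K A" and B: "persistence_module K B"
    and i: "pers_morphism K A B i" and mono: "pers_mono A i" and g: "pers_morphism K A M g"
  obtains h where "pers_morphism K B M h"
    and "\<And>a x. x \<in> carrier (pspace A a) \<Longrightarrow> h a (i a x) = g a x"
proof -
  let ?i = "\<lambda>t x. eB (i t (inv_into UNIV eA x))" and ?g = "\<lambda>t x. g t (inv_into UNIV eA x)"
  note tA = transport_morphism[OF eA A] and tB = transport_morphism[OF eB B]
  have "pers_mono (transport_pers eA A) ?i"
    using mono eA by (auto simp: pers_mono_def inj_on_def transport_pers_simps transport_space_simps inj_eq[OF eB])
  moreover have "pers_morphism K (transport_pers eA A) (transport_pers eB B) ?i"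
    using pers_morphism_comp[OF pers_morphism_comp[OF tA(2) i] tB(1)] .
  moreover have "pers_morphism K (transport_pers eA A) M ?g"
    using pers_morphism_comp[OF tA(2) g] .
  ultimately obtain h where h: "pers_morphism K (transport_pers eB B) M h"
    and hi: "\<And>t x. x \<in> carrier (pspace (transport_pers eA A) t) \<Longrightarrow> h t (?i t x) = ?g t x"
    using inj transport_persistence_module[OF eA A] transport_persistence_module[OF eB B]
    unfolding injective_pers_def by blast
  show ?thesis
  proof (rule that[of "\<lambda>t x. h t (eB x)"])
    show "pers_morphism K B M (\<lambda>t x. h t (eB x))"
      by (rule pers_morphism_comp[OF tB(1) h])
    show "h t (eB (i t x)) = g t x" if "x \<in> carrier (pspace A t)" for t x
      using hi[of "eA x" t] that eA by (simp add: transport_pers_simps transport_space_simps)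
  qed
qed

lemma projective_pers_lift:
  fixes B :: "('k, 'b) pers" and C :: "('k, 'c) pers" and U :: "'v itself"
  assumes proj: "projective_pers U K M" and eB: "inj (eB :: 'b \<Rightarrow> 'v)" and eC: "inj (eC :: 'c \<Rightarrow> 'v)"
    and B: "persistence_module K B" and C: "persistence_module K C"
    and p: "pers_morphism K B C p" and epi: "pers_epi B C p" and g: "pers_morphism K M C g"
  obtains h where "pers_morphism K M B h"
    and "\<And>a x. x \<in> carrier (pspace M a) \<Longrightarrow> p a (h a x) = g a x"
proof -
  let ?p = "\<lambda>t x. eC (p t (inv_into UNIV eB x))" and ?g = "\<lambda>t x. eC (g t x)"
  note tB = transport_morphism[OF eB B] and tC = transport_morphism[OF eC C]
  have "p t ` carrier (pspace B t) = carrier (pspace C t)" for t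
    using epi by (simp add: pers_epi_def)
  then have "pers_epi (transport_pers eB B) (transport_pers eC C) ?p"
    using eB by (simp add: pers_epi_def transport_pers_simps transport_space_simps image_image)
      (metis image_image)
  moreover have "pers_morphism K (transport_pers eB B) (transport_pers eC C) ?p"
    using pers_morphism_comp[OF pers_morphism_comp[OF tB(2) p] tC(1)] .
  moreover have "pers_morphism K M (transport_pers eC C) ?g"
    using pers_morphism_comp[OF g tC(1)] .
  ultimately obtain h where h: "pers_morphism K M (transport_pers eB B) h"
    and ph: "\<And>t x. x \<in> carrier (pspace M t) \<Longrightarrow> ?p t (h t x) = ?g t x"
    using proj transport_persistence_module[OF eB B] transport_persistence_module[OF eC C]
    unfolding projective_pers_def by blast
  show ?thesis
  proof (rule that[of "\<lambda>t x. inv_into UNIV eB (h t x)"])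
    show "pers_morphism K M B (\<lambda>t x. inv_into UNIV eB (h t x))"
      by (rule pers_morphism_comp[OF h tB(2)])
    show "p t (inv_into UNIV eB (h t x)) = g t x" if "x \<in> carrier (pspace M t)" for t x
      using ph[OF that] eC by (simp add: inj_eq)
  qed
qed


section \<open>Interval modules that are not injective, projective or flat\<close>

text \<open>Naturality can fail in two ways: a vector enters I \<inter> J from a degree of
  \<open>I\<close> outside \<open>J\<close>, or it leaves \<open>I\<close> while staying in
  \<open>J\<close>. The two assumptions exclude them in this order.\<close>

lemma interval_module_morphism:
  assumes "field K"
    and "\<And>s t. s \<le> t \<Longrightarrow> s \<in> I \<Longrightarrow> t \<in> I \<Longrightarrow> t \<in> J \<Longrightarrow> s \<in> J"
    and "\<And>s t. s \<le> t \<Longrightarrow> s \<in> I \<Longrightarrow> s \<in> J \<Longrightarrow> t \<in> J \<Longrightarrow> t \<in> I"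
  shows "pers_morphism K (interval_module K I) (interval_module K J)
    (\<lambda>t x. if t \<in> I \<and> t \<in> J then x else \<zero>\<^bsub>K\<^esub>)"
proof -
  interpret field K by fact
  show ?thesis
    using assms(2,3) unfolding pers_morphism_def linear_maps_def
    by (auto simp: interval_module_simps)
qed

lemma is_interval_between:
  fixes I :: "real set"
  shows "is_interval I \<Longrightarrow> a \<in> I \<Longrightarrow> b \<in> I \<Longrightarrow> a \<le> x \<Longrightarrow> x \<le> b \<Longrightarrow> x \<in> I"
  unfolding is_interval_1 by blast

text \<open>In k[m, \<infinity>) the 1 of degree \<open>t\<close> comes from degree
  \<open>m\<close>, where k[I] is zero; an extension would have to send it both to 1 and to
  0.\<close>

lemma not_injective_interval_module:
  fixes U :: "'v itself" and K :: "('k, 'x) ring_scheme" and e :: "'k \<Rightarrow> 'v"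
  assumes K: "field K" and e: "inj e" and I: "is_interval I"
    and t: "t \<in> I" and m: "m \<notin> I" "m < t"
  shows "\<not> injective_pers U K (interval_module K I)"
proof
  assume inj: "injective_pers U K (interval_module K I)"
  interpret field K by (rule K)
  note pers = interval_module_persistence_module[OF K]
  have A: "persistence_module K (interval_module K {t..})" and B: "persistence_module K (interval_module K {m..})"
    by (auto intro!: pers simp: is_interval_1)
  have i: "pers_morphism K (interval_module K {t..}) (interval_module K {m..})
      (\<lambda>s x. if s \<in> {t..} \<and> s \<in> {m..} then x else \<zero>\<^bsub>K\<^esub>)"
    using m by (intro interval_module_morphism K) auto
  have g: "pers_morphism K (interval_module K {t..}) (interval_module K I)
      (\<lambda>s x. if s \<in> {t..} \<and> s \<in> I then x else \<zero>\<^bsub>K\<^esub>)"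
  proof (rule interval_module_morphism[OF K])
    show "s \<in> I" if "s \<le> s'" "s \<in> {t..}" "s' \<in> I" for s s'
      using is_interval_between[OF I t \<open>s' \<in> I\<close>, of s] that by simp
  qed (auto simp: is_interval_1)
  have mono: "pers_mono (interval_module K {t..}) (\<lambda>s x. if s \<in> {t..} \<and> s \<in> {m..} then x else \<zero>\<^bsub>K\<^esub>)"
    using m by (auto simp: pers_mono_def inj_on_def interval_module_simps)
  obtain h where h: "pers_morphism K (interval_module K {m..}) (interval_module K I) h"
    and hi: "\<And>s x. x \<in> carrier (pspace (interval_module K {t..}) s) \<Longrightarrow>
      h s (if s \<in> {t..} \<and> s \<in> {m..} then x else \<zero>\<^bsub>K\<^esub>) = (if s \<in> {t..} \<and> s \<in> I then x else \<zero>\<^bsub>K\<^esub>)"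
    by (rule injective_pers_extend[OF inj e e A B i mono g]) blast
  have "h t \<one>\<^bsub>K\<^esub> = \<one>\<^bsub>K\<^esub>"
    using hi[of "\<one>\<^bsub>K\<^esub>" t] t m by (simp add: interval_module_simps)
  moreover have "h t \<one>\<^bsub>K\<^esub> = \<zero>\<^bsub>K\<^esub>"
    using pers_morphismD(2)[OF h, of m t "\<one>\<^bsub>K\<^esub>"] m by (simp add: interval_module_simps)
  ultimately show False
    by simp
qed

text \<open>
  A projective \<open>k[I]\<close> is a direct summand of its cover by the sum of all \<open>k[s, \<infinity>)\<close>,
  \<open>s \<in> I\<close>. The transition maps of the cover are inclusions, so the section picks a single nonzero
  element whose support lies below every point of \<open>I\<close>.
\<close>

lemma projective_interval_module_imp:
  fixes U :: "'v itself" and K :: "('k, 'x) ring_scheme" and e :: "(real \<Rightarrow> 'k) \<Rightarrow> 'v"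
  assumes K: "field K" and e: "inj e" and I: "is_interval I" "I \<noteq> {}"
    and proj: "projective_pers U K (interval_module K I)"
  shows "\<exists>m. I = {m..}"
proof -
  interpret field K by (rule K)
  let ?R = "\<lambda>_ :: real. regular_space K"
  \<comment> \<open>In degree \<open>t\<close> the sum of the k[s, \<infinity>) with
    \<open>s\<close> in \<open>I\<close> is free on the \<open>s\<close> up to \<open>t\<close>.
    With finitely supported functions as vectors, the transition maps leave the vectors
    unaltered.\<close>
  define B where "B = \<lparr>pspace = (\<lambda>t. free_space K (I \<inter> {..t})), ptrans = (\<lambda>_ _ u. u)\<rparr>"
  have Bs: "pspace B t = direct_sum (I \<inter> {..t}) ?R" "ptrans B s t u = u" for s t u
    by (simp_all add: B_def free_space_def)
  note reg = regular_space_module[OF is_cring]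
  have incl: "u \<in> carrier (pspace B t)" if "u \<in> carrier (pspace B s)" "s \<le> t" for u s t
    using that by (auto simp: Bs direct_sum_carrier)
  have B: "persistence_module K B"
    unfolding persistence_module_def
  proof (intro conjI allI impI ballI)
    show "Module.module K (pspace B t)" for t
      unfolding Bs by (rule direct_sum_module[OF is_cring reg])
    show "ptrans B s t \<in> linear_maps K (pspace B s) (pspace B t)" if "s \<le> t" for s t
      using incl[OF _ that] by (intro linear_mapsI) (simp_all add: Bs direct_sum_simps)
  qed (simp_all add: Bs)
  let ?S = "direct_sum_lift ?R (regular_space K) (\<lambda>_ c. c)"
  have S: "?S \<in> linear_maps K (pspace B t) (regular_space K)" for t
    unfolding Bs by (rule direct_sum_lift(1)[OF reg reg linear_maps_id])
  let ?p = "\<lambda>t u. if t \<in> I then ?S u else \<zero>\<^bsub>K\<^esub>"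
  have C: "persistence_module K (interval_module K I)"
    by (rule interval_module_persistence_module[OF K I(1)])
  have p_lin: "?p t \<in> linear_maps K (pspace B t) (pspace (interval_module K I) t)" for t
    by (rule linear_maps_interval_module[OF ring_axioms _ _ persistence_moduleD(1)[OF B]]) (use S in auto)
  \<comment> \<open>By convexity, a degree outside \<open>I\<close> with a point of \<open>I\<close>
    above it has no point of \<open>I\<close> below it, so the sum is zero there. Naturality of
    \<open>?p\<close> requires this: in such a degree \<open>?p\<close> is zero, whereas in degree
    \<open>t\<close> it adds up all coordinates.\<close>
  have empty: "u = (\<lambda>_. \<zero>\<^bsub>K\<^esub>)" if "u \<in> carrier (pspace B s)" "s \<notin> I" "s \<le> t" "t \<in> I" for u s t
  proof -
    have "r \<notin> I" if "r \<le> s" for r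
      using is_interval_between[OF I(1) _ \<open>t \<in> I\<close> that \<open>s \<le> t\<close>] \<open>s \<notin> I\<close> by auto
    then show ?thesis
      using that by (auto simp: Bs direct_sum_carrier fun_eq_iff)
  qed
  have S0: "?S (\<lambda>_. \<zero>\<^bsub>K\<^esub>) = \<zero>\<^bsub>K\<^esub>"
    using linear_maps_zero_minus(1)[OF persistence_moduleD(1)[OF B] reg S] by (simp add: Bs direct_sum_simps)
  have p: "pers_morphism K B (interval_module K I) ?p"
    unfolding pers_morphism_def
  proof (intro conjI allI impI ballI p_lin)
    show "?p t (ptrans B s t u) = ptrans (interval_module K I) s t (?p s u)"
      if "s \<le> t" "u \<in> carrier (pspace B s)" for s t u
      using empty[OF that(2) _ that(1)] S0 by (auto simp: interval_module_simps Bs)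
  qed
  have epi: "pers_epi B (interval_module K I) ?p"
    unfolding pers_epi_def
  proof (intro allI equalityI subsetI)
    fix t c assume c: "c \<in> carrier (pspace (interval_module K I) t)"
    show "c \<in> ?p t ` carrier (pspace B t)"
    proof (cases "t \<in> I")
      case True
      then have "in_summand ?R t c \<in> carrier (pspace B t)"
        unfolding Bs using c
        by (intro linear_mapsD(1)[OF in_summand_linear[where D = ?R, OF reg]]) (simp_all add: interval_module_simps)
      moreover have "?p t (in_summand ?R t c) = c"
        using direct_sum_lift(2)[where J = "I \<inter> {..t}" and D = ?R, OF reg reg linear_maps_id, of t c] c True
        by (simp add: interval_module_simps)
      ultimately show ?thesis
        using imageI[of "in_summand ?R t c" "carrier (pspace B t)" "?p t"] by simp
    next
      case False
      have "\<zero>\<^bsub>pspace B t\<^esub> \<in> carrier (pspace B t)"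
        by (rule submodule_zero_mem[OF persistence_moduleD(1)[OF B] module.carrier_is_submodule[OF persistence_moduleD(1)[OF B]]])
      then show ?thesis
        using False c by (auto simp: interval_module_simps)
    qed
  qed (use linear_mapsD(1)[OF p_lin] in blast)
  have g: "pers_morphism K (interval_module K I) (interval_module K I) (\<lambda>_ x. x)"
    by (simp add: pers_morphism_def linear_maps_id)
  \<comment> \<open>The target of the cover has its elements in \<open>'k\<close>, which reaches the
    universe through constant functions.\<close>
  have "inj (\<lambda>c. e (\<lambda>_. c))"
    using e by (auto simp: inj_def fun_eq_iff)
  then obtain h where h: "pers_morphism K (interval_module K I) B h"
    and ph: "\<And>t x. x \<in> carrier (pspace (interval_module K I) t) \<Longrightarrow> ?p t (h t x) = x"
    by (rule projective_pers_lift[OF proj e _ B C p epi g]) blast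
  have one: "\<one>\<^bsub>K\<^esub> \<in> carrier (pspace (interval_module K I) t)" if "t \<in> I" for t
    using that by (simp add: interval_module_simps)
  obtain t1 where t1: "t1 \<in> I"
    using I by auto
  define u where "u = h t1 \<one>\<^bsub>K\<^esub>"
  have le: "h t \<one>\<^bsub>K\<^esub> = h s \<one>\<^bsub>K\<^esub>" if "s \<in> I" "t \<in> I" "s \<le> t" for s t
    using pers_morphismD(2)[OF h that(3) one[OF that(1)]] that by (simp add: interval_module_simps Bs)
  have hu: "h t \<one>\<^bsub>K\<^esub> = u" if "t \<in> I" for t
    unfolding u_def using le[OF that t1] le[OF t1 that] linear[of t t1] by auto
  have "u \<noteq> (\<lambda>_. \<zero>\<^bsub>K\<^esub>)"
    using ph[OF one[OF t1]] t1 S0 by (auto simp: u_def)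
  then obtain m where m: "u m \<noteq> \<zero>\<^bsub>K\<^esub>"
    by auto
  \<comment> \<open>The same \<open>u\<close> lies in the cover in every degree of \<open>I\<close>,
    so the point \<open>m\<close> of its support belongs to \<open>I\<close> and is a lower bound of
    it.\<close>
  have um: "m \<in> I \<and> m \<le> t" if "t \<in> I" for t
    using pers_morphismD(3)[OF h one[OF that]] hu[OF that] m by (auto simp: Bs direct_sum_carrier)
  have mI: "m \<in> I"
    using um[OF t1] by simp
  \<comment> \<open>There is no upper end either: beyond it the section would have to send 0 to
    \<open>u\<close>, because the transition maps of the cover never annihilate
    \<open>u\<close>.\<close>
  have "t \<in> I" if "m \<le> t" for t
  proof (rule ccontr)
    assume t: "t \<notin> I"
    have "h t (ptrans (interval_module K I) m t \<one>\<^bsub>K\<^esub>) = u"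
      using pers_morphismD(2)[OF h that one[OF mI]] hu[OF mI] by (simp add: Bs)
    moreover have "h t \<zero>\<^bsub>K\<^esub> = (\<lambda>_. \<zero>\<^bsub>K\<^esub>)"
      using linear_maps_zero_minus(1)[OF persistence_moduleD(1)[OF C] persistence_moduleD(1)[OF B]
          pers_morphismD(1)[OF h], of t] by (simp add: interval_module_simps Bs direct_sum_simps)
    ultimately have "u = (\<lambda>_. \<zero>\<^bsub>K\<^esub>)"
      using t by (simp add: interval_module_simps)
    then show False
      using m by simp
  qed
  then have "I = {m..}"
    using um by auto
  then show ?thesis ..
qed

text \<open>
  With \<open>b = t' - t\<close>, the inclusion of \<open>k[b, \<infinity>)\<close> into \<open>k[0, \<infinity>)\<close>
  becomes in degree \<open>t'\<close> the transition map of \<open>k[I]\<close> from \<open>t\<close> to \<open>t'\<close>.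
\<close>

lemma not_flat_interval_module:
  fixes U :: "'v itself" and K :: "('k, 'x) ring_scheme" and e :: "'k \<Rightarrow> 'v"
  assumes K: "field K" and e: "inj e" and I: "is_interval I"
    and t: "t \<in> I" and t': "t' \<notin> I" "t < t'"
  shows "\<not> flat_pers U K (interval_module K I)"
proof
  assume flat: "flat_pers U K (interval_module K I)"
  interpret field K by (rule K)
  define b where "b = t' - t"
  have b: "0 < b"
    using t' by (simp add: b_def)
  \<comment> \<open>The cokernel k[0, b) completes the inclusion to a short exact sequence, the form
    in which \<open>flat_pers\<close> can be applied.\<close>
  let ?A = "interval_module K {b..}" and ?B = "interval_module K {0..}" and ?C = "interval_module K {0..<b}"
    and ?M = "interval_module K I"
  note pers = interval_module_persistence_module[OF K]
  have A: "persistence_module K ?A" and B: "persistence_module K ?B" and C: "persistence_module K ?C"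
    by (auto intro!: pers simp: is_interval_1)
  have M: "persistence_module K ?M"
    by (rule pers[OF I])
  let ?f = "\<lambda>s x. if s \<in> {b..} \<and> s \<in> {0..} then x else \<zero>\<^bsub>K\<^esub>"
    and ?g = "\<lambda>s x. if s \<in> {0..} \<and> s \<in> {0..<b} then x else \<zero>\<^bsub>K\<^esub>"
  have f: "pers_morphism K ?A ?B ?f"
    using b by (intro interval_module_morphism K) auto
  have g: "pers_morphism K ?B ?C ?g"
    using b by (intro interval_module_morphism K) auto
  let ?tA = "transport_pers e ?A" and ?tB = "transport_pers e ?B" and ?tC = "transport_pers e ?C"
  let ?tf = "\<lambda>s x. e (?f s (inv_into UNIV e x))" and ?tg = "\<lambda>s x. e (?g s (inv_into UNIV e x))"
  note tA = transport_persistence_module[OF e A] and tB = transport_persistence_module[OF e B]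
    and tC = transport_persistence_module[OF e C]
  have tf: "pers_morphism K ?tA ?tB ?tf" and tg: "pers_morphism K ?tB ?tC ?tg"
    using pers_morphism_comp[OF pers_morphism_comp[OF transport_morphism(2)[OF e A] f] transport_morphism(1)[OF e B]]
      pers_morphism_comp[OF pers_morphism_comp[OF transport_morphism(2)[OF e B] g] transport_morphism(1)[OF e C]] .
  have "short_exact ?tA ?tf ?tB ?tg ?tC"
    by (rule short_exact_transport[OF e])
      (use b in \<open>auto simp: short_exact_def pers_mono_def pers_epi_def interval_module_simps inj_on_def image_iff\<close>)
  then have "short_exact (graded_tensor K ?tA ?M) (graded_tensor_map K ?tB ?M ?tf)
      (graded_tensor K ?tB ?M) (graded_tensor_map K ?tC ?M ?tg) (graded_tensor K ?tC ?M)"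
    using flat tA tB tC tf tg unfolding flat_pers_def by blast
  then have inj: "inj_on (graded_tensor_map K ?tB ?M ?tf t') (carrier (pspace (graded_tensor K ?tA ?M) t'))"
    by (simp add: short_exact_def pers_mono_def)
  interpret TA: graded_pair K ?tA ?M by (intro graded_pair.intro tA M)
  interpret TB: graded_pair K ?tB ?M by (intro graded_pair.intro tB M)
  interpret A': Module.module K "pspace (graded_tensor K ?tA ?M) t'" by (rule TA.graded_tensor_module)
  have bt: "b + t \<le> t'"
    by (simp add: b_def)
  have x: "e \<one>\<^bsub>K\<^esub> \<in> carrier (pspace ?tA b)" "e \<one>\<^bsub>K\<^esub> \<in> carrier (pspace ?tB 0)"
    by (auto simp: transport_pers_simps transport_space_simps interval_module_simps)
  have y: "\<one>\<^bsub>K\<^esub> \<in> carrier (pspace ?M t)"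
    using t by (simp add: interval_module_simps)
  \<comment> \<open>\<open>?v\<close> sits at the index (b, t), on the boundary b + t = t'. In
    \<open>?A\<close> nonzero first factors have degree at least \<open>b\<close>, which confines
    the second factor to degrees up to \<open>t\<close>. In \<open>?B\<close> the first factor comes
    from degree 0, and this leaves room to push the second one to t', outside
    \<open>I\<close>.\<close>
  let ?v = "graded_pure K ?tA ?M t' b t (e \<one>\<^bsub>K\<^esub>) \<one>\<^bsub>K\<^esub>"
  have v: "?v \<in> carrier (pspace (graded_tensor K ?tA ?M) t')"
    by (rule bilinear_mapD(1)[OF TA.graded_pure_bilinear[OF bt] x(1) y])
  have "graded_tensor_map K ?tB ?M ?tf t' ?v = graded_pure K ?tB ?M t' b t (e \<one>\<^bsub>K\<^esub>) \<one>\<^bsub>K\<^esub>"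
    using graded_tensor_map(2)[OF tA tB M tf bt x(1) y] b e by simp
  also have "\<dots> = graded_pure K ?tB ?M t' 0 t (e \<one>\<^bsub>K\<^esub>) \<one>\<^bsub>K\<^esub>"
    using TB.graded_pure_compat[of 0 b t t t' "e \<one>\<^bsub>K\<^esub>" "\<one>\<^bsub>K\<^esub>"] b bt x(2) y t e
    by (simp add: transport_pers_simps interval_module_simps)
  also have "\<dots> = graded_pure K ?tB ?M t' 0 t' (e \<one>\<^bsub>K\<^esub>) \<zero>\<^bsub>K\<^esub>"
    using TB.graded_pure_compat[of 0 0 t t' t' "e \<one>\<^bsub>K\<^esub>" "\<one>\<^bsub>K\<^esub>"] t' x(2) y t e
    by (simp add: transport_pers_simps interval_module_simps)
  also have "\<dots> = \<zero>\<^bsub>pspace (graded_tensor K ?tB ?M) t'\<^esub>"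
  proof -
    have "graded_pure K ?tB ?M t' 0 t' (e \<one>\<^bsub>K\<^esub>) \<in> linear_maps K (pspace ?M t') (pspace (graded_tensor K ?tB ?M) t')"
      using TB.graded_pure_bilinear[of 0 t' t'] x(2) by (simp add: bilinear_map_def)
    from linear_maps_zero_minus(1)[OF TB.Nmod TB.graded_tensor_module this] show ?thesis
      by (simp add: interval_module_simps)
  qed
  also have "\<dots> = graded_tensor_map K ?tB ?M ?tf t' \<zero>\<^bsub>pspace (graded_tensor K ?tA ?M) t'\<^esub>"
    using linear_maps_zero_minus(1)[OF TA.graded_tensor_module TB.graded_tensor_module
        graded_tensor_map(1)[OF tA tB M tf]] by simp
  finally have v0: "?v = \<zero>\<^bsub>pspace (graded_tensor K ?tA ?M) t'\<^esub>"
    using inj_onD[OF inj _ v A'.M.zero_closed] by simp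
  \<comment> \<open>A functional that detects \<open>?v\<close>. For b \<le> s and s + r \<le> t'
    one has r \<le> t, so by convexity the relevant transitions that start in \<open>I\<close> stay
    in \<open>I\<close> and the product of the two vectors is preserved.\<close>
  let ?\<beta> = "\<lambda>s r x y. if b \<le> s \<and> r \<in> I \<and> s + r \<le> t' then inv_into UNIV e x \<otimes>\<^bsub>K\<^esub> y else \<zero>\<^bsub>K\<^esub>"
  have convex: "r \<in> I" if "r' \<in> I" "r' \<le> r" "r \<le> t" for r r'
    using is_interval_between[OF I \<open>r' \<in> I\<close> t] that by simp
  obtain h where h: "h \<in> linear_maps K (pspace (graded_tensor K ?tA ?M) t') (regular_space K)"
    and h_pure: "\<And>s r x y. s + r \<le> t' \<Longrightarrow> x \<in> carrier (pspace ?tA s) \<Longrightarrow> y \<in> carrier (pspace ?M r) \<Longrightarrow>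
      h (graded_pure K ?tA ?M t' s r x y) = ?\<beta> s r x y"
  proof (rule TA.graded_tensor_universal[OF regular_space_module[OF is_cring], of t' ?\<beta>])
    show "bilinear_map K (pspace ?tA s) (pspace ?M r) (regular_space K) (?\<beta> s r)" for s r
      using e by (auto simp: bilinear_map_def linear_maps_def transport_pers_simps transport_space_simps
          interval_module_simps l_distr r_distr m_assoc m_lcomm)
    fix s r s' r' x y
    assume le: "s \<le> s'" "r \<le> r'" "s' + r' \<le> t'" and x: "x \<in> carrier (pspace ?tA s)"
      and y: "y \<in> carrier (pspace ?M r)"
    show "?\<beta> s' r' (ptrans ?tA s s' x) (ptrans ?M r r' y) = ?\<beta> s r x y"
    proof (cases "b \<le> s \<and> r \<in> I")
      case True
      then have "r' \<in> I"
        using convex[of r r'] le by (simp add: b_def)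
      then show ?thesis
        using True le e x y by (auto simp: transport_pers_simps interval_module_simps)
    next
      case False
      then show ?thesis
        using le e x y by (auto simp: transport_pers_simps transport_space_simps interval_module_simps)
    qed
  qed blast
  have "h ?v = \<one>\<^bsub>K\<^esub>"
    using h_pure[OF bt x(1) y] bt t e by simp
  moreover have "h ?v = \<zero>\<^bsub>K\<^esub>"
    using linear_maps_zero_minus(1)[OF TA.graded_tensor_module regular_space_module[OF is_cring] h] v0 by simp
  ultimately show False
    by simp
qed


section \<open>The module \<open>k[a, \<infinity>)\<close>\<close>

text \<open>A morphism out of k[a, \<infinity>) amounts to a vector in degree \<open>a\<close>, the
  image of 1; it is enough to lift that one vector through the surjection.\<close>

lemma projective_interval_module:
  fixes U :: "'v itself" and K :: "('k, 'x) ring_scheme"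
  assumes K: "field K"
  shows "projective_pers U K (interval_module K {a..})"
  unfolding projective_pers_def
proof (intro allI impI; elim conjE)
  interpret field K by (rule K)
  fix B C :: "('k, 'v) pers" and p g
  assume B: "persistence_module K B" and C: "persistence_module K C"
    and p: "pers_morphism K B C p" and epi: "pers_epi B C p"
    and g: "pers_morphism K (interval_module K {a..}) C g"
  interpret B: Module.module K "pspace B t" for t by (rule persistence_moduleD(1)[OF B])
  note trB = linear_mapsD[OF persistence_moduleD(2)[OF B]]
  have one: "\<one>\<^bsub>K\<^esub> \<in> carrier (pspace (interval_module K {a..}) a)"
    by (simp add: interval_module_simps)
  have "g a \<one>\<^bsub>K\<^esub> \<in> p a ` carrier (pspace B a)"
    using epi pers_morphismD(3)[OF g one] by (simp add: pers_epi_def)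
  then obtain b where b: "b \<in> carrier (pspace B a)" "g a \<one>\<^bsub>K\<^esub> = p a b"
    by auto
  let ?h = "\<lambda>t c. if a \<le> t then c \<odot>\<^bsub>pspace B t\<^esub> ptrans B a t b else \<zero>\<^bsub>pspace B t\<^esub>"
  have "?h t \<in> linear_maps K (pspace (interval_module K {a..}) t) (pspace B t)" for t
    using trB(1)[OF _ b(1)]
    by (intro linear_mapsI) (auto simp: interval_module_simps B.smult_l_distr B.smult_assoc1)
  moreover have "?h t (ptrans (interval_module K {a..}) s t c) = ptrans B s t (?h s c)"
    if "s \<le> t" "c \<in> carrier (pspace (interval_module K {a..}) s)" for s t c
    using that b(1) trB persistence_moduleD(4)[OF B _ _ b(1)]
      linear_maps_zero_minus(1)[OF persistence_moduleD(1)[OF B] persistence_moduleD(1)[OF B]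
        persistence_moduleD(2)[OF B that(1)]]
    by (auto simp: interval_module_simps)
  ultimately have "pers_morphism K (interval_module K {a..}) B ?h"
    by (auto simp: pers_morphism_def)
  moreover have "p t (?h t c) = g t c" if c: "c \<in> carrier (pspace (interval_module K {a..}) t)" for t c
  proof (cases "a \<le> t")
    case True
    then have cK: "c \<in> carrier K"
      using c by (simp add: interval_module_simps)
    have "p t (?h t c) = c \<odot>\<^bsub>pspace C t\<^esub> p t (ptrans B a t b)"
      using True cK trB(1)[OF True b(1)] linear_mapsD(3)[OF pers_morphismD(1)[OF p]] by simp
    also have "p t (ptrans B a t b) = g t (ptrans (interval_module K {a..}) a t \<one>\<^bsub>K\<^esub>)"
      using pers_morphismD(2)[OF p True b(1)] pers_morphismD(2)[OF g True one] b(2) by simp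
    also have "ptrans (interval_module K {a..}) a t \<one>\<^bsub>K\<^esub> = \<one>\<^bsub>K\<^esub>"
      using True by (simp add: interval_module_simps)
    also have "c \<odot>\<^bsub>pspace C t\<^esub> g t \<one>\<^bsub>K\<^esub> = g t (c \<odot>\<^bsub>pspace (interval_module K {a..}) t\<^esub> \<one>\<^bsub>K\<^esub>)"
      by (rule linear_mapsD(3)[OF pers_morphismD(1)[OF g] cK, symmetric])
        (use True in \<open>simp add: interval_module_simps\<close>)
    finally show ?thesis
      using cK by (simp add: interval_module_simps)
  next
    case False
    have M: "Module.module K (pspace (interval_module K {a..}) t)"
      by (rule persistence_moduleD(1)[OF interval_module_persistence_module[OF K]]) (simp add: is_interval_1)
    have "c = \<zero>\<^bsub>pspace (interval_module K {a..}) t\<^esub>"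
      using False c by (simp add: interval_module_simps)
    then show ?thesis
      using False linear_maps_zero_minus(1)[OF persistence_moduleD(1)[OF B] persistence_moduleD(1)[OF C] pers_morphismD(1)[OF p], of t]
        linear_maps_zero_minus(1)[OF M persistence_moduleD(1)[OF C] pers_morphismD(1)[OF g]] by simp
  qed
  ultimately show "\<exists>h. pers_morphism K (interval_module K {a..}) B h \<and>
      (\<forall>t. \<forall>x\<in>carrier (pspace (interval_module K {a..}) t). p t (h t x) = g t x)"
    by blast
qed

text \<open>Multiplying the generator \<open>v0\<close>, the 1 in degree \<open>a\<close>, by p
  gives the coefficient function of p shifted by \<open>a\<close>. Shifting is a bijection from the
  monoid ring onto the graded module, so \<open>v0\<close> alone is a basis.\<close>

lemma graded_free_interval_module:
  fixes K :: "('k, 'x) ring_scheme"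
  assumes K: "field K"
  shows "graded_free K (interval_module K {a..})"
proof -
  interpret field K by (rule K)
  let ?M = "interval_module K {a..}"
  let ?V = "graded_module K ?M" and ?S = "direct_sum UNIV (pspace ?M)"
  have M: "persistence_module K ?M"
    by (rule interval_module_persistence_module[OF K]) (simp add: is_interval_1)
  interpret M: Module.module K "pspace ?M t" for t by (rule persistence_moduleD(1)[OF M])
  interpret S: Module.module K ?S
    by (rule direct_sum_module[OF is_cring persistence_moduleD(1)[OF M]])
  have car: "v \<in> carrier ?V \<longleftrightarrow> (\<forall>r. v r \<in> carrier K) \<and> (\<forall>r<a. v r = \<zero>\<^bsub>K\<^esub>) \<and> finite {r. v r \<noteq> \<zero>\<^bsub>K\<^esub>}" for v
  proof -
    have "v r \<in> (if r \<in> {a..} then carrier K else {\<zero>\<^bsub>K\<^esub>}) \<longleftrightarrow> v r \<in> carrier K \<and> (r < a \<longrightarrow> v r = \<zero>\<^bsub>K\<^esub>)" for r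
      by auto
    then show ?thesis
      by (simp add: graded_module_def direct_sum_carrier interval_module_simps) blast
  qed
  \<comment> \<open>A finite sum depends only on carrier, zero and addition, which the graded module
    shares with the direct sum; so it can be computed in the latter, a vector space over
    \<open>K\<close>.\<close>
  have finsum: "finsum ?V f F = finsum ?S f F" for f and F :: "'b set"
    by (simp add: graded_module_def finsum_def finprod_def)
  define v0 :: "real \<Rightarrow> 'k" where "v0 = (\<lambda>_. \<zero>\<^bsub>K\<^esub>)(a := \<one>\<^bsub>K\<^esub>)"
  define shift where "shift p = (\<lambda>r. if a \<le> r then p (r - a) else \<zero>\<^bsub>K\<^esub>)" for p :: "real \<Rightarrow> 'k"
  have smult: "p \<odot>\<^bsub>?V\<^esub> v0 = shift p" if p: "p \<in> carrier (monoid_ring K)" for p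
  proof
    fix r
    have fin: "finite {s. p s \<noteq> \<zero>\<^bsub>K\<^esub>}" and pK: "p s \<in> carrier K" and neg: "s < 0 \<Longrightarrow> p s = \<zero>\<^bsub>K\<^esub>" for s
      using p by (auto simp: monoid_ring_def)
    let ?t = "\<lambda>s. p s \<odot>\<^bsub>pspace ?M r\<^esub> ptrans ?M (r - s) r (v0 (r - s))"
    \<comment> \<open>\<open>v0\<close> lives in degree \<open>a\<close> only, so just the exponent
      s = r - a contributes. For r < a this exponent is negative and has coefficient zero, in
      agreement with \<open>shift\<close>.\<close>
    have t: "?t s = (if r - a = s then shift p r else \<zero>\<^bsub>K\<^esub>)" for s
      using pK[of s] neg[of s] by (auto simp: interval_module_simps v0_def shift_def)
    have closed: "shift p r \<in> carrier (pspace ?M r)"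
      using pK by (simp add: shift_def interval_module_simps)
    have "(p \<odot>\<^bsub>?V\<^esub> v0) r = (\<Oplus>\<^bsub>pspace ?M r\<^esub>s\<in>{s. p s \<noteq> \<zero>\<^bsub>K\<^esub>}. ?t s)"
      by (simp add: graded_module_def)
    also have "\<dots> = (\<Oplus>\<^bsub>pspace ?M r\<^esub>s\<in>{s. p s \<noteq> \<zero>\<^bsub>K\<^esub>}. if r - a = s then shift p r else \<zero>\<^bsub>pspace ?M r\<^esub>)"
      using closed M.M.zero_closed[of r, unfolded interval_module_simps(2)]
      by (intro M.M.finsum_cong') (auto simp: t interval_module_simps(2))
    also have "\<dots> = shift p r"
    \<comment> \<open>If this coefficient is zero, \<open>r - a\<close> is missing from the index
      set and all terms of the sum are zero.\<close>
    proof (cases "p (r - a) = \<zero>\<^bsub>K\<^esub>")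
      case True
      then have "(\<Oplus>\<^bsub>pspace ?M r\<^esub>s\<in>{s. p s \<noteq> \<zero>\<^bsub>K\<^esub>}. if r - a = s then shift p r else \<zero>\<^bsub>pspace ?M r\<^esub>) =
          (\<Oplus>\<^bsub>pspace ?M r\<^esub>s\<in>{s. p s \<noteq> \<zero>\<^bsub>K\<^esub>}. \<zero>\<^bsub>pspace ?M r\<^esub>)"
        by (intro M.M.finsum_cong') auto
      also have "\<dots> = shift p r"
        using True M.M.finsum_zero[of r "{s. p s \<noteq> \<zero>\<^bsub>K\<^esub>}"] by (simp add: shift_def interval_module_simps(2))
      finally show ?thesis .
    next
      case False
      then show ?thesis
        using M.M.finsum_singleton[of "r - a" "{s. p s \<noteq> \<zero>\<^bsub>K\<^esub>}" "\<lambda>_. shift p r" r] fin closed by simp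
    qed
    finally show "(p \<odot>\<^bsub>?V\<^esub> v0) r = shift p r" .
  qed
  have shift_closed: "shift p \<in> carrier ?V" if p: "p \<in> carrier (monoid_ring K)" for p
  proof -
    have "{r. shift p r \<noteq> \<zero>\<^bsub>K\<^esub>} \<subseteq> (\<lambda>s. s + a) ` {s. p s \<noteq> \<zero>\<^bsub>K\<^esub>}"
      by (auto simp: shift_def image_iff) (metis diff_add_cancel)
    then show ?thesis
      using p finite_subset by (auto simp: car monoid_ring_def) (auto simp: shift_def)
  qed
  have comb: "(\<Oplus>\<^bsub>?V\<^esub>b\<in>{b. c b \<noteq> \<zero>\<^bsub>monoid_ring K\<^esub>}. c b \<odot>\<^bsub>?V\<^esub> b) = shift (c v0)"
    if c: "c v0 \<in> carrier (monoid_ring K)" "\<And>b. b \<noteq> v0 \<Longrightarrow> c b = \<zero>\<^bsub>monoid_ring K\<^esub>" for c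
  proof (cases "c v0 = \<zero>\<^bsub>monoid_ring K\<^esub>")
    case True
    then have "{b. c b \<noteq> \<zero>\<^bsub>monoid_ring K\<^esub>} = {}"
      using c(2) by (metis (mono_tags, lifting) Collect_empty_eq)
    then show ?thesis
      using True by (simp add: finsum shift_def monoid_ring_def direct_sum_simps interval_module_simps)
  next
    case False
    then have "{b. c b \<noteq> \<zero>\<^bsub>monoid_ring K\<^esub>} = {v0}"
      using c(2) by auto
    then show ?thesis
      using smult[OF c(1)] shift_closed[OF c(1)] by (simp add: finsum) (simp add: graded_module_def)
  qed
  have "module_basis (monoid_ring K) ?V {v0}"
    unfolding module_basis_def
  proof (intro conjI ballI)
    show "{v0} \<subseteq> carrier ?V"
      by (auto simp: car v0_def)
    fix v assume v: "v \<in> carrier ?V"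
    \<comment> \<open>The inverse of \<open>shift\<close>: exponents start at 0 where degrees start
      at \<open>a\<close>.\<close>
    define p where "p s = (if 0 \<le> s then v (s + a) else \<zero>\<^bsub>K\<^esub>)" for s
    have "{s. p s \<noteq> \<zero>\<^bsub>K\<^esub>} \<subseteq> (\<lambda>r. r - a) ` {r. v r \<noteq> \<zero>\<^bsub>K\<^esub>}"
      by (auto simp: p_def image_iff split: if_splits) (metis add_diff_cancel_right')
    then have p: "p \<in> carrier (monoid_ring K)"
      using v finite_subset by (auto simp: car monoid_ring_def) (auto simp: p_def)
    have shift_p: "shift p = v"
      using v by (auto simp: shift_def p_def car fun_eq_iff)
    define c0 where "c0 = (\<lambda>b. if b = v0 then p else \<zero>\<^bsub>monoid_ring K\<^esub>)"
    show "\<exists>!c. (\<forall>b\<in>{v0}. c b \<in> carrier (monoid_ring K)) \<and>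
        (\<forall>b. b \<notin> {v0} \<longrightarrow> c b = \<zero>\<^bsub>monoid_ring K\<^esub>) \<and> finite {b. c b \<noteq> \<zero>\<^bsub>monoid_ring K\<^esub>} \<and>
        v = (\<Oplus>\<^bsub>?V\<^esub>b\<in>{b. c b \<noteq> \<zero>\<^bsub>monoid_ring K\<^esub>}. c b \<odot>\<^bsub>?V\<^esub> b)"
    proof (rule ex1I[of _ c0])
      have "{b. c0 b \<noteq> \<zero>\<^bsub>monoid_ring K\<^esub>} \<subseteq> {v0}"
        by (auto simp: c0_def)
      then have "finite {b. c0 b \<noteq> \<zero>\<^bsub>monoid_ring K\<^esub>}"
        by (rule finite_subset) simp
      then show "(\<forall>b\<in>{v0}. c0 b \<in> carrier (monoid_ring K)) \<and>
          (\<forall>b. b \<notin> {v0} \<longrightarrow> c0 b = \<zero>\<^bsub>monoid_ring K\<^esub>) \<and> finite {b. c0 b \<noteq> \<zero>\<^bsub>monoid_ring K\<^esub>} \<and>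
          v = (\<Oplus>\<^bsub>?V\<^esub>b\<in>{b. c0 b \<noteq> \<zero>\<^bsub>monoid_ring K\<^esub>}. c0 b \<odot>\<^bsub>?V\<^esub> b)"
        using p shift_p comb[of c0] by (simp add: c0_def)
    next
      fix c assume c: "(\<forall>b\<in>{v0}. c b \<in> carrier (monoid_ring K)) \<and>
          (\<forall>b. b \<notin> {v0} \<longrightarrow> c b = \<zero>\<^bsub>monoid_ring K\<^esub>) \<and> finite {b. c b \<noteq> \<zero>\<^bsub>monoid_ring K\<^esub>} \<and>
          v = (\<Oplus>\<^bsub>?V\<^esub>b\<in>{b. c b \<noteq> \<zero>\<^bsub>monoid_ring K\<^esub>}. c b \<odot>\<^bsub>?V\<^esub> b)"
      then have "v = shift (c v0)"
        using comb[of c] by simp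
      then have "c v0 = p"
        using c by (auto simp: p_def shift_def monoid_ring_def)
      then show "c = c0"
        unfolding c0_def by (intro ext[of c]) (use c in auto)
    qed
  qed
  moreover have "homogeneous ?M v0"
    by (auto simp: homogeneous_def v0_def interval_module_simps)
  ultimately show ?thesis
    by (auto simp: graded_free_def)
qed

section \<open>The four families of intervals\<close>

theorem theorem1p2:
  fixes K :: "('k, 'x) ring_scheme" and a :: real and U :: "('k, 'u) universe itself"
  assumes "field K"
  shows
    "(injective_pers U K (interval_module K {..<a}) \<and>
      injective_pers U K (interval_module K {..a}) \<and>
      \<not> flat_pers U K (interval_module K {..<a}) \<and>
      \<not> flat_pers U K (interval_module K {..a}) \<and>
      \<not> projective_pers U K (interval_module K {..<a}) \<and>
      \<not> projective_pers U K (interval_module K {..a})) \<and>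
     (projective_pers U K (interval_module K {a..}) \<and>
      graded_free K (interval_module K {a..}) \<and>
      flat_pers U K (interval_module K {a<..}) \<and>
      \<not> projective_pers U K (interval_module K {a<..}) \<and>
      \<not> injective_pers U K (interval_module K {a..}) \<and>
      \<not> injective_pers U K (interval_module K {a<..})) \<and>
     (injective_pers U K (interval_module K UNIV) \<and>
      flat_pers U K (interval_module K UNIV) \<and>
      \<not> projective_pers U K (interval_module K UNIV)) \<and>
     (\<forall>I. I \<noteq> {} \<and> bounded I \<and> is_interval I \<longrightarrow>
        \<not> flat_pers U K (interval_module K I) \<and>
        \<not> projective_pers U K (interval_module K I) \<and>
        \<not> injective_pers U K (interval_module K I))"
proof -
  let ?e = "Inr :: (real \<Rightarrow> 'k) \<Rightarrow> ('k, 'u) universe"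
  \<comment> \<open>The second summand of the universe contains a copy of \<open>K\<close>, the
    constant functions.\<close>
  let ?c = "\<lambda>x. ?e (\<lambda>_. x)"
  have e: "inj ?e" and c: "inj ?c"
    by (auto simp: inj_def fun_eq_iff)
  have injective: "injective_pers U K (interval_module K D)"
    if "D \<noteq> {}" "\<And>s t. t \<in> D \<Longrightarrow> s \<le> t \<Longrightarrow> s \<in> D" for D
    using injective_interval_module[OF assms that] .
  have flat: "flat_pers U K (interval_module K I)"
    if "I \<noteq> {}" "\<And>s t. s \<in> I \<Longrightarrow> s \<le> t \<Longrightarrow> t \<in> I" for I
    using up_interval.flat[OF up_interval.intro[OF assms that]] .
  have not_projective: "\<not> projective_pers U K (interval_module K I)"
    if "is_interval I" "I \<noteq> {}" "\<And>m. I \<noteq> {m..}" for I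
    using projective_interval_module_imp[OF assms e that(1,2)] that(3) by blast
  note not_injective = not_injective_interval_module[OF assms c, where U = U]
    and not_flat = not_flat_interval_module[OF assms c, where U = U]
  \<comment> \<open>{m..} has a least element; density of the reals rules this out for
    {a<..}.\<close>
  have gt: "{a<..} \<noteq> {m..}" for m
    using dense[of a m] by (metis atLeast_iff greaterThan_iff not_le order_refl)
  have lt: "{..<a} \<noteq> {m..}" "{..a} \<noteq> {m..}" "UNIV \<noteq> {m..}" for m
  proof -
    \<comment> \<open>A point of {m..} above \<open>a\<close> separates it from both rays that end
      at \<open>a\<close>, and m - 1 separates it from the whole line.\<close>
    have "max m (a + 1) \<in> {m..}" "max m (a + 1) \<notin> {..a}" "m - 1 \<notin> {m..}"
      by auto
    then show "{..<a} \<noteq> {m..}" "{..a} \<noteq> {m..}" "UNIV \<noteq> {m..}"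
      by (metis atMost_iff lessThan_iff less_imp_le, metis, metis UNIV_I)
  qed
  have bdd: "\<not> flat_pers U K (interval_module K I) \<and> \<not> projective_pers U K (interval_module K I) \<and>
      \<not> injective_pers U K (interval_module K I)" if I: "I \<noteq> {}" "bounded I" "is_interval I" for I
  proof -
    obtain B where B: "\<And>x. x \<in> I \<Longrightarrow> \<bar>x\<bar> \<le> B"
      using I(2) by (auto simp: bounded_iff)
    obtain t where t: "t \<in> I"
      using I(1) by auto
    \<comment> \<open>Points outside \<open>I\<close> on either side of \<open>t\<close>: the upper
      one refutes flatness, the lower one injectivity.\<close>
    have out: "B + 1 \<notin> I" "- B - 1 \<notin> I"
      using B[of "B + 1"] B[of "- B - 1"] by auto
    have "I \<noteq> {m..}" for m
      using B[of "max m (B + 1)"] by auto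
    then show ?thesis
      using not_projective[OF I(3,1)] not_flat[OF I(3) t out(1)] not_injective[OF I(3) t out(2)] B[OF t]
      by auto
  qed
  show ?thesis
  proof (intro conjI)
    show "injective_pers U K (interval_module K {..<a})" "injective_pers U K (interval_module K {..a})"
      "injective_pers U K (interval_module K UNIV)"
      by (rule injective; auto intro: lt_ex)+
    show "flat_pers U K (interval_module K {a<..})" "flat_pers U K (interval_module K UNIV)"
      by (rule flat; auto intro: gt_ex)+
    \<comment> \<open>Whether or not \<open>a\<close> belongs to the ray, a - 1 lies in it and a + 1
      does not.\<close>
    show "\<not> flat_pers U K (interval_module K {..<a})" "\<not> flat_pers U K (interval_module K {..a})"
      by (rule not_flat[of _ "a - 1" "a + 1"]; simp add: is_interval_1)+
    show "\<not> injective_pers U K (interval_module K {a..})" "\<not> injective_pers U K (interval_module K {a<..})"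
      by (rule not_injective[of _ "a + 1" "a - 1"]; simp add: is_interval_1)+
    show "\<not> projective_pers U K (interval_module K {..<a})" "\<not> projective_pers U K (interval_module K {..a})"
      "\<not> projective_pers U K (interval_module K {a<..})" "\<not> projective_pers U K (interval_module K UNIV)"
      by (rule not_projective; use lt gt in \<open>simp add: is_interval_1\<close>)+
  qed (use bdd projective_interval_module[OF assms, of U a] graded_free_interval_module[OF assms, of a]
      in blast)+
qed

end
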